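(* Let $f(n,s)$ be as defined in the context. Then, as $n\to\infty$ (with $s=s(n)$), \[ f(n,s)=\begin{cases} O(n/s) & \text{for } n^{1/3}\le s\le n,\\ O\!\left(n^{5/6+o(1)}/\sqrt{s}\right) & \text{for } 3\le s\le n^{1/3}.\end{cases} \] In particular, $f(n,s)=\Theta(n/s)$ when $s=\Omega(\sqrt{n\log n})$.
   Context: For $n,s\in\mathbb{N}$ with $n\ge s\ge 2$, $f(n,s)$ denotes the largest integer such that every set $P\subseteq\mathbb{R}^2$ of $n$ points with at most $s$ points on any line (i.e., containing no $s+1$ collinear points) contains a subset of size $f(n,s)$ in general position, i.e., containing no three collinear points. Here $s=s(n)$ may depend on $n$, and asymptotic notation refers to $n\to\infty$. *)

theory Defs
  imports "HOL-Analysis.Analysis" "HOL-Library.Landau_Symbols"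
begin

definition no_collinear :: "nat \<Rightarrow> (real ^ 2) set \<Rightarrow> bool" where
  "no_collinear k P \<longleftrightarrow> (\<forall>T. T \<subseteq> P \<and> card T = k \<longrightarrow> \<not> collinear T)"

definition general_position :: "(real ^ 2) set \<Rightarrow> bool" where
  "general_position P \<longleftrightarrow> no_collinear 3 P"

definition forces_general_position :: "nat \<Rightarrow> nat \<Rightarrow> nat \<Rightarrow> bool" where
  "forces_general_position n s k \<longleftrightarrow>
     (\<forall>P :: (real ^ 2) set. finite P \<and> card P = n \<and> no_collinear (s + 1) P \<longrightarrow>
        (\<exists>Q. Q \<subseteq> P \<and> card Q = k \<and> general_position Q))"

definition f :: "nat \<Rightarrow> nat \<Rightarrow> nat" where
  "f n s = (GREATEST k. forces_general_position n s k)"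

text \<open>For \<open>s \<ge> 2\<close> the maximum defining \<open>f n s\<close> exists: \<open>k = 0\<close> always qualifies,
  and \<open>n\<close> points on a parabola show that every qualifying \<open>k\<close> is at most \<open>n\<close>.\<close>

lemma no_collinear_mono:
  assumes "no_collinear k P" "k \<le> m" "0 < m"
  shows "no_collinear m P"
  unfolding no_collinear_def
proof (intro allI impI notI)
  fix T assume T: "T \<subseteq> P \<and> card T = m" and c: "collinear T"
  obtain U where "U \<subseteq> T" "card U = k"
    using T assms(2) by (metis obtain_subset_with_card_n)
  then show False
    using assms(1) T c collinear_subset unfolding no_collinear_def by blast
qed

lemma ex_general_position:
  "\<exists>P :: (real ^ 2) set. finite P \<and> card P = n \<and> general_position P"
proof -
  define g :: "nat \<Rightarrow> real ^ 2" where "g i = vector [real i, (real i)\<^sup>2]" for i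
  have g: "g i $ 1 = real i" "g i $ 2 = (real i)\<^sup>2" for i
    by (simp_all add: g_def)
  have "inj g"
    by (rule injI) (metis g(1) of_nat_eq_iff)
  moreover have "general_position (g ` {..<n})"
    unfolding general_position_def no_collinear_def
  proof (intro allI impI notI)
    fix T assume T: "T \<subseteq> g ` {..<n} \<and> card T = 3" and c: "collinear T"
    obtain x y z where xyz: "T = {x, y, z}" "x \<noteq> y" "y \<noteq> z" "x \<noteq> z"
      using T by (metis card_3_iff)
    obtain i j k where ijk: "x = g i" "y = g j" "z = g k"
      using T xyz(1) by auto
    have ne: "real i \<noteq> real j" "real j \<noteq> real k" "real i \<noteq> real k"
      using xyz ijk by auto
    obtain u where u: "\<forall>x\<in>T. \<forall>y\<in>T. \<exists>c. x - y = c *\<^sub>R u"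
      using c unfolding collinear_def by blast
    obtain a where a: "x - y = a *\<^sub>R u" using u xyz(1) by blast
    obtain b where b: "x - z = b *\<^sub>R u" using u xyz(1) by blast
    have 1: "real i - real j = a * u $ 1" "(real i)\<^sup>2 - (real j)\<^sup>2 = a * u $ 2"
      using arg_cong[OF a, of "\<lambda>v. v $ 1"] arg_cong[OF a, of "\<lambda>v. v $ 2"]
      by (simp_all add: ijk g)
    have 2: "real i - real k = b * u $ 1" "(real i)\<^sup>2 - (real k)\<^sup>2 = b * u $ 2"
      using arg_cong[OF b, of "\<lambda>v. v $ 1"] arg_cong[OF b, of "\<lambda>v. v $ 2"]
      by (simp_all add: ijk g)
    have "(real i - real j) * ((real i)\<^sup>2 - (real k)\<^sup>2) =
          (real i - real k) * ((real i)\<^sup>2 - (real j)\<^sup>2)"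
      unfolding 1 2 by (simp add: algebra_simps)
    moreover have "(real i - real j) * ((real i)\<^sup>2 - (real k)\<^sup>2) -
          (real i - real k) * ((real i)\<^sup>2 - (real j)\<^sup>2) =
          (real i - real j) * (real i - real k) * (real k - real j)"
      by (simp add: algebra_simps power2_eq_square)
    ultimately have "(real i - real j) * (real i - real k) * (real k - real j) = 0"
      by linarith
    then show False using ne by simp
  qed
  ultimately show ?thesis
    by (intro exI[of _ "g ` {..<n}"]) (simp add: card_image inj_on_subset)
qed

lemma f_is_greatest:
  assumes "2 \<le> s"
  shows "forces_general_position n s (f n s)"
    and "\<And>k. forces_general_position n s k \<Longrightarrow> k \<le> f n s"
proof -
  have 0: "forces_general_position n s 0"
    unfolding forces_general_position_def general_position_def no_collinear_def
    by (intro allI impI exI[of _ "{}"]) auto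
  obtain P :: "(real ^ 2) set" where P: "finite P" "card P = n" "general_position P"
    using ex_general_position by blast
  have "no_collinear (s + 1) P"
    using no_collinear_mono[OF P(3)[unfolded general_position_def]] assms by simp
  then have P': "finite P \<and> card P = n \<and> no_collinear (s + 1) P"
    using P by simp
  have le: "k \<le> n" if k: "forces_general_position n s k" for k
  proof -
    obtain Q where "Q \<subseteq> P" "card Q = k"
      using k[unfolded forces_general_position_def, rule_format, OF P'] by blast
    then show ?thesis using card_mono[OF P(1), of Q] P(2) by simp
  qed
  show "forces_general_position n s (f n s)"
    unfolding f_def using 0 le by (rule GreatestI_nat)
  show "k \<le> f n s" if k: "forces_general_position n s k" for k
    unfolding f_def using k le by (rule Greatest_le_nat)
qed

end

theory Submission
  imports Defs "HOL-Probability.Probability" "HOL-Real_Asymp.Real_Asymp"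
begin

text \<open>
  Upper bounds come from subsets of the lattice cube \<open>{0..<m}\<^sup>3\<close>, projected to the plane by an
  injective map that creates no new collinear triples. If \<open>n \<le> s\<^sup>3\<close>, one takes \<open>n\<close> points of
  \<open>{0..<s}\<^sup>3\<close> on about \<open>n/s\<close> parallel lines, each of which contains at most two points of a set in
  general position. For smaller \<open>s\<close> one keeps each point of the cube with probability about \<open>s/m\<close>
  (up to logarithms) and deletes a point from every remaining \<open>s + 1\<close> collinear ones. Subsets
  without collinear triples are controlled by hypergraph containers: a set \<open>A\<close> of size \<open>t m\<^sup>2\<close> carries,
  in each of the roughly \<open>t\<^sup>3\<close> primitive directions of size at most \<open>t\<close>, about \<open>|A|\<close> disjoint collinear
  triples, and all of these together form a linear 3-graph that is almost regular.

  The lower bound samples the points at random and deletes: by the Szemeredi-Trotter theorem, \<open>n\<close>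
  points with at most \<open>s\<close> on a line span \<open>O(n\<^sup>2 ln s + n s\<^sup>2)\<close> collinear triples. That theorem follows from the
  crossing lemma, and the linear bound on the number of edges of a plane straight-line graph from a
  charging argument along vertical lines.
\<close>

section \<open>Elementary estimates\<close>

lemma ln_ge_1:
  assumes "3 \<le> n"
  shows "1 \<le> ln (real n)"
proof -
  have "exp 1 \<le> real n" using exp_le assms by linarith
  then show ?thesis using assms by (simp add: ln_ge_iff)
qed

lemma harm_le: "0 < n \<Longrightarrow> harm n \<le> 1 + ln (real n)"
  using euler_mascheroni_sequence_decreasing[of 1 n] by (simp add: harm_def)

lemma sum_inverse_le:
  assumes "0 < s"
  shows "(\<Sum>j<s. 1 / real j) \<le> 1 + ln (real s)"
proof -
  have "(\<Sum>j<s. 1 / real j) = (\<Sum>j=1..<s. inverse (real j))"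
    by (rule sum.mono_neutral_cong_right) (auto simp: inverse_eq_divide Suc_le_eq)
  also have "\<dots> \<le> harm s"
    unfolding harm_def by (rule sum_mono2) auto
  also have "\<dots> \<le> 1 + ln (real s)" using assms by (rule harm_le)
  finally show ?thesis .
qed

lemma sum_inverse_cubes_le:
  assumes "1 \<le> t"
  shows "(\<Sum>d=2..t. 1 / real d ^ 3) \<le> (1 - 1 / real t) / 2"
  using assms
proof (induction t rule: dec_induct)
  case (step t)
  have t: "1 \<le> real t" using step by simp
  have "2 * real t * (real t + 1) \<le> (real t + 1)\<^sup>2 * (real t + 1)"
    by (rule mult_right_mono) (simp_all add: power2_eq_square algebra_simps)
  then have "1 / (real t + 1) ^ 3 \<le> 1 / (2 * real t * (real t + 1))"
    using t by (intro divide_left_mono) (simp_all add: power2_eq_square power3_eq_cube)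
  also have "\<dots> = (1 / real t - 1 / (real t + 1)) / 2" using t by (simp add: field_simps)
  finally have "1 / real (Suc t) ^ 3 \<le> (1 / real t - 1 / real (Suc t)) / 2"
    by (simp add: add.commute)
  moreover have "(\<Sum>d=2..Suc t. 1 / real d ^ 3) = (\<Sum>d=2..t. 1 / real d ^ 3) + 1 / real (Suc t) ^ 3"
    using step by simp
  ultimately show ?case using step.IH by (simp only: diff_divide_distrib)
qed simp

lemma sum_lessThan_choose: "(\<Sum>j<n. j choose m) = n choose Suc m"
  by (cases n) (simp_all add: lessThan_Suc_atMost sum_choose_upper)

lemma sum_choose_layers:
  assumes L: "finite L" and g: "\<And>l. l \<in> L \<Longrightarrow> g l \<le> s"
  shows "(\<Sum>l\<in>L. g l choose Suc m) = (\<Sum>j<s. card {l\<in>L. j < g l} * (j choose m))"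
proof -
  have "g l choose Suc m = (\<Sum>j<s. if j < g l then j choose m else 0)" if "l \<in> L" for l
  proof -
    have "{j\<in>{..<s}. j < g l} = {..<g l}" using g[OF that] by auto
    then show ?thesis by (simp flip: sum.inter_filter sum_lessThan_choose)
  qed
  then have "(\<Sum>l\<in>L. g l choose Suc m) = (\<Sum>l\<in>L. \<Sum>j<s. if j < g l then j choose m else 0)" by simp
  also have "\<dots> = (\<Sum>j<s. \<Sum>l\<in>L. if j < g l then j choose m else 0)" by (rule sum.swap)
  also have "\<dots> = (\<Sum>j<s. card {l\<in>L. j < g l} * (j choose m))"
    using L by (simp flip: sum.inter_filter)
  finally show ?thesis .
qed

lemma choose_le_power_divide_fact: "real (n choose k) \<le> real n ^ k / fact k"
proof -
  have "real ((n choose k) * fact k) \<le> real (n ^ k)"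
    using binomial_fact_pow by (simp only: of_nat_le_iff)
  then show ?thesis by (simp add: pos_le_divide_eq)
qed

lemma power_div_fact_le_exp:
  fixes x :: real
  assumes "0 \<le> x"
  shows "x ^ n / fact n \<le> exp x"
proof -
  have "(\<Sum>i\<in>{n}. x ^ i /\<^sub>R fact i) \<le> (\<Sum>i. x ^ i /\<^sub>R fact i)"
    by (intro sum_le_suminf summable_exp_generic) (use assms in auto)
  then show ?thesis by (simp add: exp_def divide_inverse mult.commute)
qed

lemma choose_le_exp_power:
  assumes "0 < k"
  shows "real (n choose k) \<le> (exp 1 * real n / real k) ^ k"
proof -
  have "real (n choose k) * real k ^ k \<le> real n ^ k / fact k * real k ^ k"
    using choose_le_power_divide_fact by (rule mult_right_mono) simp
  also have "\<dots> = real n ^ k * (real k ^ k / fact k)" by simp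
  also have "\<dots> \<le> real n ^ k * exp (real k)" by (intro mult_left_mono power_div_fact_le_exp) auto
  also have "exp (real k) = exp 1 ^ k" by (simp flip: exp_of_nat_mult)
  finally show ?thesis
    using assms by (simp add: power_divide power_mult_distrib pos_le_divide_eq mult.commute)
qed

lemma self_power_le:
  assumes "0 < s"
  shows "real s ^ s \<le> 6 ^ s * fact (s - 1)"
proof -
  have "real s ^ s \<le> exp (real s) * fact s"
    using power_div_fact_le_exp[of "real s" s] by (simp add: pos_divide_le_eq)
  also have "exp (real s) = exp 1 ^ s" by (simp flip: exp_of_nat_mult)
  also have "exp 1 ^ s * fact s \<le> 3 ^ s * (real s * fact (s - 1))"
    using exp_le assms by (intro mult_mono power_mono) (auto simp: fact_reduce)
  also have "\<dots> \<le> 3 ^ s * (2 ^ s * fact (s - 1))"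
    by (intro mult_left_mono mult_right_mono) (auto intro: less_imp_le)
  also have "\<dots> = 6 ^ s * fact (s - 1)" by (simp flip: power_mult_distrib mult.assoc)
  finally show ?thesis .
qed

section \<open>Random subsets\<close>

definition random_subset :: "'a set \<Rightarrow> real \<Rightarrow> 'a set pmf" where
  "random_subset P p = map_pmf (\<lambda>\<omega>. {x\<in>P. \<omega> x}) (Pi_pmf P False (\<lambda>_. bernoulli_pmf p))"

lemma set_random_subset: "Q \<in> set_pmf (random_subset P p) \<Longrightarrow> Q \<subseteq> P"
  by (auto simp: random_subset_def)

lemma integrable_random_subset [simp]:
  fixes g :: "'a set \<Rightarrow> real"
  assumes "finite P"
  shows "integrable (random_subset P p) g"
proof (rule integrable_measure_pmf_finite)
  show "finite (set_pmf (random_subset P p))"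
    using assms
    by (rule rev_finite_subset[OF iffD2[OF finite_Pow_iff]]) (auto dest: set_random_subset)
qed

lemma prob_subset_random_subset:
  assumes P: "finite P" and B: "B \<subseteq> P" and p: "0 \<le> p" "p \<le> 1"
  shows "measure_pmf.prob (random_subset P p) {Q. B \<subseteq> Q} = p ^ card B"
proof -
  let ?A = "\<lambda>x. if x \<in> B then {True} else UNIV"
  have "(\<lambda>\<omega>. {x\<in>P. \<omega> x}) -` {Q. B \<subseteq> Q} = Pi P ?A"
    using B by (auto simp: Pi_def)
  then have "measure_pmf.prob (random_subset P p) {Q. B \<subseteq> Q}
      = (\<Prod>x\<in>P. measure_pmf.prob (bernoulli_pmf p) (?A x))"
    by (simp only: random_subset_def measure_map_pmf measure_Pi_pmf_Pi[OF P])
  also have "\<dots> = (\<Prod>x\<in>P. if x \<in> B then p else 1)"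
    using p by (intro prod.cong) (auto simp: measure_pmf_single)
  also have "\<dots> = p ^ card B"
    using P B by (simp add: prod.If_cases inf.absorb2)
  finally show ?thesis .
qed

lemma expectation_card_contained:
  assumes P: "finite P" and I: "finite I" "\<And>i. i \<in> I \<Longrightarrow> B i \<subseteq> P" and p: "0 \<le> p" "p \<le> 1"
  shows "measure_pmf.expectation (random_subset P p) (\<lambda>Q. real (card {i\<in>I. B i \<subseteq> Q}))
    = (\<Sum>i\<in>I. p ^ card (B i))"
proof -
  have "measure_pmf.expectation (random_subset P p) (\<lambda>Q. real (card {i\<in>I. B i \<subseteq> Q}))
      = measure_pmf.expectation (random_subset P p) (\<lambda>Q. \<Sum>i\<in>I. indicator {Q. B i \<subseteq> Q} Q)"
    using I(1) by (simp add: indicator_def sum.If_cases Int_def)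
  also have "\<dots> = (\<Sum>i\<in>I. measure_pmf.prob (random_subset P p) {Q. B i \<subseteq> Q})"
    by (subst Bochner_Integration.integral_sum) (use P in simp_all)
  also have "\<dots> = (\<Sum>i\<in>I. p ^ card (B i))"
    using P I p by (intro sum.cong prob_subset_random_subset) auto
  finally show ?thesis .
qed

lemma expectation_card_random_subset:
  assumes P: "finite P" and p: "0 \<le> p" "p \<le> 1"
  shows "measure_pmf.expectation (random_subset P p) (\<lambda>Q. real (card Q)) = p * card P"
proof -
  have "measure_pmf.expectation (random_subset P p) (\<lambda>Q. real (card Q))
      = measure_pmf.expectation (random_subset P p) (\<lambda>Q. real (card {x\<in>P. {x} \<subseteq> Q}))"
    by (intro integral_cong_AE AE_pmfI)
      (auto dest: set_random_subset intro!: arg_cong[where f = card])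
  then show ?thesis
    using expectation_card_contained[OF P P, of "\<lambda>x. {x}"] p by simp
qed

lemma ex_ge_expectation:
  fixes g :: "'a \<Rightarrow> real"
  assumes "integrable (measure_pmf M) g"
  shows "\<exists>x\<in>set_pmf M. measure_pmf.expectation M g \<le> g x"
proof (rule ccontr)
  assume "\<not> ?thesis"
  then have "\<And>x. x \<in> set_pmf M \<Longrightarrow> g x < measure_pmf.expectation M g"
    by (auto simp: not_le)
  then have "measure_pmf.expectation M g < measure_pmf.expectation M (\<lambda>_. measure_pmf.expectation M g)"
    using assms by (intro measure_pmf.integral_less_AE_space) (auto intro!: AE_pmfI)
  then show False by simp
qed

lemma ex_subset_avoiding:
  assumes "finite P" "finite \<F>" and ne: "\<And>F. F \<in> \<F> \<Longrightarrow> F \<noteq> {}"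
  shows "\<exists>Q\<subseteq>P. card P \<le> card Q + card {F\<in>\<F>. F \<subseteq> P} \<and> (\<forall>F\<in>\<F>. \<not> F \<subseteq> Q)"
proof -
  let ?\<G> = "{F\<in>\<F>. F \<subseteq> P}"
  obtain c where c: "\<And>F. F \<in> \<F> \<Longrightarrow> c F \<in> F"
    using ne by (metis ex_in_conv)
  have "card P \<le> card (P - c ` ?\<G>) + card (c ` ?\<G>)"
    using diff_card_le_card_Diff[of "c ` ?\<G>" P] assms(2) by simp
  also have "card (c ` ?\<G>) \<le> card ?\<G>"
    using assms(2) by (intro card_image_le) simp
  finally have "card P \<le> card (P - c ` ?\<G>) + card ?\<G>" by simp
  then show ?thesis
    using c by (intro exI[of _ "P - c ` ?\<G>"]) blast
qed

lemma random_deletion: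
  fixes p :: real
  assumes P: "finite P" and \<F>: "finite \<F>" "\<And>F. F \<in> \<F> \<Longrightarrow> F \<subseteq> P \<and> F \<noteq> {}"
    and p: "0 \<le> p" "p \<le> 1"
  shows "\<exists>Q\<subseteq>P. p * card P - (\<Sum>F\<in>\<F>. p ^ card F) \<le> card Q \<and> (\<forall>F\<in>\<F>. \<not> F \<subseteq> Q)"
proof -
  let ?M = "random_subset P p" and ?g = "\<lambda>R. real (card R) - real (card {F\<in>\<F>. F \<subseteq> R})"
  have "measure_pmf.expectation ?M ?g = p * card P - (\<Sum>F\<in>\<F>. p ^ card F)"
    using expectation_card_random_subset[OF P p] expectation_card_contained[OF P \<F>(1) _ p, of "\<lambda>F. F"] \<F>(2) P
    by simp
  then obtain R where R: "R \<subseteq> P" "p * card P - (\<Sum>F\<in>\<F>. p ^ card F) \<le> ?g R"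
    using ex_ge_expectation[of ?M ?g] P by (auto dest: set_random_subset)
  obtain Q where "Q \<subseteq> R" "card R \<le> card Q + card {F\<in>\<F>. F \<subseteq> R}" "\<forall>F\<in>\<F>. \<not> F \<subseteq> Q"
    using ex_subset_avoiding[of R \<F>] \<F> finite_subset[OF R(1) P] by blast
  then show ?thesis
    using R by (intro exI[of _ Q]) auto
qed

section \<open>Straight-line drawings and the crossing lemma\<close>

locale drawing =
  fixes x y :: "'a \<Rightarrow> real" and P :: "'a set"
  assumes finite_P: "finite P" and inj_x: "inj_on x P"
begin

definition slope :: "'a \<times> 'a \<Rightarrow> real" where
  "slope e = (y (snd e) - y (fst e)) / (x (snd e) - x (fst e))"

definition height :: "'a \<times> 'a \<Rightarrow> real \<Rightarrow> real" where
  "height e a = y (fst e) + (a - x (fst e)) * slope e"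

definition spans :: "'a \<times> 'a \<Rightarrow> real \<Rightarrow> bool" where
  "spans e a \<longleftrightarrow> x (fst e) < a \<and> a < x (snd e)"

definition crosses :: "'a \<times> 'a \<Rightarrow> 'a \<times> 'a \<Rightarrow> bool" where
  "crosses e g \<longleftrightarrow> (\<exists>a. spans e a \<and> spans g a \<and> height e a = height g a)"

definition drawn :: "('a \<times> 'a) set \<Rightarrow> bool" where
  "drawn E \<longleftrightarrow> (\<forall>e\<in>E. fst e \<in> P \<and> snd e \<in> P \<and> x (fst e) < x (snd e)) \<and>
     (\<forall>e\<in>E. \<forall>w\<in>P. spans e (x w) \<longrightarrow> height e (x w) \<noteq> y w)"

definition crossings :: "('a \<times> 'a) set \<Rightarrow> (('a \<times> 'a) \<times> ('a \<times> 'a)) set" where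
  "crossings E = {(e, g). e \<in> E \<and> g \<in> E \<and> e \<noteq> g \<and> crosses e g}"

lemma height_fst [simp]: "height e (x (fst e)) = y (fst e)"
  by (simp add: height_def)

lemma height_snd: "x (fst e) < x (snd e) \<Longrightarrow> height e (x (snd e)) = y (snd e)"
  by (simp add: height_def slope_def)

lemma height_diff: "height e a - height e b = (a - b) * slope e"
  by (simp add: height_def algebra_simps)

lemma height_less_iff_slope_less:
  assumes "fst g = fst e" "x (fst e) < a"
  shows "height e a < height g a \<longleftrightarrow> slope e < slope g"
  using assms by (simp add: height_def)

lemma drawn_edge: "drawn E \<Longrightarrow> e \<in> E \<Longrightarrow> fst e \<in> P \<and> snd e \<in> P \<and> x (fst e) < x (snd e)"
  by (simp add: drawn_def)

lemma drawn_avoids: "drawn E \<Longrightarrow> e \<in> E \<Longrightarrow> w \<in> P \<Longrightarrow> spans e (x w) \<Longrightarrow> height e (x w) \<noteq> y w"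
  by (simp add: drawn_def)

lemma drawn_finite: "drawn E \<Longrightarrow> finite E"
  by (rule finite_subset[of _ "P \<times> P"]) (use finite_P in \<open>auto dest: drawn_edge\<close>)

lemma drawn_subset: "drawn E \<Longrightarrow> F \<subseteq> E \<Longrightarrow> drawn F"
  by (auto simp: drawn_def)

lemma finite_crossings: "drawn E \<Longrightarrow> finite (crossings E)"
  by (rule finite_subset[of _ "E \<times> E"]) (auto simp: crossings_def drawn_finite)

lemma collinear_edges_eq:
  assumes E: "drawn E" "e \<in> E" "g \<in> E"
    and meet: "spans e a" "spans g a" "height e a = height g a" "slope e = slope g"
  shows "e = g"
proof -
  have same_height: "height e b = height g b" for b
    using height_diff[of e b a] height_diff[of g b a] meet by simp
  have "\<not> x (fst e') < x (fst g')" "\<not> x (snd g') < x (snd e')"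
    if "e' \<in> E" "g' \<in> E" "spans e' a" "spans g' a" "\<And>b. height e' b = height g' b" for e' g'
  proof -
    have "height e' (x (fst g')) = y (fst g')" "height e' (x (snd g')) = y (snd g')"
      using that(5) height_snd drawn_edge[OF E(1) that(2)] by simp_all
    then show "\<not> x (fst e') < x (fst g')" "\<not> x (snd g') < x (snd e')"
      using drawn_avoids[OF E(1) that(1)] drawn_edge[OF E(1) that(2)] that(3,4)
      by (force simp: spans_def)+
  qed
  from this[of e g] this[of g e] have "x (fst e) = x (fst g)" "x (snd e) = x (snd g)"
    using E meet same_height by force+
  then show ?thesis
    using inj_x drawn_edge[OF E(1,2)] drawn_edge[OF E(1,3)] by (simp add: inj_on_eq_iff prod_eq_iff)
qed

end

locale plane_drawing = drawing +
  fixes E :: "('a \<times> 'a) set"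
  assumes drawn: "drawn E"
    and noncrossing: "e \<in> E \<Longrightarrow> g \<in> E \<Longrightarrow> crosses e g \<Longrightarrow> e = g"
begin

lemmas edge = drawn_edge[OF drawn]
lemmas edge_avoids = drawn_avoids[OF drawn]

lemma same_left_slope_eq:
  assumes "e \<in> E" "g \<in> E" "fst e = fst g" "slope e = slope g"
  shows "e = g"
proof -
  obtain a where "x (fst e) < a" "a < min (x (snd e)) (x (snd g))"
    using dense[of "x (fst e)" "min (x (snd e)) (x (snd g))"] edge[of e] edge[of g] assms by auto
  then show ?thesis
    using assms by (intro collinear_edges_eq[OF drawn, of e g a]) (auto simp: spans_def height_def)
qed

lemma same_right_slope_eq:
  assumes "e \<in> E" "g \<in> E" "snd e = snd g" "slope e = slope g"
  shows "e = g"
proof -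
  obtain a where "max (x (fst e)) (x (fst g)) < a" "a < x (snd e)"
    using dense[of "max (x (fst e)) (x (fst g))" "x (snd e)"] edge[of e] edge[of g] assms by auto
  moreover have "height e a = height g a"
    using height_diff[of e a "x (snd e)"] height_diff[of g a "x (snd g)"] assms
      height_snd[of e] height_snd[of g] edge[of e] edge[of g] by simp
  ultimately show ?thesis
    using assms by (intro collinear_edges_eq[OF drawn, of e g a]) (auto simp: spans_def)
qed

lemma height_order_leftwards:
  assumes E: "e \<in> E" "g \<in> E" and right: "height e b < height g b" and l: "l \<le> b"
    and range: "x (fst e) \<le> l" "x (fst g) \<le> l" "b \<le> x (snd e)" "b \<le> x (snd g)"
  shows "height e l \<le> height g l"
proof (rule ccontr)
  assume reversed: "\<not> ?thesis"
  then have "\<exists>a\<ge>l. a \<le> b \<and> height e a - height g a = 0"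
    using right l by (intro IVT2') (auto simp: height_def intro!: continuous_intros)
  then obtain a where a: "l \<le> a" "a \<le> b" "height e a = height g a" by auto
  then have "l \<noteq> a" "a \<noteq> b" using right reversed by auto
  then have "crosses e g"
    unfolding crosses_def spans_def using a range by (intro exI[of _ a]) auto
  then have "e = g" using E noncrossing by blast
  then show False using right by simp
qed

text \<open>Each edge is charged to a vertex: the steepest edge out of a vertex and the least steep edge
  into a vertex to that vertex, any other edge to a vertex that sees it directly below.\<close>

definition directly_above :: "'a \<Rightarrow> 'a \<times> 'a \<Rightarrow> bool" where
  "directly_above w e \<longleftrightarrow> w \<in> P \<and> spans e (x w) \<and> height e (x w) < y w \<and>
     (\<forall>k\<in>E. spans k (x w) \<longrightarrow> height k (x w) < y w \<longrightarrow> height k (x w) \<le> height e (x w))"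

lemma directly_above_unique:
  assumes "e \<in> E" "g \<in> E" "directly_above w e" "directly_above w g"
  shows "e = g"
proof (rule noncrossing[OF assms(1,2)])
  have "height e (x w) = height g (x w)"
    using assms by (auto simp: directly_above_def intro: order_antisym)
  then show "crosses e g"
    using assms(3,4) by (auto simp: directly_above_def crosses_def)
qed

definition wedge :: "'a \<times> 'a \<Rightarrow> 'a \<times> 'a \<Rightarrow> 'a set" where
  "wedge e g = {w\<in>P. spans e (x w) \<and> x w \<le> x (snd g) \<and> height e (x w) < y w \<and> y w \<le> height g (x w)}"

lemma wedge_nonempty:
  assumes E: "e \<in> E" "g \<in> E" "k \<in> E"
    and left: "fst g = fst e" "slope e < slope g" and right: "snd k = snd e" "slope k < slope e"
  shows "wedge e g \<noteq> {}"
proof -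
  have e_below_g: "height e a < height g a" if "x (fst e) < a" for a
    using that left height_less_iff_slope_less by blast
  show ?thesis
  proof (cases "x (snd g) < x (snd e)")
    case True
    then have "snd g \<in> wedge e g"
      using edge[OF E(2)] left(1) e_below_g[of "x (snd g)"]
      by (simp add: wedge_def spans_def height_snd)
    then show ?thesis by blast
  next
    case False
    have meet: "height k (x (snd e)) = height e (x (snd e))"
      using right(1) height_snd[of e] height_snd[of k] edge[OF E(1)] edge[OF E(3)] by simp
    have e_below_k: "height e a < height k a" if "a < x (snd e)" for a
    proof -
      have "(a - x (snd e)) * slope e < (a - x (snd e)) * slope k"
        using right(2) that by (intro mult_strict_left_mono_neg) auto
      then show ?thesis
        using meet height_diff[of e a "x (snd e)"] height_diff[of k a "x (snd e)"] by linarith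
    qed
    have k_below_g: "height k l \<le> height g l"
      if "x (fst e) \<le> l" "x (fst k) \<le> l" "l \<le> x (snd e)" for l
    proof (rule height_order_leftwards[of _ _ "x (snd e)"])
      show "height k (x (snd e)) < height g (x (snd e))"
        using e_below_g[of "x (snd e)"] edge[OF E(1)] by (simp add: meet)
    qed (use E that left right False in auto)
    have "x (fst e) < x (fst k)"
    proof (rule ccontr)
      assume "\<not> ?thesis"
      then have "height k (x (fst e)) \<le> height g (x (fst e))"
        using k_below_g[of "x (fst e)"] edge[OF E(1)] by simp
      also have "\<dots> = height e (x (fst e))" using left(1) by (metis height_fst)
      finally show False using e_below_k[of "x (fst e)"] edge[OF E(1)] by simp
    qed
    then have "fst k \<in> wedge e g"
      using edge[OF E(3)] right(1) e_below_k[of "x (fst k)"] k_below_g[of "x (fst k)"] False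
      by (simp add: wedge_def spans_def)
    then show ?thesis by blast
  qed
qed

lemma leftmost_in_wedge_directly_above:
  assumes E: "e \<in> E" "g \<in> E" and left: "fst g = fst e" "slope e < slope g"
    and g_next: "\<And>k. k \<in> E \<Longrightarrow> fst k = fst e \<Longrightarrow> slope e < slope k \<Longrightarrow> slope g \<le> slope k"
    and w: "w \<in> wedge e g" and leftmost: "\<And>z. z \<in> wedge e g \<Longrightarrow> x w \<le> x z"
  shows "directly_above w e"
proof -
  have wedge: "w \<in> P" "x (fst e) < x w" "x w < x (snd e)" "x w \<le> x (snd g)"
    "height e (x w) < y w" "y w \<le> height g (x w)"
    using w by (auto simp: wedge_def spans_def)
  have "height k (x w) \<le> height e (x w)"
    if k: "k \<in> E" "spans k (x w)" "height k (x w) < y w" for k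
  proof (rule ccontr)
    assume "\<not> ?thesis"
    then have between: "height e (x w) < height k (x w)" "height k (x w) < height g (x w)"
      using k wedge by auto
    let ?l = "max (x (fst e)) (x (fst k))"
    have range: "x (fst k) < x w" "x w < x (snd k)" using k(2) by (auto simp: spans_def)
    have e_k: "height e ?l \<le> height k ?l" and k_g: "height k ?l \<le> height g ?l"
      by (rule height_order_leftwards[of _ _ "x w"]; use E k between wedge range left in auto)+
    consider "x (fst e) < x (fst k)" | "x (fst k) < x (fst e)" | "fst k = fst e"
      using inj_x edge[OF E(1)] edge[OF k(1)] by (metis inj_on_eq_iff linorder_less_linear)
    then show False
    proof cases
      case 1
      then have "spans e (x (fst k))" using range wedge by (simp add: spans_def)
      then have "fst k \<in> wedge e g"
        using 1 e_k k_g range wedge edge[OF k(1)] edge_avoids[OF E(1), of "fst k"]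
        by (auto simp: wedge_def)
      then show False using leftmost range by fastforce
    next
      case 2
      then have "spans k (x (fst e))" using range wedge by (simp add: spans_def)
      moreover have "height k (x (fst e)) = y (fst e)"
        using 2 e_k k_g height_fst[of g] left(1) by simp
      ultimately show False using edge_avoids[OF k(1)] edge[OF E(1)] by blast
    next
      case 3
      then have "slope e < slope k" "slope k < slope g"
        using between left(1) wedge(2) height_less_iff_slope_less[of k e "x w"]
          height_less_iff_slope_less[of g k "x w"] by simp_all
      then show False using g_next[OF k(1) 3] by simp
    qed
  qed
  then show ?thesis using wedge by (simp add: directly_above_def spans_def)
qed

lemma ex_directly_above:
  assumes e: "e \<in> E" and left: "\<exists>g\<in>E. fst g = fst e \<and> slope e < slope g"
    and right: "\<exists>k\<in>E. snd k = snd e \<and> slope k < slope e"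
  shows "\<exists>w. directly_above w e"
proof -
  let ?U = "{g\<in>E. fst g = fst e \<and> slope e < slope g}"
  have "finite ?U" "?U \<noteq> {}" using drawn_finite[OF drawn] left by auto
  then obtain g where g: "g \<in> ?U" "\<And>k. k \<in> ?U \<Longrightarrow> slope g \<le> slope k"
    using arg_min_if_finite[of ?U slope] by (metis (no_types, lifting) not_le)
  have "finite (wedge e g)" using finite_P by (simp add: wedge_def)
  moreover have "wedge e g \<noteq> {}" using wedge_nonempty e g(1) right by blast
  ultimately obtain w where "w \<in> wedge e g" "\<And>z. z \<in> wedge e g \<Longrightarrow> x w \<le> x z"
    using arg_min_if_finite[of "wedge e g" x] by (metis (no_types, lifting) not_le)
  then have "directly_above w e"
    using leftmost_in_wedge_directly_above[of e g w] e g by blast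
  then show ?thesis ..
qed

lemma card_edges_le: "card E \<le> 3 * card P"
proof -
  define S where "S = {e\<in>E. \<forall>g\<in>E. fst g = fst e \<longrightarrow> slope g \<le> slope e}"
  define L where "L = {e\<in>E. \<forall>g\<in>E. snd g = snd e \<longrightarrow> slope e \<le> slope g}"
  define B where "B = {e\<in>E. \<exists>w. directly_above w e}"
  have "inj_on fst S"
    by (intro inj_onI same_left_slope_eq) (auto simp: S_def intro: order_antisym)
  moreover have "fst ` S \<subseteq> P" using edge by (auto simp: S_def)
  ultimately have S: "card S \<le> card P" using finite_P by (metis card_inj_on_le)
  have "inj_on snd L"
    by (intro inj_onI same_right_slope_eq) (auto simp: L_def intro: order_antisym)
  moreover have "snd ` L \<subseteq> P" using edge by (auto simp: L_def)
  ultimately have L: "card L \<le> card P" using finite_P by (metis card_inj_on_le)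
  obtain c where c: "\<forall>e\<in>B. directly_above (c e) e"
    using bchoice[of B "\<lambda>e w. directly_above w e"] by (auto simp: B_def)
  have "inj_on c B"
    by (rule inj_onI) (metis (mono_tags, lifting) B_def c directly_above_unique mem_Collect_eq)
  moreover have "c ` B \<subseteq> P" using c by (auto simp: directly_above_def)
  ultimately have B: "card B \<le> card P" using finite_P by (metis card_inj_on_le)
  have "E \<subseteq> S \<union> L \<union> B"
    using ex_directly_above by (force simp: S_def L_def B_def not_le)
  then have "card E \<le> card (S \<union> L \<union> B)"
    using drawn_finite[OF drawn] by (intro card_mono) (auto simp: S_def L_def B_def)
  also have "\<dots> \<le> card S + card L + card B"
    by (meson add_le_mono1 card_Un_le le_trans)
  finally show ?thesis using S L B by linarith
qed

end

context drawing
begin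

lemma card_edges_le_crossings:
  assumes E: "drawn E"
  shows "card E \<le> 3 * card P + card (crossings E)"
proof -
  let ?F = "E - fst ` crossings E"
  interpret plane_drawing x y P ?F
  proof
    show "drawn ?F" using E by (rule drawn_subset) blast
    show "e = g" if "e \<in> ?F" "g \<in> ?F" "crosses e g" for e g
      using that by (force simp: crossings_def)
  qed
  have "card E - card (fst ` crossings E) \<le> card ?F"
    using finite_crossings[OF E] by (intro diff_card_le_card_Diff) simp
  then show ?thesis
    using card_edges_le card_image_le[OF finite_crossings[OF E], of fst] by linarith
qed

definition ends :: "'a \<times> 'a \<Rightarrow> 'a set" where
  "ends e = {fst e, snd e}"

lemma card_ends: "drawn E \<Longrightarrow> e \<in> E \<Longrightarrow> card (ends e) = 2 \<and> ends e \<subseteq> P"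
  using drawn_edge[of E e] by (auto simp: ends_def card_insert_if)

lemma card_crossing_ends:
  assumes E: "drawn E" and X: "(e, g) \<in> crossings E"
  shows "card (ends e \<union> ends g) = 4"
proof -
  obtain a where a: "e \<in> E" "g \<in> E" "e \<noteq> g" "spans e a" "spans g a" "height e a = height g a"
    using X by (auto simp: crossings_def crosses_def)
  have meet_once: "b = a" if "height e b = height g b" for b
  proof (rule ccontr)
    assume "b \<noteq> a"
    then have "slope e = slope g"
      using height_diff[of e b a] height_diff[of g b a] a that by simp
    then show False using collinear_edges_eq[OF E] a by blast
  qed
  have "fst e \<noteq> fst g"
    using meet_once[of "x (fst e)"] a(4) height_fst[of g] by (auto simp: spans_def)
  moreover have "snd e \<noteq> snd g"
    using meet_once[of "x (snd e)"] a height_snd[of e] height_snd[of g] drawn_edge[OF E]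
    by (auto simp: spans_def)
  moreover have "fst e \<noteq> snd e" "fst g \<noteq> snd g" "fst e \<noteq> snd g" "fst g \<noteq> snd e"
    using a(4,5) by (auto simp: spans_def)
  ultimately show ?thesis by (simp add: ends_def)
qed

lemma sampled_edges_le_crossings:
  fixes p :: real
  assumes E: "drawn E" and p: "0 \<le> p" "p \<le> 1"
  shows "p\<^sup>2 * card E \<le> 3 * (p * card P) + p ^ 4 * card (crossings E)"
proof -
  let ?ends2 = "\<lambda>(e, g). ends e \<union> ends g" and ?M = "random_subset P p"
  let ?E = "\<lambda>Q. {e\<in>E. ends e \<subseteq> Q}" and ?X = "\<lambda>Q. {c\<in>crossings E. ?ends2 c \<subseteq> Q}"
  have in_P: "\<And>c. c \<in> crossings E \<Longrightarrow> ?ends2 c \<subseteq> P"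
    using card_ends[OF E] by (auto simp: crossings_def)
  have induced: "real (card (?E Q)) \<le> 3 * real (card Q) + real (card (?X Q))" if Q: "Q \<subseteq> P" for Q
  proof -
    interpret Q: drawing x y Q
      using Q finite_P inj_x by unfold_locales (auto intro: finite_subset inj_on_subset)
    have "Q.drawn (?E Q)"
      using E Q by (auto simp: drawn_def Q.drawn_def ends_def)
    then have "card (?E Q) \<le> 3 * card Q + card (Q.crossings (?E Q))"
      by (rule Q.card_edges_le_crossings)
    also have "Q.crossings (?E Q) = ?X Q" by (auto simp: Q.crossings_def crossings_def)
    finally show ?thesis by linarith
  qed
  have "p\<^sup>2 * card E = (\<Sum>e\<in>E. p ^ card (ends e))"
    using card_ends[OF E] by simp
  also have "\<dots> = measure_pmf.expectation ?M (\<lambda>Q. real (card (?E Q)))"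
    using finite_P drawn_finite[OF E] card_ends[OF E] p
    by (intro expectation_card_contained[symmetric]) auto
  also have "\<dots> \<le> measure_pmf.expectation ?M (\<lambda>Q. 3 * real (card Q) + real (card (?X Q)))"
    using finite_P induced
    by (intro integral_mono_AE) (auto intro!: AE_pmfI dest: set_random_subset)
  also have "\<dots> = 3 * (p * card P) + (\<Sum>c\<in>crossings E. p ^ card (?ends2 c))"
    using finite_P p finite_crossings[OF E] in_P
    by (simp add: expectation_card_random_subset expectation_card_contained)
  also have "(\<Sum>c\<in>crossings E. p ^ card (?ends2 c)) = p ^ 4 * card (crossings E)"
    using card_crossing_ends[OF E] by (simp add: case_prod_unfold)
  finally show ?thesis .
qed

lemma crossing_lemma:
  assumes E: "drawn E" and dense: "6 * card P \<le> card E"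
  shows "real (card E)^3 \<le> 72 * real (card P)^2 * card (crossings E)"
proof (cases "E = {}")
  case False
  define n m X where "n = real (card P)" "m = real (card E)" "X = real (card (crossings E))"
  have "P \<noteq> {}" using drawn_edge[OF E] False by blast
  then have n: "0 < n" using finite_P by (simp add: n_m_X_def card_gt_0_iff)
  have m: "6 * n \<le> m" "0 < m" using dense n unfolding n_m_X_def by linarith+
  define p where "p = 6 * n / m"
  have p: "0 < p" "p \<le> 1" "p * m = 6 * n" using n m by (auto simp: p_def)
  have "p * (p * m) \<le> p * (3 * n + p ^ 3 * X)"
    using sampled_edges_le_crossings[OF E, of p] p(1,2)
    by (simp add: n_m_X_def eval_nat_numeral algebra_simps)
  then have "3 * n \<le> p ^ 3 * X" using p by simp
  then have "3 * n * m ^ 3 \<le> (p * m) ^ 3 * X"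
    using m mult_right_mono[of "3 * n" "p ^ 3 * X" "m ^ 3"]
    by (simp add: power_mult_distrib mult_ac)
  also have "\<dots> = 3 * n * (72 * n\<^sup>2 * X)" unfolding p(3) by (simp add: eval_nat_numeral)
  finally have "m ^ 3 \<le> 72 * n\<^sup>2 * X" using n by (simp add: mult_ac)
  then show ?thesis by (simp add: n_m_X_def)
qed simp

end

section \<open>Rich lines and collinear triples\<close>

context drawing
begin

text \<open>The pair \<open>(a, b)\<close> stands for the line of equation \<open>y = a + b x\<close>.\<close>

definition on_line :: "real \<times> real \<Rightarrow> 'a set" where
  "on_line l = {w\<in>P. y w = fst l + snd l * x w}"

definition consecutive :: "real \<times> real \<Rightarrow> ('a \<times> 'a) set" where
  "consecutive l = {(u, v). u \<in> on_line l \<and> v \<in> on_line l \<and> x u < x v \<and>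
     (\<forall>w\<in>on_line l. \<not> (x u < x w \<and> x w < x v))}"

lemma on_line_subset: "on_line l \<subseteq> P"
  by (auto simp: on_line_def)

lemma finite_on_line [simp]: "finite (on_line l)"
  using finite_P by (simp add: on_line_def)

lemma finite_consecutive [simp]: "finite (consecutive l)"
  by (rule finite_subset[of _ "on_line l \<times> on_line l"]) (auto simp: consecutive_def)

lemma card_on_line_le: "card (on_line l) \<le> card (consecutive l) + 1"
proof (cases "on_line l = {}")
  case False
  then obtain last where last: "last \<in> on_line l" "\<And>z. z \<in> on_line l \<Longrightarrow> x z \<le> x last"
    using arg_min_if_finite[OF finite_on_line False, of "\<lambda>z. - x z"]
    by (metis neg_less_iff_less not_le)
  have "u \<in> fst ` consecutive l" if u: "u \<in> on_line l" "u \<noteq> last" for u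
  proof -
    let ?N = "{w\<in>on_line l. x u < x w}"
    have "x u \<noteq> x last"
      using u last(1) inj_x by (auto simp: on_line_def dest: inj_onD)
    then have "last \<in> ?N" using last u(1) by force
    then have "?N \<noteq> {}" "finite ?N" by auto
    then obtain v where "v \<in> ?N" "\<And>z. z \<in> ?N \<Longrightarrow> x v \<le> x z"
      using arg_min_if_finite[of ?N x] by (metis (no_types, lifting) not_le)
    then have "(u, v) \<in> consecutive l" using u(1) by (fastforce simp: consecutive_def)
    then show ?thesis by force
  qed
  then have "on_line l - {last} \<subseteq> fst ` consecutive l" by blast
  then have "card (on_line l - {last}) \<le> card (consecutive l)"
    by (meson card_image_le card_mono finite_consecutive finite_imageI le_trans)
  then show ?thesis using last(1) by simp
qed simp

lemma lines_meet_once: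
  fixes l l' :: "real \<times> real"
  assumes "fst l + snd l * a = fst l' + snd l' * a" "fst l + snd l * b = fst l' + snd l' * b"
    "a \<noteq> b"
  shows "l = l'"
proof -
  have "(snd l - snd l') * (a - b) = 0" using assms(1,2) by (simp add: algebra_simps)
  then show ?thesis using assms by (simp add: prod_eq_iff)
qed

lemma two_points_determine_line:
  assumes "u \<in> on_line l" "v \<in> on_line l" "u \<in> on_line l'" "v \<in> on_line l'" "u \<noteq> v"
  shows "l = l'"
proof -
  have "x u \<noteq> x v" using assms inj_x by (auto simp: on_line_def dest: inj_onD)
  then show ?thesis
    using assms lines_meet_once[of l "x u" l' "x v"] by (auto simp: on_line_def)
qed

lemma height_consecutive:
  assumes "e \<in> consecutive l"
  shows "height e a = fst l + snd l * a"
proof -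
  obtain u v
    where e: "e = (u, v)" "x u < x v" "y u = fst l + snd l * x u" "y v = fst l + snd l * x v"
    using assms by (auto simp: consecutive_def on_line_def)
  have "slope e = (snd l * (x v - x u)) / (x v - x u)"
    using e by (simp add: slope_def algebra_simps)
  then have "slope e = snd l" using e(2) by simp
  then show ?thesis using e by (simp add: height_def algebra_simps)
qed

lemma consecutive_spans_unique:
  assumes "e \<in> consecutive l" "g \<in> consecutive l" "spans e a" "spans g a"
  shows "e = g"
proof -
  obtain u v u' v' where e: "e = (u, v)" and g: "g = (u', v')" by (metis surj_pair)
  have "\<not> (x u < x u' \<and> x u' < x v)" "\<not> (x u < x v' \<and> x v' < x v)"
    "\<not> (x u' < x u \<and> x u < x v')" "\<not> (x u' < x v \<and> x v < x v')"
    using assms(1,2) unfolding e g consecutive_def by blast+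
  then have "x u = x u'" "x v = x v'" using assms(3,4) by (auto simp: e g spans_def)
  then show ?thesis
    using inj_x assms by (auto simp: e g consecutive_def on_line_def dest: inj_onD)
qed

lemma drawn_consecutive: "drawn (\<Union>l\<in>L. consecutive l)"
  unfolding drawn_def
proof (intro conjI ballI impI)
  fix e assume "e \<in> (\<Union>l\<in>L. consecutive l)"
  then obtain l where l: "e \<in> consecutive l" by blast
  then show "fst e \<in> P" "snd e \<in> P" "x (fst e) < x (snd e)"
    by (auto simp: consecutive_def on_line_def)
  show "height e (x w) \<noteq> y w" if w: "w \<in> P" "spans e (x w)" for w
  proof
    assume "height e (x w) = y w"
    then have "w \<in> on_line l" using w(1) height_consecutive[OF l] by (simp add: on_line_def)
    then show False using l w(2) by (auto simp: consecutive_def spans_def)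
  qed
qed

lemma card_consecutive_edges_ge:
  assumes L: "finite L" and rich: "\<And>l. l \<in> L \<Longrightarrow> r < card (on_line l)"
  shows "card L * r \<le> card (\<Union>l\<in>L. consecutive l)"
proof -
  have "card L * r \<le> (\<Sum>l\<in>L. card (consecutive l))"
  proof -
    have "r \<le> card (consecutive l)" if "l \<in> L" for l
      using rich[OF that] card_on_line_le[of l] by linarith
    then show ?thesis using sum_bounded_below[of L r] by simp
  qed
  also have "\<dots> = card (\<Union>l\<in>L. consecutive l)"
  proof (intro card_UN_disjoint[symmetric] ballI impI)
    fix l l' :: "real \<times> real" assume "l \<noteq> l'"
    then show "consecutive l \<inter> consecutive l' = {}"
      using two_points_determine_line[of _ l _ l'] by (fastforce simp: consecutive_def)
  qed (use L in auto)
  finally show ?thesis .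
qed

lemma card_crossings_consecutive_le:
  assumes L: "finite L"
  shows "card (crossings (\<Union>l\<in>L. consecutive l)) \<le> (card L)\<^sup>2"
proof -
  let ?E = "\<Union>l\<in>L. consecutive l"
  obtain line where line: "\<And>e. e \<in> ?E \<Longrightarrow> line e \<in> L \<and> e \<in> consecutive (line e)"
    by (metis UN_E)
  have "inj_on (map_prod line line) (crossings ?E)"
  proof (rule inj_onI, clarify)
    fix e g e' g' assume X: "(e, g) \<in> crossings ?E" "(e', g') \<in> crossings ?E"
      and "map_prod line line (e, g) = map_prod line line (e', g')"
    then have same: "line e' = line e" "line g' = line g" by simp_all
    obtain a where a: "spans e a" "spans g a" "height e a = height g a" "e \<in> ?E" "g \<in> ?E" "e \<noteq> g"
      using X(1) by (auto simp: crossings_def crosses_def)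
    obtain b where b: "spans e' b" "spans g' b" "height e' b = height g' b" "e' \<in> ?E" "g' \<in> ?E"
      using X(2) by (auto simp: crossings_def crosses_def)
    note e = conjunct2[OF line[OF a(4)]] and g = conjunct2[OF line[OF a(5)]]
      and e' = conjunct2[OF line[OF b(4)], unfolded same]
      and g' = conjunct2[OF line[OF b(5)], unfolded same]
    have "line e \<noteq> line g"
      using consecutive_spans_unique[OF e _ a(1,2)] g a(6) by auto
    moreover have "fst (line e) + snd (line e) * a = fst (line g) + snd (line g) * a"
      "fst (line e) + snd (line e) * b = fst (line g) + snd (line g) * b"
      using a(3) b(3) height_consecutive e g e' g' by simp_all
    ultimately have "a = b" using lines_meet_once by blast
    then show "e = e' \<and> g = g'"
      using consecutive_spans_unique[OF e e' a(1)] consecutive_spans_unique[OF g g' a(2)] b(1,2)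
      by simp
  qed
  moreover have "line ` ?E \<subseteq> L" using line by blast
  then have "map_prod line line ` crossings ?E \<subseteq> L \<times> L" by (force simp: crossings_def)
  ultimately have "card (crossings ?E) \<le> card (L \<times> L)"
    using L by (intro card_inj_on_le) auto
  then show ?thesis by (simp add: card_cartesian_product power2_eq_square)
qed

lemma Szemeredi_Trotter_rich_lines:
  assumes L: "finite L" and rich: "\<And>l. l \<in> L \<Longrightarrow> r < card (on_line l)" and r: "0 < r"
  shows "card L \<le> 72 * real (card P)^2 / real r ^ 3 + 6 * real (card P) / real r"
proof -
  let ?E = "\<Union>l\<in>L. consecutive l"
  have "real (card L * r) \<le> real (card ?E)"
    using card_consecutive_edges_ge[OF L rich] by (simp only: of_nat_le_iff)
  then have edges: "real (card L) * real r \<le> card ?E" by simp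
  show ?thesis
  proof (cases "6 * card P \<le> card ?E \<and> L \<noteq> {}")
    case True
    then have L_pos: "0 < real (card L)" using L by (simp add: card_gt_0_iff)
    have crossings: "real (card (crossings ?E)) \<le> real ((card L)\<^sup>2)"
      using card_crossings_consecutive_le[OF L] by (simp only: of_nat_le_iff)
    have "(real (card L) * real r) ^ 3 \<le> real (card ?E) ^ 3"
      using edges by (intro power_mono) auto
    also have "\<dots> \<le> 72 * real (card P)^2 * real (card (crossings ?E))"
      using True by (intro crossing_lemma drawn_consecutive) blast
    also have "\<dots> \<le> 72 * real (card P)^2 * real ((card L)\<^sup>2)"
      using crossings by (rule mult_left_mono) simp
    finally have "real (card L) ^ 2 * (real (card L) * real r ^ 3) \<le> real (card L) ^ 2 * (72 * real (card P)^2)"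
      by (simp add: power_mult_distrib eval_nat_numeral mult_ac)
    then have "real (card L) \<le> 72 * real (card P)^2 / real r ^ 3"
      using L_pos r by (simp add: pos_le_divide_eq)
    moreover have "0 \<le> 6 * real (card P) / real r" by simp
    ultimately show ?thesis by linarith
  next
    case False
    then have "real (card L) * real r \<le> 6 * real (card P)" using edges by (cases "L = {}") auto
    then have "real (card L) \<le> 6 * real (card P) / real r" using r by (simp add: pos_le_divide_eq)
    moreover have "0 \<le> 72 * real (card P)^2 / real r ^ 3" by simp
    ultimately show ?thesis by linarith
  qed
qed

definition collinear_triples :: "'a set set" where
  "collinear_triples = {t. card t = 3 \<and> (\<exists>l. t \<subseteq> on_line l)}"

lemma finite_collinear_triples [simp]: "finite collinear_triples"
  by (rule finite_subset[of _ "Pow P"]) (use finite_P in \<open>auto simp: collinear_triples_def on_line_def\<close>)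

lemma collinear_triples_subset: "t \<in> collinear_triples \<Longrightarrow> t \<subseteq> P \<and> t \<noteq> {}"
  using on_line_subset by (fastforce simp: collinear_triples_def)

definition spanned_lines :: "(real \<times> real) set" where
  "spanned_lines = {l. 2 \<le> card (on_line l)}"

lemma finite_spanned_lines [simp]: "finite spanned_lines"
proof (rule finite_imageD)
  show "finite (on_line ` spanned_lines)"
    by (rule finite_subset[of _ "Pow P"]) (use finite_P in \<open>auto simp: on_line_def\<close>)
  show "inj_on on_line spanned_lines"
  proof (rule inj_onI)
    fix l l' assume l: "l \<in> spanned_lines" and eq: "on_line l = on_line l'"
    obtain S where "S \<subseteq> on_line l" "card S = 2"
      using l unfolding spanned_lines_def mem_Collect_eq by (rule obtain_subset_with_card_n)
    then obtain u v where "u \<in> on_line l" "v \<in> on_line l" "u \<noteq> v" by (auto simp: card_2_iff)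
    then show "l = l'" using two_points_determine_line[of u l v l'] eq by simp
  qed
qed

lemma card_collinear_triples_le_sum:
  assumes s: "\<And>l. card (on_line l) \<le> s"
  shows "card collinear_triples \<le> (\<Sum>j<s. card {l\<in>spanned_lines. j < card (on_line l)} * (j choose 2))"
proof -
  have "collinear_triples \<subseteq> (\<Union>l\<in>spanned_lines. {t. t \<subseteq> on_line l \<and> card t = 3})"
  proof
    fix t assume "t \<in> collinear_triples"
    then obtain l where l: "t \<subseteq> on_line l" "card t = 3" by (auto simp: collinear_triples_def)
    then have "3 \<le> card (on_line l)" by (metis card_mono finite_on_line)
    then have "l \<in> spanned_lines" by (simp add: spanned_lines_def)
    then show "t \<in> (\<Union>l\<in>spanned_lines. {t. t \<subseteq> on_line l \<and> card t = 3})" using l by blast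
  qed
  then have "card collinear_triples \<le> card (\<Union>l\<in>spanned_lines. {t. t \<subseteq> on_line l \<and> card t = 3})"
    by (intro card_mono) auto
  also have "\<dots> \<le> (\<Sum>l\<in>spanned_lines. card {t. t \<subseteq> on_line l \<and> card t = 3})"
    by (rule card_UN_le) simp
  also have "\<dots> = (\<Sum>l\<in>spanned_lines. card (on_line l) choose Suc 2)" by (simp add: n_subsets)
  also have "\<dots> = (\<Sum>j<s. card {l\<in>spanned_lines. j < card (on_line l)} * (j choose 2))"
    using s by (intro sum_choose_layers) simp_all
  finally show ?thesis .
qed

lemma card_collinear_triples_le:
  assumes s: "\<And>l. card (on_line l) \<le> s" and "0 < s"
  shows "card collinear_triples \<le> 36 * real (card P)^2 * (1 + ln s) + 3 * real (card P) * real s^2"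
proof -
  define n where "n = real (card P)"
  let ?rich = "\<lambda>j. {l\<in>spanned_lines. j < card (on_line l)}"
  have layer: "real (card (?rich j) * (j choose 2)) \<le> 36 * n\<^sup>2 * (1 / real j) + 3 * n * real s"
    if j: "j < s" for j
  proof (cases "j = 0")
    case False
    have "real ((j choose 2) * fact 2) \<le> real (j\<^sup>2)"
      using binomial_fact_pow[of j 2] by (simp only: of_nat_le_iff)
    then have choose2: "real (j choose 2) \<le> real j ^ 2 / 2" by simp
    have "real (card (?rich j)) \<le> 72 * n\<^sup>2 / real j ^ 3 + 6 * n / real j"
      unfolding n_def using False by (intro Szemeredi_Trotter_rich_lines) auto
    then have "real (card (?rich j) * (j choose 2)) \<le> (72 * n\<^sup>2 / real j ^ 3 + 6 * n / real j) * (real j ^ 2 / 2)"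
      unfolding of_nat_mult using choose2 by (intro mult_mono) (auto simp: n_def)
    also have "\<dots> = 36 * n\<^sup>2 * (1 / real j) + 3 * n * real j"
      using False by (simp add: field_simps eval_nat_numeral)
    also have "\<dots> \<le> 36 * n\<^sup>2 * (1 / real j) + 3 * n * real s"
      using j by (intro add_left_mono mult_left_mono) (auto simp: n_def)
    finally show ?thesis .
  qed (simp add: n_def numeral_2_eq_2)
  have "real (card collinear_triples) \<le> real (\<Sum>j<s. card (?rich j) * (j choose 2))"
    using card_collinear_triples_le_sum[OF s] by (simp only: of_nat_le_iff)
  also have "\<dots> = (\<Sum>j<s. real (card (?rich j) * (j choose 2)))" by simp
  also have "\<dots> \<le> (\<Sum>j<s. 36 * n\<^sup>2 * (1 / real j) + 3 * n * real s)"
    using layer by (intro sum_mono) simp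
  also have "\<dots> = 36 * n\<^sup>2 * (\<Sum>j<s. 1 / real j) + 3 * n * real s ^ 2"
    by (simp add: sum.distrib sum_distrib_left power2_eq_square)
  also have "\<dots> \<le> 36 * n\<^sup>2 * (1 + ln s) + 3 * n * real s ^ 2"
    using sum_inverse_le[OF \<open>0 < s\<close>] by (intro add_right_mono mult_left_mono) auto
  finally show ?thesis by (simp only: n_def)
qed

end

section \<open>Large subsets in general position\<close>

lemma collinear_iff_triples:
  fixes S :: "'a :: euclidean_space set"
  shows "collinear S \<longleftrightarrow> (\<forall>p\<in>S. \<forall>q\<in>S. \<forall>r\<in>S. collinear {p, q, r})"
proof
  assume "collinear S"
  then show "\<forall>p\<in>S. \<forall>q\<in>S. \<forall>r\<in>S. collinear {p, q, r}"
    by (auto intro: collinear_subset)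
next
  assume triples: "\<forall>p\<in>S. \<forall>q\<in>S. \<forall>r\<in>S. collinear {p, q, r}"
  show "collinear S"
  proof (cases "\<exists>p\<in>S. \<exists>q\<in>S. p \<noteq> q")
    case True
    then obtain p q where "p \<in> S" "q \<in> S" "p \<noteq> q" by blast
    then show ?thesis
      using triples collinear_triples[of p q S] by (simp add: insert_absorb)
  next
    case False
    then have "S = {} \<or> (\<exists>p. S = {p})" by blast
    then show ?thesis by auto
  qed
qed

lemma collinear_0_2D: "collinear {0, u, v :: real ^ 2} \<longleftrightarrow> u $ 1 * v $ 2 = v $ 1 * u $ 2"
proof
  assume "collinear {0, u, v}"
  then show "u $ 1 * v $ 2 = v $ 1 * u $ 2" by (auto simp: collinear_lemma)
next
  assume det: "u $ 1 * v $ 2 = v $ 1 * u $ 2"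
  consider "u = 0" | "u $ 1 \<noteq> 0" | "u $ 1 = 0" "u $ 2 \<noteq> 0" by (auto simp: vec_eq_iff forall_2)
  then show "collinear {0, u, v}"
  proof cases
    case 2
    then have "v = (v $ 1 / u $ 1) *\<^sub>R u" using det by (simp add: vec_eq_iff forall_2 field_simps)
    then show ?thesis by (metis collinear_lemma)
  next
    case 3
    then have "v = (v $ 2 / u $ 2) *\<^sub>R u" using det by (simp add: vec_eq_iff forall_2 field_simps)
    then show ?thesis by (metis collinear_lemma)
  qed simp
qed

lemma collinear_3_2D:
  fixes p q r :: "real ^ 2"
  shows "collinear {p, q, r} \<longleftrightarrow> (q $ 1 - p $ 1) * (r $ 2 - p $ 2) = (r $ 1 - p $ 1) * (q $ 2 - p $ 2)"
proof -
  have "collinear {p, q, r} \<longleftrightarrow> collinear {0, q - p, r - p}"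
    using collinear_3[of q p r] by (simp add: insert_commute)
  then show ?thesis by (simp add: collinear_0_2D)
qed

lemma general_position_subset: "general_position P \<Longrightarrow> Q \<subseteq> P \<Longrightarrow> general_position Q"
  by (auto simp: general_position_def no_collinear_def)

lemma ex_shear_inj_on:
  fixes P :: "(real ^ 2) set"
  assumes "finite P"
  shows "\<exists>t. inj_on (\<lambda>p. p $ 1 + t * p $ 2) P"
proof -
  let ?bad = "(\<lambda>(p, q). (q $ 1 - p $ 1) / (p $ 2 - q $ 2)) ` (P \<times> P)"
  obtain t where t: "t \<notin> ?bad"
    using ex_new_if_finite[OF infinite_UNIV_char_0, of ?bad] assms by auto
  have "inj_on (\<lambda>p. p $ 1 + t * p $ 2) P"
  proof (rule inj_onI, rule ccontr)
    fix p q assume pq: "p \<in> P" "q \<in> P" "p $ 1 + t * p $ 2 = q $ 1 + t * q $ 2" "p \<noteq> q"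
    then have "p $ 2 \<noteq> q $ 2" by (auto simp: vec_eq_iff forall_2)
    then have "t = (q $ 1 - p $ 1) / (p $ 2 - q $ 2)" using pq(3) by (simp add: field_simps)
    with pq t show False by force
  qed
  then show ?thesis ..
qed

locale sheared_points =
  fixes P :: "(real ^ 2) set" and t :: real
  assumes finite_points: "finite P" and inj_shear: "inj_on (\<lambda>p. p $ 1 + t * p $ 2) P"
begin

sublocale drawing "\<lambda>p. p $ 1 + t * p $ 2" "\<lambda>p. p $ 2" P
  by unfold_locales (fact finite_points inj_shear)+

lemma collinear_iff_on_line:
  assumes S: "S \<subseteq> P"
  shows "collinear S \<longleftrightarrow> (\<exists>l. S \<subseteq> on_line l)"
proof
  let ?x = "\<lambda>p. p $ 1 + t * p $ 2"
  have det: "collinear {p, q, r} \<longleftrightarrow>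
      (?x q - ?x p) * (r $ 2 - p $ 2) = (?x r - ?x p) * (q $ 2 - p $ 2)" for p q r :: "real ^ 2"
    unfolding collinear_3_2D by (simp add: algebra_simps)
  show "collinear S" if on_line: "\<exists>l. S \<subseteq> on_line l"
  proof -
    obtain l where l: "S \<subseteq> on_line l" using on_line by blast
    have "r $ 2 - p $ 2 = snd l * (?x r - ?x p)" if "p \<in> S" "r \<in> S" for p r
      using subsetD[OF l that(1)] subsetD[OF l that(2)] by (simp add: on_line_def algebra_simps)
    then show ?thesis
      unfolding collinear_iff_triples[of S] det by (simp add: mult_ac)
  qed
  assume col: "collinear S"
  show "\<exists>l. S \<subseteq> on_line l"
  proof (cases "\<exists>p\<in>S. \<exists>q\<in>S. p \<noteq> q")
    case True
    then obtain p q where pq: "p \<in> S" "q \<in> S" "p \<noteq> q" by blast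
    then have "?x q \<noteq> ?x p" using S inj_onD[OF inj_shear] by blast
    define b where "b = (q $ 2 - p $ 2) / (?x q - ?x p)"
    have "r $ 2 = p $ 2 - b * ?x p + b * ?x r" if "r \<in> S" for r
    proof -
      have "(?x q - ?x p) * (r $ 2 - p $ 2) = (?x r - ?x p) * (q $ 2 - p $ 2)"
        using col pq that unfolding collinear_iff_triples[of S] det by blast
      then have "r $ 2 - p $ 2 = b * (?x r - ?x p)"
        using \<open>?x q \<noteq> ?x p\<close> by (simp add: b_def eq_divide_eq mult.commute)
      then show ?thesis by (simp add: algebra_simps)
    qed
    then have "S \<subseteq> on_line (p $ 2 - b * ?x p, b)" using S by (auto simp: on_line_def)
    then show ?thesis ..
  next
    case False
    then obtain p where "S \<subseteq> {p}" by blast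
    then have "S \<subseteq> on_line (p $ 2, 0)" using S by (auto simp: on_line_def)
    then show ?thesis ..
  qed
qed

lemma card_on_line_le_of_no_collinear:
  assumes "no_collinear (s + 1) P"
  shows "card (on_line l) \<le> s"
proof (rule ccontr)
  assume "\<not> ?thesis"
  then have "s + 1 \<le> card (on_line l)" by simp
  then obtain S where S: "S \<subseteq> on_line l" "card S = s + 1" by (rule obtain_subset_with_card_n)
  have "S \<subseteq> P" using S(1) on_line_subset by (rule subset_trans)
  then have "collinear S" using collinear_iff_on_line[of S] S(1) by blast
  then show False using assms S(2) \<open>S \<subseteq> P\<close> unfolding no_collinear_def by blast
qed

lemma general_position_iff_collinear_triples:
  assumes "Q \<subseteq> P"
  shows "general_position Q \<longleftrightarrow> (\<forall>t\<in>collinear_triples. \<not> t \<subseteq> Q)"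
proof -
  have "collinear t \<longleftrightarrow> (\<exists>l. t \<subseteq> on_line l)" if "t \<subseteq> Q" for t
    using subset_trans[OF that assms] by (rule collinear_iff_on_line)
  then have "general_position Q \<longleftrightarrow> (\<forall>t. t \<subseteq> Q \<and> card t = 3 \<longrightarrow> \<not> (\<exists>l. t \<subseteq> on_line l))"
    unfolding general_position_def no_collinear_def by (simp cong: imp_cong)
  also have "\<dots> \<longleftrightarrow> (\<forall>t\<in>collinear_triples. \<not> t \<subseteq> Q)"
    by (auto simp: collinear_triples_def)
  finally show ?thesis .
qed

end

lemma ex_general_position_subset:
  fixes P :: "(real ^ 2) set" and p :: real
  assumes P: "finite P" "no_collinear (s + 1) P" and s: "0 < s" and p: "0 \<le> p" "p \<le> 1"
    and sparse: "p\<^sup>2 * (36 * real (card P) * (1 + ln s) + 3 * real s^2) \<le> 1 / 2"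
  shows "\<exists>Q\<subseteq>P. general_position Q \<and> p * card P / 2 \<le> card Q"
proof -
  obtain t where "inj_on (\<lambda>p. p $ 1 + t * p $ 2) P" using ex_shear_inj_on[OF P(1)] by blast
  with P(1) interpret sheared_points P t by unfold_locales
  obtain Q where Q: "Q \<subseteq> P" "\<forall>t\<in>collinear_triples. \<not> t \<subseteq> Q"
    "p * card P - (\<Sum>t\<in>collinear_triples. p ^ card t) \<le> card Q"
    using random_deletion[OF P(1) finite_collinear_triples _ p] collinear_triples_subset by blast
  have "(\<Sum>t\<in>collinear_triples. p ^ card t) = p ^ 3 * card collinear_triples"
    by (simp add: collinear_triples_def)
  also have "\<dots> \<le> p ^ 3 * (36 * real (card P)^2 * (1 + ln s) + 3 * real (card P) * real s^2)"
    using card_collinear_triples_le[OF card_on_line_le_of_no_collinear[OF P(2)] s] p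
    by (intro mult_left_mono) auto
  also have "\<dots> = p * card P * (p\<^sup>2 * (36 * real (card P) * (1 + ln s) + 3 * real s^2))"
    by (simp add: algebra_simps eval_nat_numeral)
  also have "\<dots> \<le> p * card P * (1 / 2)"
    using sparse p by (intro mult_left_mono) auto
  finally show ?thesis
    using Q general_position_iff_collinear_triples[OF Q(1)] by (intro exI[of _ Q]) auto
qed

lemma f_geI:
  fixes a :: real
  assumes s: "2 \<le> s"
    and large: "\<And>P :: (real ^ 2) set. finite P \<Longrightarrow> card P = n \<Longrightarrow> no_collinear (s + 1) P \<Longrightarrow>
      \<exists>Q\<subseteq>P. general_position Q \<and> a \<le> card Q"
  shows "a \<le> real (f n s)"
proof -
  have "forces_general_position n s (nat \<lceil>a\<rceil>)"
    unfolding forces_general_position_def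
  proof (intro allI impI, elim conjE)
    fix P :: "(real ^ 2) set" assume "finite P" "card P = n" "no_collinear (s + 1) P"
    then obtain Q where Q: "Q \<subseteq> P" "general_position Q" "a \<le> card Q" using large by blast
    then have "nat \<lceil>a\<rceil> \<le> card Q" by (simp add: ceiling_le_iff nat_le_iff)
    then obtain R where "R \<subseteq> Q" "card R = nat \<lceil>a\<rceil>" by (metis obtain_subset_with_card_n)
    then show "\<exists>Q\<subseteq>P. card Q = nat \<lceil>a\<rceil> \<and> general_position Q"
      using Q general_position_subset by blast
  qed
  then have "nat \<lceil>a\<rceil> \<le> f n s" using f_is_greatest(2)[OF s] by blast
  then show ?thesis by linarith
qed

lemma f_leI:
  fixes P :: "(real ^ 2) set" and a :: real
  assumes s: "2 \<le> s" and P: "finite P" "card P = n" "no_collinear (s + 1) P"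
    and small: "\<And>Q. Q \<subseteq> P \<Longrightarrow> general_position Q \<Longrightarrow> card Q \<le> a"
  shows "real (f n s) \<le> a"
proof -
  obtain Q where "Q \<subseteq> P" "card Q = f n s" "general_position Q"
    using f_is_greatest(1)[OF s, of n] P unfolding forces_general_position_def by blast
  then show ?thesis using small[of Q] by simp
qed

lemma f_lower_bound:
  assumes n: "3 \<le> n" and s: "2 \<le> s" "s \<le> n" and a: "0 \<le> a" "real n * ln n \<le> a * real s ^ 2"
  shows "real n \<le> (288 * a + 12) * real s * real (f n s)"
proof -
  define K where "K = 144 * a + 6"
  define p where "p = 1 / (K * s)"
  have K: "1 \<le> K" "K \<le> K\<^sup>2" using a by (auto simp: K_def power2_eq_square)
  have "1 * 1 \<le> K * real s" using K s by (intro mult_mono) auto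
  then have p: "0 \<le> p" "p \<le> 1" by (simp_all add: p_def)
  have "1 + ln (real s) \<le> 2 * ln (real n)"
  proof -
    have "1 \<le> ln (real n)" using n by (rule ln_ge_1)
    moreover have "ln (real s) \<le> ln (real n)" using s by simp
    ultimately show ?thesis by linarith
  qed
  then have "real n * (1 + ln s) \<le> real n * (2 * ln n)" by (rule mult_left_mono) simp
  then have "36 * real n * (1 + ln s) + 3 * real s^2 \<le> K / 2 * real s ^ 2"
    using a(2) by (simp add: K_def algebra_simps)
  also have "\<dots> \<le> K\<^sup>2 / 2 * real s ^ 2" using K by (intro mult_right_mono) auto
  finally have "p\<^sup>2 * (36 * real n * (1 + ln s) + 3 * real s^2) \<le> p\<^sup>2 * (K\<^sup>2 / 2 * real s ^ 2)"
    by (rule mult_left_mono) simp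
  also have "\<dots> = 1 / 2" using K s by (simp add: p_def power_divide power_mult_distrib)
  finally have sparse: "p\<^sup>2 * (36 * real n * (1 + ln s) + 3 * real s^2) \<le> 1 / 2" .
  have "p * n / 2 \<le> f n s"
  proof (rule f_geI[OF s(1)])
    fix P :: "(real ^ 2) set" assume P: "finite P" "card P = n" "no_collinear (s + 1) P"
    then show "\<exists>Q\<subseteq>P. general_position Q \<and> p * n / 2 \<le> card Q"
      using ex_general_position_subset[OF P(1,3) _ p] sparse s(1) by simp
  qed
  then have "real n \<le> 2 * (K * s) * real (f n s)"
    using K s by (simp add: p_def pos_divide_le_eq mult_ac)
  then show ?thesis by (simp add: K_def algebra_simps)
qed

section \<open>Containers for linear 3-graphs\<close>

definition independent :: "'a set set \<Rightarrow> 'a set \<Rightarrow> bool" where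
  "independent H I \<longleftrightarrow> (\<forall>e\<in>H. \<not> e \<subseteq> I)"

definition container_family :: "('a set \<Rightarrow> bool) \<Rightarrow> 'a set \<Rightarrow> 'a set set \<Rightarrow> bool" where
  "container_family \<I> A \<C> \<longleftrightarrow> finite \<C> \<and> (\<forall>C\<in>\<C>. C \<subseteq> A) \<and> (\<forall>I\<subseteq>A. \<I> I \<longrightarrow> (\<exists>C\<in>\<C>. I \<subseteq> C))"

lemma container_family_UN:
  assumes \<D>: "container_family \<I> A \<D>" and F: "\<And>B. B \<in> \<D> \<Longrightarrow> container_family \<I> B (F B)"
  shows "container_family \<I> A (\<Union>B\<in>\<D>. F B)"
  unfolding container_family_def
proof (intro conjI ballI allI impI)
  show "finite (\<Union>B\<in>\<D>. F B)" using assms by (simp add: container_family_def)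
  show "C \<subseteq> A" if "C \<in> (\<Union>B\<in>\<D>. F B)" for C
  proof -
    obtain B where "B \<in> \<D>" "C \<in> F B" using \<open>C \<in> (\<Union>B\<in>\<D>. F B)\<close> by blast
    then have "C \<subseteq> B" "B \<subseteq> A" using assms by (simp_all add: container_family_def)
    then show ?thesis by (rule subset_trans)
  qed
  fix I assume I: "I \<subseteq> A" "\<I> I"
  then obtain B where B: "B \<in> \<D>" "I \<subseteq> B" using \<D> by (auto simp: container_family_def)
  then obtain C where "C \<in> F B" "I \<subseteq> C" using F[OF B(1)] I(2) by (auto simp: container_family_def)
  then show "\<exists>C\<in>\<Union>B\<in>\<D>. F B. I \<subseteq> C" using B(1) by blast
qed

lemma iterate_containers:
  fixes r M :: real
  assumes step: "\<And>B. B \<subseteq> A \<Longrightarrow> M < card B \<Longrightarrow>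
      \<exists>\<C>. container_family \<I> B \<C> \<and> card \<C> \<le> N \<and> (\<forall>C\<in>\<C>. card C \<le> r * card B)"
    and small: "r ^ j * card A \<le> M" and r: "0 \<le> r" and N: "1 \<le> N"
  shows "\<exists>\<C>. container_family \<I> A \<C> \<and> card \<C> \<le> N ^ j \<and> (\<forall>C\<in>\<C>. card C \<le> M)"
  using step small
proof (induction j arbitrary: A)
  case 0
  then show ?case by (intro exI[of _ "{A}"]) (simp add: container_family_def)
next
  case (Suc j)
  show ?case
  proof (cases "card A \<le> M")
    case True
    moreover have "1 \<le> N ^ Suc j" using N by (rule one_le_power)
    ultimately show ?thesis by (intro exI[of _ "{A}"]) (simp add: container_family_def)
  next
    case False
    then obtain \<D> where \<D>: "container_family \<I> A \<D>" "card \<D> \<le> N" "\<forall>B\<in>\<D>. card B \<le> r * card A"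
      using Suc.prems(1)[of A] by auto
    have "\<forall>B\<in>\<D>. \<exists>\<C>. container_family \<I> B \<C> \<and> card \<C> \<le> N ^ j \<and> (\<forall>C\<in>\<C>. card C \<le> M)"
    proof
      fix B assume B: "B \<in> \<D>"
      have "B \<subseteq> A" using \<D>(1) B by (simp add: container_family_def)
      have "r ^ j * card B \<le> r ^ j * (r * card A)" using \<D>(3) B r by (intro mult_left_mono) auto
      also have "\<dots> \<le> M" using Suc.prems(2) by (simp add: mult_ac)
      finally show "\<exists>\<C>. container_family \<I> B \<C> \<and> card \<C> \<le> N ^ j \<and> (\<forall>C\<in>\<C>. card C \<le> M)"
        using \<open>B \<subseteq> A\<close> by (intro Suc.IH Suc.prems(1)) auto
    qed
    from bchoice[OF this] obtain F where F: "\<forall>B\<in>\<D>. container_family \<I> B (F B) \<and>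
        card (F B) \<le> N ^ j \<and> (\<forall>C\<in>F B. card C \<le> M)" ..
    have "card (\<Union>B\<in>\<D>. F B) \<le> (\<Sum>B\<in>\<D>. card (F B))"
      using \<D>(1) by (intro card_UN_le) (simp add: container_family_def)
    also have "\<dots> \<le> card \<D> * N ^ j" using F sum_bounded_above[of \<D> "\<lambda>B. card (F B)" "N ^ j"] by simp
    also have "\<dots> \<le> N ^ Suc j" using \<D>(2) by simp
    finally have "card (\<Union>B\<in>\<D>. F B) \<le> N ^ Suc j" .
    moreover have "container_family \<I> A (\<Union>B\<in>\<D>. F B)"
      using F by (intro container_family_UN[OF \<D>(1)]) blast
    ultimately show ?thesis using F by blast
  qed
qed

fun greedy :: "('a list \<Rightarrow> 'a \<Rightarrow> bool) \<Rightarrow> 'a list \<Rightarrow> bool" where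
  "greedy Q [] \<longleftrightarrow> True"
| "greedy Q (u # us) \<longleftrightarrow> greedy Q us \<and> u \<notin> set us \<and> Q us u"

lemma greedy_distinct: "greedy Q us \<Longrightarrow> distinct us"
  by (induction us) auto

lemma ex_maximal_greedy:
  assumes "finite I"
  shows "\<exists>us. greedy Q us \<and> set us \<subseteq> I \<and> (\<forall>u\<in>I - set us. \<not> Q us u)"
proof -
  let ?V = "\<lambda>us. greedy Q us \<and> set us \<subseteq> I"
  have "length us < Suc (card I)" if "?V us" for us
    using that assms by (metis card_mono distinct_card greedy_distinct less_Suc_eq_le)
  moreover have "?V []" by simp
  ultimately obtain us where us: "?V us" and longest: "\<And>zs. ?V zs \<Longrightarrow> length zs \<le> length us"
    using ex_has_greatest_nat[of ?V "[]" length "Suc (card I)"] by (auto simp: less_Suc_eq_le)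
  have "\<not> Q us u" if "u \<in> I - set us" for u
    using longest[of "u # us"] us that by auto
  then show ?thesis using us by blast
qed

lemma card_lists_length_le_power:
  assumes "finite A"
  shows "card {us. set us \<subseteq> A \<and> length us \<le> q} \<le> (card A + 1) ^ q"
proof -
  have "(\<Sum>i\<le>q. a ^ i) \<le> (a + 1) ^ q" for a :: nat
  proof (induction q)
    case (Suc q)
    have "(\<Sum>i\<le>Suc q. a ^ i) = (\<Sum>i\<le>q. a ^ i) + a * a ^ q" by simp
    also have "\<dots> \<le> (a + 1) ^ q + a * (a + 1) ^ q"
      using Suc by (intro add_mono mult_left_mono power_mono) auto
    finally show ?case by simp
  qed simp
  then show ?thesis using assms by (simp add: card_lists_length_le)
qed

definition deg :: "'a set set \<Rightarrow> 'a \<Rightarrow> nat" where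
  "deg G x = card {p\<in>G. x \<in> p}"

lemma sum_deg:
  assumes "finite A" "finite G" and G: "\<And>p. p \<in> G \<Longrightarrow> p \<subseteq> A \<and> card p = k"
  shows "(\<Sum>x\<in>A. deg G x) = k * card G"
proof -
  have "card {x\<in>A. x \<in> p} = k" if "p \<in> G" for p
  proof -
    have "{x\<in>A. x \<in> p} = p" using G[OF that] by blast
    then show ?thesis using G[OF that] by simp
  qed
  then show ?thesis
    unfolding deg_def using assms(1,2) sum_multicount[of A G "\<lambda>x p. x \<in> p" k] by simp
qed

lemma sum_card_le_of_few_new:
  fixes N :: "'a \<Rightarrow> 'b set" and c D :: nat
  assumes A: "finite A" and N: "\<And>u. u \<in> A \<Longrightarrow> finite (N u) \<and> card (N u) \<le> D"
    and R: "R \<subseteq> A" "\<And>u. u \<in> R \<Longrightarrow> c * card (N u - W) \<le> D"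
  shows "c * (\<Sum>u\<in>A. card (N u)) \<le> D * card A + c * (\<Sum>u\<in>A. card (N u \<inter> W)) + c * D * card (A - R)"
proof -
  have "c * card (N u) \<le> D + c * card (N u \<inter> W) + (if u \<in> A - R then c * D else 0)"
    if u: "u \<in> A" for u
  proof (cases "u \<in> R")
    case True
    have "card (N u) = card (N u \<inter> W) + card (N u - W)" using N[OF u] by (simp add: card_Int_Diff)
    then show ?thesis using R(2)[OF True] by (simp add: distrib_left)
  next
    case False
    then show ?thesis using N[OF u] u by (simp add: trans_le_add2)
  qed
  then have "c * (\<Sum>u\<in>A. card (N u))
      \<le> (\<Sum>u\<in>A. D + c * card (N u \<inter> W) + (if u \<in> A - R then c * D else 0))"
    unfolding sum_distrib_left by (rule sum_mono)
  also have "\<dots> = D * card A + c * (\<Sum>u\<in>A. card (N u \<inter> W)) + (\<Sum>u\<in>A. if u \<in> A - R then c * D else 0)"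
    by (simp add: sum.distrib sum_distrib_left)
  also have "(\<Sum>u\<in>A. if u \<in> A - R then c * D else 0) = (\<Sum>u\<in>A - R. c * D)"
    using A by (intro sum.mono_neutral_cong_right) auto
  finally show ?thesis by (simp add: mult.commute[of _ "c * D"])
qed

lemma card_Diff_le_length_add:
  assumes A: "finite A"
  shows "card (A - R) \<le> length us + card (A - (set us \<union> R))"
proof -
  have "card (A - R) \<le> card (set us \<union> (A - (set us \<union> R)))"
    using A by (intro card_mono) auto
  also have "\<dots> \<le> card (set us) + card (A - (set us \<union> R))" by (rule card_Un_le)
  finally show ?thesis using card_length[of us] by linarith
qed

locale linear_3graph =
  fixes A :: "'a set" and H :: "'a set set"
  assumes finite_A: "finite A"
    and edge: "e \<in> H \<Longrightarrow> e \<subseteq> A \<and> card e = 3"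
    and linear: "e \<in> H \<Longrightarrow> g \<in> H \<Longrightarrow> a \<noteq> b \<Longrightarrow> {a, b} \<subseteq> e \<Longrightarrow> {a, b} \<subseteq> g \<Longrightarrow> e = g"
begin

lemma finite_H: "finite H"
  by (rule finite_subset[of _ "Pow A"]) (use edge finite_A in auto)

definition link :: "'a \<Rightarrow> 'a set set" where
  "link u = (\<lambda>e. e - {u}) ` {e\<in>H. u \<in> e}"

lemma link_iff: "p \<in> link u \<longleftrightarrow> u \<notin> p \<and> insert u p \<in> H"
proof
  assume "p \<in> link u"
  then show "u \<notin> p \<and> insert u p \<in> H" unfolding link_def by (auto simp: insert_absorb)
next
  assume "u \<notin> p \<and> insert u p \<in> H"
  then show "p \<in> link u" unfolding link_def by (intro image_eqI[of _ _ "insert u p"]) auto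
qed

lemma finite_link [simp]: "finite (link u)"
  using finite_H by (simp add: link_def)

lemma card_link: "card (link u) = deg H u"
  unfolding link_def deg_def by (rule card_image) (auto simp: inj_on_def)

lemma link_pair:
  assumes "p \<in> link u"
  shows "card p = 2 \<and> p \<subseteq> A"
proof -
  have "insert u p \<subseteq> A" "card (insert u p) = 3" "u \<notin> p" using assms edge by (auto simp: link_iff)
  moreover from this(1) have "finite p"
    using finite_A by (meson finite_subset subset_insertI subset_trans)
  ultimately show ?thesis by auto
qed

lemma links_disjoint:
  assumes "p \<in> link u" "p \<in> link u'"
  shows "u = u'"
proof -
  obtain a b where ab: "p = {a, b}" "a \<noteq> b" using link_pair[OF assms(1)] by (metis card_2_iff)
  have "insert u p = insert u' p"
    by (rule linear[of _ _ a b]) (use assms ab in \<open>auto simp: link_iff\<close>)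
  then show ?thesis using assms by (auto simp: link_iff)
qed

lemma deg_link: "deg (link u) x = card {e\<in>H. u \<in> e \<and> x \<in> e \<and> u \<noteq> x}"
proof -
  have "bij_betw (insert u) {p\<in>link u. x \<in> p} {e\<in>H. u \<in> e \<and> x \<in> e \<and> u \<noteq> x}"
    by (rule bij_betw_byWitness[of _ "\<lambda>e. e - {u}"]) (auto simp: link_iff insert_absorb)
  then show ?thesis unfolding deg_def by (rule bij_betw_same_card)
qed

lemma deg_link_commute: "deg (link u) x = deg (link x) u"
  unfolding deg_link by (rule arg_cong[where f = card]) blast

lemma deg_link_le_1: "deg (link u) x \<le> 1"
proof -
  have "e = g" if "e \<in> {e\<in>H. u \<in> e \<and> x \<in> e \<and> u \<noteq> x}" "g \<in> {e\<in>H. u \<in> e \<and> x \<in> e \<and> u \<noteq> x}" for e g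
    using that linear[of e g u x] by auto
  then show ?thesis
    unfolding deg_link using finite_H by (simp add: card_le_Suc0_iff_eq)
qed

lemma sum_deg_links: "(\<Sum>u\<in>A. deg (link u) x) = 2 * deg H x"
  using sum_deg[of A "link x" 2] finite_A link_pair[of _ x]
  by (simp add: deg_link_commute[of _ x] card_link)

end

locale dense_linear_3graph = linear_3graph +
  fixes D \<theta> \<kappa> :: nat
  assumes deg_le: "u \<in> A \<Longrightarrow> deg H u \<le> D"
    and dense: "D * card A \<le> \<kappa> * card H"
    and D_large: "2 * \<kappa>\<^sup>2 * \<theta> \<le> D" and \<theta>_large: "64 * \<kappa>\<^sup>2 \<le> \<theta>" and \<kappa>_pos: "0 < \<kappa>"
begin

lemma \<theta>_pos: "0 < \<theta>"
  using \<theta>_large \<kappa>_pos by (intro gr0I) auto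

lemma D_pos: "0 < D"
  using D_large \<theta>_pos \<kappa>_pos by (intro gr0I) auto

text \<open>A fingerprint is chosen greedily from an independent set: first vertices whose links still add
  many pairs to a graph in which the independent set is independent too, then vertices with many
  new neighbours in that graph. Freezing the vertices of degree \<open>\<theta>\<close> keeps the graph of bounded degree.
  The fingerprint alone determines which vertices were rejected, hence the container.\<close>

definition saturated :: "'a set set \<Rightarrow> 'a set" where
  "saturated G = {x\<in>A. \<theta> \<le> deg G x}"

definition fresh_pairs :: "'a set set \<Rightarrow> 'a \<Rightarrow> 'a set set" where
  "fresh_pairs G u = link u - {p. p \<inter> saturated G \<noteq> {}}"

fun pair_graph :: "'a list \<Rightarrow> 'a set set" where
  "pair_graph [] = {}"
| "pair_graph (u # us) = pair_graph us \<union> fresh_pairs (pair_graph us) u"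

definition adds_pairs :: "'a list \<Rightarrow> 'a \<Rightarrow> bool" where
  "adds_pairs us u \<longleftrightarrow> D \<le> 2 * \<kappa> * card (fresh_pairs (pair_graph us) u)"

definition link_container :: "'a list \<Rightarrow> 'a set" where
  "link_container us = set us \<union> {u\<in>A. \<not> adds_pairs us u}"

definition neighbours :: "'a list \<Rightarrow> 'a \<Rightarrow> 'a set" where
  "neighbours us x = {z\<in>A. z \<noteq> x \<and> {x, z} \<in> pair_graph us}"

definition neighbourhood :: "'a list \<Rightarrow> 'a list \<Rightarrow> 'a set" where
  "neighbourhood us xs = (\<Union>x\<in>set xs. neighbours us x)"

definition adds_neighbours :: "'a list \<Rightarrow> 'a list \<Rightarrow> 'a \<Rightarrow> bool" where
  "adds_neighbours us xs x \<longleftrightarrow> \<theta> \<le> 8 * \<kappa> * card (neighbours us x - neighbourhood us xs)"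

definition neighbour_container :: "'a list \<Rightarrow> 'a list \<Rightarrow> 'a set" where
  "neighbour_container us xs =
     (if card A \<le> 8 * \<kappa> * card (neighbourhood us xs) then A - neighbourhood us xs
      else set xs \<union> {x\<in>A. \<not> adds_neighbours us xs x})"

lemma saturated_subset: "saturated G \<subseteq> A"
  by (auto simp: saturated_def)

lemma finite_saturated [simp]: "finite (saturated G)"
  using finite_A by (simp add: saturated_def)

lemma fresh_pairs_subset: "fresh_pairs G u \<subseteq> link u"
  by (auto simp: fresh_pairs_def)

lemma finite_fresh_pairs [simp]: "finite (fresh_pairs G u)"
  by (simp add: fresh_pairs_def)

lemma pair_graph_link: "p \<in> pair_graph us \<Longrightarrow> \<exists>u\<in>set us. p \<in> link u"
  by (induction us) (auto simp: fresh_pairs_def)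

lemma finite_pair_graph [simp]: "finite (pair_graph us)"
  by (induction us) auto

lemma deg_pair_graph_le:
  assumes "x \<in> A"
  shows "deg (pair_graph us) x \<le> \<theta>"
proof (induction us)
  case (Cons u us)
  show ?case
  proof (cases "x \<in> saturated (pair_graph us)")
    case True
    then have "{p\<in>pair_graph (u # us). x \<in> p} = {p\<in>pair_graph us. x \<in> p}"
      by (auto simp: fresh_pairs_def)
    then show ?thesis using Cons by (simp add: deg_def)
  next
    case False
    have "{p\<in>pair_graph (u # us). x \<in> p} \<subseteq> {p\<in>pair_graph us. x \<in> p} \<union> {p\<in>link u. x \<in> p}"
      by (auto simp: fresh_pairs_def)
    then have "deg (pair_graph (u # us)) x \<le> card ({p\<in>pair_graph us. x \<in> p} \<union> {p\<in>link u. x \<in> p})"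
      unfolding deg_def by (intro card_mono) auto
    also have "\<dots> \<le> deg (pair_graph us) x + deg (link u) x"
      unfolding deg_def by (rule card_Un_le)
    also have "\<dots> \<le> deg (pair_graph us) x + 1" using deg_link_le_1 by simp
    finally show ?thesis using False assms by (simp add: saturated_def)
  qed
qed (simp add: deg_def)

lemma sum_deg_pair_graph: "(\<Sum>x\<in>A. deg (pair_graph us) x) = 2 * card (pair_graph us)"
  by (rule sum_deg[OF finite_A finite_pair_graph]) (use pair_graph_link link_pair in blast)

lemma length_adds_pairs_le:
  assumes "greedy adds_pairs us"
  shows "D * length us \<le> \<kappa> * \<theta> * card A"
proof -
  have "D * length us \<le> 2 * \<kappa> * card (pair_graph us)"
    using assms
  proof (induction us)
    case (Cons u us)
    have "pair_graph us \<inter> fresh_pairs (pair_graph us) u = {}"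
      using pair_graph_link[of _ us] links_disjoint[of _ u] fresh_pairs_subset Cons.prems
      by fastforce
    then have "card (pair_graph (u # us)) = card (pair_graph us) + card (fresh_pairs (pair_graph us) u)"
      by (simp add: card_Un_disjoint)
    then show ?case using Cons by (simp add: adds_pairs_def distrib_left)
  qed simp
  also have "2 * card (pair_graph us) \<le> \<theta> * card A"
    using sum_bounded_above[of A "deg (pair_graph us)" \<theta>] deg_pair_graph_le
    by (simp add: sum_deg_pair_graph mult.commute)
  then have "2 * \<kappa> * card (pair_graph us) \<le> \<kappa> * \<theta> * card A" by simp
  finally show ?thesis .
qed

lemma fingerprint_pairs_short:
  assumes "greedy adds_pairs us"
  shows "2 * \<kappa> * length us \<le> card A"
proof -
  have "D * (2 * \<kappa> * length us) = 2 * \<kappa> * (D * length us)" by simp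
  also have "\<dots> \<le> 2 * \<kappa> * (\<kappa> * \<theta> * card A)"
    using length_adds_pairs_le[OF assms] by (rule mult_left_mono) simp
  also have "\<dots> = 2 * \<kappa>\<^sup>2 * \<theta> * card A" by (simp add: power2_eq_square)
  also have "\<dots> \<le> D * card A" using D_large by (rule mult_right_mono) simp
  finally show ?thesis using D_pos by simp
qed

lemma sum_card_link_saturated_le:
  "(\<Sum>u\<in>A. card (link u \<inter> {p. p \<inter> saturated G \<noteq> {}})) \<le> 2 * D * card (saturated G)"
proof -
  have "card (link u \<inter> {p. p \<inter> saturated G \<noteq> {}}) \<le> (\<Sum>x\<in>saturated G. deg (link u) x)" for u
  proof -
    have "link u \<inter> {p. p \<inter> saturated G \<noteq> {}} = (\<Union>x\<in>saturated G. {p\<in>link u. x \<in> p})" by blast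
    then show ?thesis by (simp add: deg_def card_UN_le)
  qed
  then have "(\<Sum>u\<in>A. card (link u \<inter> {p. p \<inter> saturated G \<noteq> {}}))
      \<le> (\<Sum>u\<in>A. \<Sum>x\<in>saturated G. deg (link u) x)" by (intro sum_mono)
  also have "\<dots> = (\<Sum>x\<in>saturated G. 2 * deg H x)"
    by (subst sum.swap) (simp add: sum_deg_links)
  also have "\<dots> \<le> (\<Sum>x\<in>saturated G. 2 * D)"
    using deg_le saturated_subset by (intro sum_mono) auto
  finally show ?thesis by (simp add: mult.commute)
qed

lemma link_container_misses:
  assumes us: "greedy adds_pairs us"
    and few: "2 * \<kappa> * card (saturated (pair_graph us)) < card A"
  shows "card A \<le> \<kappa> * card (A - link_container us)"
proof -
  let ?W = "{p. p \<inter> saturated (pair_graph us) \<noteq> {}}" and ?R = "{u\<in>A. \<not> adds_pairs us u}"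
  define a g l b where "a = card A" "g = card (saturated (pair_graph us))" "l = length us"
    "b = card (A - link_container us)"
  note counts = a_g_l_b_def
  have R_new: "2 * \<kappa> * card (link u - ?W) \<le> D" if "u \<in> ?R" for u
    using that by (simp add: adds_pairs_def fresh_pairs_def)
  have missed: "card (A - ?R) \<le> l + b"
    using card_Diff_le_length_add[OF finite_A, of ?R us] by (simp add: counts link_container_def)
  have short: "2 * \<kappa> * l \<le> a" using fingerprint_pairs_short[OF us] unfolding counts .
  have "D * (6 * a) \<le> 2 * \<kappa> * (\<Sum>u\<in>A. card (link u))"
    using dense sum_deg[OF finite_A finite_H edge] by (simp add: card_link counts)
  also have "\<dots> \<le> D * card A + 2 * \<kappa> * (\<Sum>u\<in>A. card (link u \<inter> ?W)) + 2 * \<kappa> * D * card (A - ?R)"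
    using deg_le R_new by (intro sum_card_le_of_few_new[OF finite_A]) (auto simp: card_link)
  also have "\<dots> \<le> D * a + 2 * \<kappa> * (2 * D * g) + 2 * \<kappa> * D * (l + b)"
    using sum_card_link_saturated_le missed unfolding counts
    by (intro add_mono mult_left_mono) auto
  also have "\<dots> = D * (a + 2 * (2 * \<kappa> * g) + 2 * \<kappa> * l + 2 * \<kappa> * b)" by (simp add: algebra_simps)
  finally have "6 * a \<le> a + 2 * (2 * \<kappa> * g) + 2 * \<kappa> * l + 2 * \<kappa> * b" using D_pos by simp
  moreover have "2 * \<kappa> * g < a" using few unfolding counts .
  ultimately have "a \<le> \<kappa> * b" using short by linarith
  then show ?thesis unfolding counts .
qed

lemma neighbourhood_subset: "neighbourhood us xs \<subseteq> A"
  by (auto simp: neighbourhood_def neighbours_def)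

lemma finite_neighbourhood [simp]: "finite (neighbourhood us xs)"
  using neighbourhood_subset finite_A finite_subset by blast

lemma finite_neighbours [simp]: "finite (neighbours us x)"
  using finite_A by (simp add: neighbours_def)

lemma card_neighbours: "card (neighbours us x) = deg (pair_graph us) x"
proof -
  have "(\<lambda>z. {x, z}) ` neighbours us x = {p\<in>pair_graph us. x \<in> p}"
  proof
    show "{p\<in>pair_graph us. x \<in> p} \<subseteq> (\<lambda>z. {x, z}) ` neighbours us x"
    proof
      fix p assume p: "p \<in> {p\<in>pair_graph us. x \<in> p}"
      then have "card p = 2" "p \<subseteq> A" using pair_graph_link link_pair by blast+
      then obtain z where "p = {x, z}" "z \<noteq> x" using p by (auto simp: card_2_iff doubleton_eq_iff)
      then show "p \<in> (\<lambda>z. {x, z}) ` neighbours us x" using p \<open>p \<subseteq> A\<close> by (auto simp: neighbours_def)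
    qed
  qed (auto simp: neighbours_def)
  moreover have "inj_on (\<lambda>z. {x, z}) (neighbours us x)"
    by (auto simp: inj_on_def neighbours_def doubleton_eq_iff)
  ultimately show ?thesis unfolding deg_def by (metis card_image)
qed

lemma sum_card_neighbours_ge:
  "\<theta> * card (saturated (pair_graph us)) \<le> (\<Sum>x\<in>A. card (neighbours us x))"
proof -
  have "\<theta> * card (saturated (pair_graph us)) \<le> (\<Sum>x\<in>saturated (pair_graph us). deg (pair_graph us) x)"
    using sum_bounded_below[of "saturated (pair_graph us)" \<theta> "deg (pair_graph us)"]
    by (simp add: saturated_def mult.commute)
  also have "\<dots> \<le> (\<Sum>x\<in>A. deg (pair_graph us) x)"
    using finite_A saturated_subset by (intro sum_mono2) auto
  finally show ?thesis by (simp add: card_neighbours)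
qed

lemma length_adds_neighbours_le:
  assumes "greedy (adds_neighbours us) xs"
  shows "\<theta> * length xs \<le> 8 * \<kappa> * card A"
proof -
  have "\<theta> * length xs \<le> 8 * \<kappa> * card (neighbourhood us xs)"
    using assms
  proof (induction xs)
    case (Cons x xs)
    let ?new = "neighbours us x - neighbourhood us xs"
    have "neighbourhood us (x # xs) = neighbourhood us xs \<union> ?new" by (auto simp: neighbourhood_def)
    then have "card (neighbourhood us (x # xs)) = card (neighbourhood us xs) + card ?new"
      by (simp only:) (rule card_Un_disjoint, auto)
    then show ?case using Cons by (simp add: adds_neighbours_def distrib_left)
  qed simp
  also have "card (neighbourhood us xs) \<le> card A"
    using finite_A neighbourhood_subset by (rule card_mono)
  finally show ?thesis by simp
qed

lemma fingerprint_neighbours_short: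
  assumes "greedy (adds_neighbours us) xs"
  shows "8 * \<kappa> * length xs \<le> card A"
proof -
  have "\<theta> * (8 * \<kappa> * length xs) = 8 * \<kappa> * (\<theta> * length xs)" by simp
  also have "\<dots> \<le> 8 * \<kappa> * (8 * \<kappa> * card A)"
    using length_adds_neighbours_le[OF assms] by (rule mult_left_mono) simp
  also have "\<dots> = 64 * \<kappa>\<^sup>2 * card A" by (simp add: power2_eq_square)
  also have "\<dots> \<le> \<theta> * card A" using \<theta>_large by (rule mult_right_mono) simp
  finally show ?thesis using \<theta>_pos by simp
qed

lemma sum_card_neighbours_Int_le:
  "(\<Sum>x\<in>A. card (neighbours us x \<inter> neighbourhood us xs)) \<le> \<theta> * card (neighbourhood us xs)"
proof -
  let ?W = "neighbourhood us xs"
  have "(\<Sum>x\<in>A. card (neighbours us x \<inter> ?W)) = (\<Sum>x\<in>A. card {w\<in>?W. w \<in> neighbours us x})"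
    by (intro sum.cong refl arg_cong[where f = card]) auto
  also have "\<dots> = (\<Sum>w\<in>?W. card {x\<in>A. w \<in> neighbours us x})"
    using finite_A by (intro sum_multicount_gen) auto
  also have "\<dots> = (\<Sum>w\<in>?W. card (neighbours us w))"
    using neighbourhood_subset
    by (intro sum.cong refl arg_cong[where f = card]) (auto simp: neighbours_def insert_commute)
  also have "\<dots> \<le> (\<Sum>w\<in>?W. \<theta>)"
    using deg_pair_graph_le[OF subsetD[OF neighbourhood_subset]]
    by (intro sum_mono) (simp add: card_neighbours)
  finally show ?thesis by (simp add: mult.commute)
qed

lemma neighbour_container_misses:
  assumes xs: "greedy (adds_neighbours us) xs"
    and many: "card A \<le> 2 * \<kappa> * card (saturated (pair_graph us))"
  shows "card A \<le> 8 * \<kappa> * card (A - neighbour_container us xs)"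
proof (cases "card A \<le> 8 * \<kappa> * card (neighbourhood us xs)")
  case True
  then show ?thesis
    using neighbourhood_subset by (simp add: neighbour_container_def double_diff)
next
  case False
  let ?W = "neighbourhood us xs" and ?R = "{x\<in>A. \<not> adds_neighbours us xs x}"
  define a w l b where "a = card A" "w = card ?W" "l = length xs"
    "b = card (A - neighbour_container us xs)"
  note counts = a_w_l_b_def
  have R_new: "8 * \<kappa> * card (neighbours us x - ?W) \<le> \<theta>" if "x \<in> ?R" for x
    using that by (simp add: adds_neighbours_def)
  have missed: "card (A - ?R) \<le> l + b"
    using card_Diff_le_length_add[OF finite_A, of ?R xs] False
    by (simp add: counts neighbour_container_def)
  have short: "8 * \<kappa> * l \<le> a" using fingerprint_neighbours_short[OF xs] unfolding counts .
  have "4 * (\<theta> * a) \<le> 4 * (\<theta> * (2 * \<kappa> * card (saturated (pair_graph us))))"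
    using many unfolding counts by (intro mult_left_mono) auto
  also have "\<dots> = 8 * \<kappa> * (\<theta> * card (saturated (pair_graph us)))" by simp
  also have "\<dots> \<le> 8 * \<kappa> * (\<Sum>x\<in>A. card (neighbours us x))"
    using sum_card_neighbours_ge by (rule mult_left_mono) simp
  also have "\<dots> \<le> \<theta> * card A + 8 * \<kappa> * (\<Sum>x\<in>A. card (neighbours us x \<inter> ?W)) + 8 * \<kappa> * \<theta> * card (A - ?R)"
    using deg_pair_graph_le R_new
    by (intro sum_card_le_of_few_new[OF finite_A]) (auto simp: card_neighbours)
  also have "\<dots> \<le> \<theta> * a + 8 * \<kappa> * (\<theta> * w) + 8 * \<kappa> * \<theta> * (l + b)"
    using sum_card_neighbours_Int_le missed unfolding counts
    by (intro add_mono mult_left_mono) auto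
  also have "\<dots> = \<theta> * (a + 8 * \<kappa> * w + 8 * \<kappa> * l + 8 * \<kappa> * b)" by (simp add: algebra_simps)
  finally have "\<theta> * (4 * a) \<le> \<theta> * (a + 8 * \<kappa> * w + 8 * \<kappa> * l + 8 * \<kappa> * b)" by (simp add: mult_ac)
  then have "4 * a \<le> a + 8 * \<kappa> * w + 8 * \<kappa> * l + 8 * \<kappa> * b" using \<theta>_pos by simp
  moreover have "8 * \<kappa> * w < a" using False unfolding counts by simp
  ultimately have "a \<le> 8 * \<kappa> * b" using short by linarith
  then show ?thesis unfolding counts .
qed

lemma independent_neighbourhood_disjoint:
  assumes I: "independent H I" and "set us \<subseteq> I" "set xs \<subseteq> I"
  shows "I \<inter> neighbourhood us xs = {}"
proof (rule ccontr)
  assume "\<not> ?thesis"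
  then obtain z x where z: "z \<in> I" "x \<in> set xs" "{x, z} \<in> pair_graph us"
    by (auto simp: neighbourhood_def neighbours_def)
  then obtain u where "u \<in> set us" "{x, z} \<in> link u" using pair_graph_link by blast
  then have "insert u {x, z} \<in> H" "insert u {x, z} \<subseteq> I" using assms(2,3) z by (auto simp: link_iff)
  then show False using I by (auto simp: independent_def)
qed

definition container :: "'a list \<times> 'a list \<Rightarrow> 'a set" where
  "container = (\<lambda>(us, xs). if 2 * \<kappa> * card (saturated (pair_graph us)) < card A
     then link_container us else neighbour_container us xs)"

lemma container_misses:
  assumes "greedy adds_pairs us" "greedy (adds_neighbours us) xs"
  shows "card A \<le> 8 * \<kappa> * card (A - container (us, xs))"
  using link_container_misses[OF assms(1)] neighbour_container_misses[OF assms(2)]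
  by (auto simp: container_def)

lemma ex_fingerprint:
  assumes I: "I \<subseteq> A" "independent H I"
  shows "\<exists>us xs. greedy adds_pairs us \<and> greedy (adds_neighbours us) xs \<and>
    set us \<subseteq> A \<and> set xs \<subseteq> A \<and> I \<subseteq> container (us, xs) \<and> container (us, xs) \<subseteq> A"
proof -
  have I_finite: "finite I" using I(1) finite_A by (rule finite_subset)
  obtain us where us: "greedy adds_pairs us" "set us \<subseteq> I" "\<forall>u\<in>I - set us. \<not> adds_pairs us u"
    using ex_maximal_greedy[OF I_finite] by blast
  obtain xs where xs: "greedy (adds_neighbours us) xs" "set xs \<subseteq> I"
    "\<forall>x\<in>I - set xs. \<not> adds_neighbours us xs x"
    using ex_maximal_greedy[OF I_finite] by blast
  have "I \<subseteq> container (us, xs)" "container (us, xs) \<subseteq> A"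
    using us xs I independent_neighbourhood_disjoint[OF I(2) us(2) xs(2)]
    by (auto simp: container_def link_container_def neighbour_container_def)
  then show ?thesis using us xs I(1) by blast
qed

theorem ex_containers:
  assumes q: "\<kappa> * \<theta> * card A \<le> D * q" "8 * \<kappa> * card A \<le> \<theta> * q"
  shows "\<exists>\<C>. container_family (independent H) A \<C> \<and> card \<C> \<le> (card A + 1) ^ (2 * q) \<and>
    (\<forall>C\<in>\<C>. card A \<le> 8 * \<kappa> * card (A - C))"
proof -
  let ?lists = "{us. set us \<subseteq> A \<and> length us \<le> q}"
  let ?\<C> = "{C \<in> container ` (?lists \<times> ?lists). C \<subseteq> A \<and> card A \<le> 8 * \<kappa> * card (A - C)}"
  have finite: "finite (?lists \<times> ?lists)" using finite_lists_length_le[OF finite_A] by blast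
  then have "card ?\<C> \<le> card (container ` (?lists \<times> ?lists))" by (intro card_mono) auto
  also have "\<dots> \<le> card (?lists \<times> ?lists)" using finite by (rule card_image_le)
  also have "\<dots> \<le> (card A + 1) ^ q * (card A + 1) ^ q"
    unfolding card_cartesian_product
    using card_lists_length_le_power[OF finite_A] by (intro mult_mono) auto
  finally have "card ?\<C> \<le> (card A + 1) ^ (2 * q)" by (simp add: mult_2 power_add)
  moreover have "\<exists>C\<in>?\<C>. I \<subseteq> C" if I: "I \<subseteq> A" "independent H I" for I
  proof -
    obtain us xs where fingerprint: "greedy adds_pairs us" "greedy (adds_neighbours us) xs"
      "set us \<subseteq> A" "set xs \<subseteq> A"
      and C: "I \<subseteq> container (us, xs)" "container (us, xs) \<subseteq> A"
      using ex_fingerprint[OF I] by blast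
    have "D * length us \<le> D * q" using length_adds_pairs_le[OF fingerprint(1)] q(1) by linarith
    moreover have "\<theta> * length xs \<le> \<theta> * q"
      using length_adds_neighbours_le[OF fingerprint(2)] q(2) by linarith
    ultimately have "(us, xs) \<in> ?lists \<times> ?lists" using D_pos \<theta>_pos fingerprint(3,4) by simp
    then have "container (us, xs) \<in> ?\<C>" using container_misses[OF fingerprint(1,2)] C(2) by blast
    then show ?thesis using C(1) by blast
  qed
  ultimately show ?thesis
    using finite by (intro exI[of _ ?\<C>]) (auto simp: container_family_def)
qed

end

section \<open>Collinearity in the integer lattice\<close>

type_synonym lattice_point = "int \<times> int \<times> int"

fun scale :: "int \<Rightarrow> lattice_point \<Rightarrow> lattice_point" (infixr "\<odot>" 75) where
  "k \<odot> (a, b, c) = (k * a, k * b, k * c)"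

fun coord_gcd :: "lattice_point \<Rightarrow> int" where
  "coord_gcd (a, b, c) = gcd a (gcd b c)"

fun parallel :: "lattice_point \<Rightarrow> lattice_point \<Rightarrow> bool" where
  "parallel (a1, a2, a3) (b1, b2, b3) \<longleftrightarrow> a2 * b3 = a3 * b2 \<and> a3 * b1 = a1 * b3 \<and> a1 * b2 = a2 * b1"

definition primitive :: "lattice_point \<Rightarrow> bool" where
  "primitive v \<longleftrightarrow> coord_gcd v = 1"

definition line :: "lattice_point \<Rightarrow> lattice_point \<Rightarrow> lattice_point set" where
  "line p v = {x. \<exists>k. x = p + k \<odot> v}"

definition aligned :: "lattice_point set \<Rightarrow> bool" where
  "aligned S \<longleftrightarrow> (\<forall>u\<in>S. \<forall>v\<in>S. \<forall>w\<in>S. parallel (v - u) (w - u))"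

definition grid :: "nat \<Rightarrow> lattice_point set" where
  "grid m = {0..<int m} \<times> {0..<int m} \<times> {0..<int m}"

lemma finite_grid [simp]: "finite (grid m)"
  by (simp add: grid_def)

lemma card_grid: "card (grid m) = m ^ 3"
  by (simp add: grid_def card_cartesian_product eval_nat_numeral)

lemma scale_0 [simp]: "0 \<odot> v = 0" and scale_1 [simp]: "1 \<odot> v = v"
  by (cases v; simp add: zero_prod_def)+

lemma scale_add: "(j + k) \<odot> v = j \<odot> v + k \<odot> v"
  by (cases v) (simp add: algebra_simps)

lemma scale_diff: "(j - k) \<odot> v = j \<odot> v - k \<odot> v"
  by (cases v) (simp add: algebra_simps)

lemma scale_right_diff: "k \<odot> (v - w) = k \<odot> v - k \<odot> w"
  by (cases v; cases w) (simp add: algebra_simps)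

lemma scale_eq_0_iff [simp]: "k \<odot> v = 0 \<longleftrightarrow> k = 0 \<or> v = 0"
  by (cases v) (auto simp: zero_prod_def)

lemma scale_cancel_right [simp]: "j \<odot> v = k \<odot> v \<longleftrightarrow> j = k \<or> v = 0"
  using scale_eq_0_iff[of "j - k" v] by (auto simp: scale_diff)

lemma scale_cancel_left [simp]: "k \<odot> v = k \<odot> w \<longleftrightarrow> k = 0 \<or> v = w"
  using scale_eq_0_iff[of k "v - w"] by (auto simp: scale_right_diff)

lemma coord_gcd_scale: "coord_gcd (k \<odot> v) = \<bar>k\<bar> * coord_gcd v"
  by (cases v) (auto simp: gcd_mult_left abs_mult abs_if[of k])

lemma coord_gcd_eq_0_iff [simp]: "coord_gcd v = 0 \<longleftrightarrow> v = 0"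
  by (cases v) (auto simp: zero_prod_def)

lemma primitive_nonzero: "primitive v \<Longrightarrow> v \<noteq> 0"
  by (auto simp: primitive_def simp flip: coord_gcd_eq_0_iff)

lemma ex_primitive_direction:
  assumes "v \<noteq> 0"
  shows "\<exists>w. primitive w \<and> v = coord_gcd v \<odot> w"
proof -
  obtain a b c where v: "v = (a, b, c)" by (cases v)
  let ?g = "coord_gcd v"
  have "?g dvd a" "?g dvd b" "?g dvd c" by (auto simp: v intro: gcd_dvd2 dvd_trans)
  then have v': "v = ?g \<odot> (a div ?g, b div ?g, c div ?g)" (is "_ = _ \<odot> ?w") by (simp add: v)
  have "0 \<le> ?g" by (simp add: v)
  then have "?g = ?g * coord_gcd ?w"
    using arg_cong[OF v', of coord_gcd] by (simp only: coord_gcd_scale abs_of_nonneg)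
  then have "primitive ?w" using assms by (simp add: primitive_def)
  then show ?thesis using v' by blast
qed

lemma parallel_primitive:
  assumes "primitive v" "parallel v a"
  shows "\<exists>k. a = k \<odot> v"
proof -
  obtain v1 v2 v3 a1 a2 a3 where v: "v = (v1, v2, v3)" "a = (a1, a2, a3)" by (metis surj_pair)
  obtain p q where "p * v1 + q * gcd v2 v3 = 1"
    using bezout_int[of v1 "gcd v2 v3"] assms by (auto simp: v primitive_def)
  moreover obtain q' r' where "q' * v2 + r' * v3 = gcd v2 v3" using bezout_int by blast
  ultimately have "p * v1 + q * q' * v2 + q * r' * v3 = 1" by algebra
  then obtain x y z where bezout: "x * v1 + y * v2 + z * v3 = 1" by blast
  let ?k = "x * a1 + y * a2 + z * a3"
  have "v2 * a3 = v3 * a2" "v3 * a1 = v1 * a3" "v1 * a2 = v2 * a1"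
    using assms(2) by (auto simp: v)
  then have "?k * v1 = a1" "?k * v2 = a2" "?k * v3 = a3"
    using bezout by algebra+
  then have "a = ?k \<odot> v" by (simp add: v)
  then show ?thesis ..
qed

lemma parallel_scale: "parallel (j \<odot> v) (k \<odot> v)"
  by (cases v) simp

lemma parallel_scale_left: "k \<noteq> 0 \<Longrightarrow> parallel (k \<odot> v) w \<Longrightarrow> parallel v w"
  by (cases v; cases w) simp

lemma line_eqI:
  assumes "q \<in> line p v"
  shows "line q v = line p v"
proof -
  obtain k where "q = p + k \<odot> v" using assms by (auto simp: line_def)
  then have "q + j \<odot> v = p + (k + j) \<odot> v" "p + j \<odot> v = q + (j - k) \<odot> v" for j
    by (simp_all add: scale_add scale_diff)
  then show ?thesis unfolding line_def by metis
qed

lemma line_refl [simp]: "p \<in> line p v"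
  unfolding line_def by (rule CollectI, rule exI[of _ 0]) simp

lemma line_diff: "x \<in> line p v \<Longrightarrow> y \<in> line p v \<Longrightarrow> \<exists>k. y - x = k \<odot> v"
  by (auto simp: line_def simp flip: scale_diff)

lemma aligned_if_subset_line:
  assumes "S \<subseteq> line p v"
  shows "aligned S"
  unfolding aligned_def
proof (intro ballI)
  fix a b c assume "a \<in> S" "b \<in> S" "c \<in> S"
  then have on_line: "a \<in> line p v" "b \<in> line p v" "c \<in> line p v" using assms by auto
  obtain j k where "b - a = j \<odot> v" "c - a = k \<odot> v"
    using line_diff[OF on_line(1,2)] line_diff[OF on_line(1,3)] by blast
  then show "parallel (b - a) (c - a)" by (simp add: parallel_scale)
qed

lemma aligned_subset_line:
  assumes S: "aligned S" "p \<in> S" "q \<in> S" "p \<noteq> q"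
  shows "\<exists>v. primitive v \<and> S \<subseteq> line p v"
proof -
  obtain v where v: "primitive v" "q - p = coord_gcd (q - p) \<odot> v"
    using ex_primitive_direction[of "q - p"] S(4) by auto
  have "x \<in> line p v" if "x \<in> S" for x
  proof -
    have "parallel (q - p) (x - p)" using S that by (auto simp: aligned_def)
    then have "parallel v (x - p)"
      using v(2) S(4) parallel_scale_left by (metis coord_gcd_eq_0_iff right_minus_eq)
    then obtain k where "x - p = k \<odot> v" using parallel_primitive v(1) by blast
    then have "x = p + k \<odot> v" by (simp add: algebra_simps)
    then show ?thesis unfolding line_def by blast
  qed
  then show ?thesis using v(1) by blast
qed

definition segment :: "lattice_point \<Rightarrow> lattice_point \<Rightarrow> nat \<Rightarrow> nat set \<Rightarrow> lattice_point set" where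
  "segment u v g K = (\<lambda>j. u + int j \<odot> v) ` insert 0 (insert g K)"

lemma ex_first_point:
  assumes S: "S \<subseteq> line p v" "finite S" "S \<noteq> {}" and v: "v \<noteq> 0"
  shows "\<exists>u\<in>S. \<forall>x\<in>S. \<exists>j. x = u + int j \<odot> v"
proof -
  define J where "J = {j. p + j \<odot> v \<in> S}"
  have S_J: "S = (\<lambda>j. p + j \<odot> v) ` J" using S(1) unfolding J_def line_def by blast
  moreover have "inj_on (\<lambda>j. p + j \<odot> v) J" using v by (auto simp: inj_on_def)
  ultimately have J: "finite J" "J \<noteq> {}" using S(2,3) finite_imageD by auto
  define u where "u = p + Min J \<odot> v"
  have "\<exists>i. x = u + int i \<odot> v" if "x \<in> S" for x
  proof -
    obtain j where j: "j \<in> J" "x = p + j \<odot> v" using \<open>x \<in> S\<close> S_J by blast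
    then have "Min J \<le> j" using J by simp
    then have "x = u + int (nat (j - Min J)) \<odot> v" using j(2) by (simp add: u_def scale_diff)
    then show ?thesis ..
  qed
  moreover have "u \<in> S" using Min_in[OF J] by (simp add: u_def J_def)
  ultimately show ?thesis by blast
qed

lemma subset_line_eq_segment:
  assumes S: "S \<subseteq> line p v" "finite S" "2 \<le> card S" and v: "v \<noteq> 0"
  shows "\<exists>u g K. 0 < g \<and> K \<subseteq> {0<..<g} \<and> card S = card K + 2 \<and> S = segment u v g K"
proof -
  have "S \<noteq> {}" using S(3) by auto
  from ex_first_point[OF S(1,2) this v]
  obtain u where u: "u \<in> S" "\<forall>x\<in>S. \<exists>j. x = u + int j \<odot> v" by (rule bexE)
  define J where "J = {j. u + int j \<odot> v \<in> S}"
  have S_J: "S = (\<lambda>j. u + int j \<odot> v) ` J" using u(2) by (fastforce simp: J_def image_iff)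
  have inj: "inj_on (\<lambda>j. u + int j \<odot> v) J" using v by (auto simp: inj_on_def)
  have J: "finite J" "card J = card S"
    using S(2) by (simp_all add: S_J finite_image_iff[OF inj] card_image[OF inj])
  have "0 \<in> J" using u(1) by (simp add: J_def)
  define g K where "g = Max J" and "K = J - {0, g}"
  have g: "g \<in> J" "\<And>j. j \<in> J \<Longrightarrow> j \<le> g" using J(1) \<open>0 \<in> J\<close> unfolding g_def by (auto intro: Max_in)
  have "0 < g"
  proof (rule ccontr)
    assume "\<not> 0 < g"
    then have "J \<subseteq> {0}" using g(2) by auto
    then have "card J \<le> 1" using card_mono[of "{0::nat}" J] by simp
    then show False using J(2) S(3) by simp
  qed
  moreover have "K \<subseteq> {0<..<g}" using g(2) by (force simp: K_def)
  moreover have J_eq: "J = insert 0 (insert g K)" using \<open>0 \<in> J\<close> g(1) by (auto simp: K_def)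
  have "card J = card K + 2" using J(1) \<open>0 < g\<close> by (subst J_eq) (simp add: K_def)
  then have "card S = card K + 2" using J(2) by simp
  moreover have "S = segment u v g K"
    unfolding segment_def by (subst S_J, subst J_eq) simp
  ultimately show ?thesis by blast
qed

lemma aligned_eq_segment:
  assumes S: "aligned S" "finite S" "2 \<le> card S"
  shows "\<exists>u v g K. primitive v \<and> 0 < g \<and> K \<subseteq> {0<..<g} \<and> card S = card K + 2 \<and> S = segment u v g K"
proof -
  have "\<not> card S \<le> Suc 0" using S(3) by simp
  then obtain p q where "p \<in> S" "q \<in> S" "p \<noteq> q" unfolding card_le_Suc0_iff_eq[OF S(2)] by blast
  then obtain v where "primitive v" "S \<subseteq> line p v" using aligned_subset_line[OF S(1)] by blast
  then show ?thesis using subset_line_eq_segment[of S p v] S(2,3) primitive_nonzero by blast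
qed

definition cube :: "nat \<Rightarrow> lattice_point set" where
  "cube k = {-int k..int k} \<times> {-int k..int k} \<times> {-int k..int k}"

lemma finite_cube [simp]: "finite (cube k)"
  by (simp add: cube_def)

lemma card_cube: "card (cube k) = (2 * k + 1) ^ 3"
proof -
  have "nat (2 * int k + 1) = 2 * k + 1" by simp
  then show ?thesis by (simp add: cube_def card_cartesian_product power3_eq_cube)
qed

lemma step_between_grid_points:
  assumes u: "u \<in> grid m" "u + int g \<odot> v \<in> grid m" and v: "v \<noteq> 0" and g: "0 < g"
  shows "g < m" and "v \<in> cube (m div g)"
proof -
  obtain u1 u2 u3 v1 v2 v3 where uv: "u = (u1, u2, u3)" "v = (v1, v2, v3)" by (metis surj_pair)
  have small: "\<bar>int g * v1\<bar> < int m" "\<bar>int g * v2\<bar> < int m" "\<bar>int g * v3\<bar> < int m"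
    using u by (auto simp: grid_def uv)
  have le_div: "\<bar>w\<bar> \<le> int (m div g)" if "\<bar>int g * w\<bar> < int m" for w
  proof -
    have "int g * \<bar>w\<bar> \<le> int m" using that by (simp add: abs_mult)
    then have "int g * \<bar>w\<bar> div int g \<le> int m div int g" using g by (intro zdiv_mono1) auto
    then show ?thesis using g by (simp add: zdiv_int)
  qed
  then show "v \<in> cube (m div g)" using le_div[OF small(1)] le_div[OF small(2)] le_div[OF small(3)]
    by (auto simp: uv cube_def abs_le_iff)
  have "int g \<le> \<bar>int g * w\<bar>" if "w \<noteq> 0" for w
  proof -
    have "1 \<le> \<bar>w\<bar>" using that by linarith
    then show ?thesis by (simp add: abs_mult mult_le_cancel_left1)
  qed
  moreover have "v1 \<noteq> 0 \<or> v2 \<noteq> 0 \<or> v3 \<noteq> 0" using v by (auto simp: uv zero_prod_def)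
  ultimately show "g < m" using small by (meson le_less_trans of_nat_less_iff)
qed

lemma card_aligned_grid_le:
  assumes S: "aligned S" "S \<subseteq> grid m" "2 \<le> card S"
  shows "card S \<le> m"
proof -
  have "finite S" using S(2) finite_grid by (rule finite_subset)
  then obtain u v g K
    where segment: "primitive v" "0 < g" "K \<subseteq> {0<..<g}" "card S = card K + 2" "S = segment u v g K"
    using aligned_eq_segment[OF S(1) _ S(3)] by blast
  then have ends: "u \<in> grid m" "u + int g \<odot> v \<in> grid m" using S(2) by (auto simp: segment_def)
  have "g < m"
    using step_between_grid_points(1)[OF ends primitive_nonzero[OF segment(1)] segment(2)] .
  moreover have "card K \<le> g - 1" using card_mono[OF _ segment(3)] by simp
  ultimately show ?thesis using segment(2,4) by linarith
qed

lemma aligned_subsets_cover: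
  assumes s: "0 < s"
  shows "{S. S \<subseteq> grid m \<and> card S = s + 1 \<and> aligned S} \<subseteq>
    (\<Union>g\<in>{1..m}. (\<lambda>(u, v, K). segment u v g K) `
      (grid m \<times> cube (m div g) \<times> {K. K \<subseteq> {0<..<g} \<and> card K = s - 1}))"
proof
  fix S assume "S \<in> {S. S \<subseteq> grid m \<and> card S = s + 1 \<and> aligned S}"
  then have S: "S \<subseteq> grid m" "card S = s + 1" "aligned S" by auto
  have "finite S" using S(1) finite_grid by (rule finite_subset)
  then obtain u v g K
    where segment: "primitive v" "0 < g" "K \<subseteq> {0<..<g}" "card S = card K + 2" "S = segment u v g K"
    using aligned_eq_segment[OF S(3)] S(2) s by auto
  then have u: "u \<in> grid m" "u + int g \<odot> v \<in> grid m" using S(1) by (auto simp: segment_def)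
  have "g < m" "v \<in> cube (m div g)"
    using step_between_grid_points[OF u primitive_nonzero[OF segment(1)] segment(2)] by simp_all
  then show "S \<in> (\<Union>g\<in>{1..m}. (\<lambda>(u, v, K). segment u v g K) `
      (grid m \<times> cube (m div g) \<times> {K. K \<subseteq> {0<..<g} \<and> card K = s - 1}))"
    using segment S(2) u(1) by (intro UN_I[of g] image_eqI[of _ _ "(u, v, K)"]) auto
qed

lemma card_aligned_subsets_le_sum:
  assumes s: "0 < s"
  shows "card {S. S \<subseteq> grid m \<and> card S = s + 1 \<and> aligned S}
    \<le> (\<Sum>g=1..m. m ^ 3 * (2 * (m div g) + 1) ^ 3 * (g - 1 choose (s - 1)))"
proof -
  let ?codes = "\<lambda>g. grid m \<times> cube (m div g) \<times> {K. K \<subseteq> {0<..<g} \<and> card K = s - 1}"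
  have fin: "finite (?codes g)" for g
    using finite_subset[of _ "Pow {0<..<g}"] by (intro finite_cartesian_product) auto
  have "card {S. S \<subseteq> grid m \<and> card S = s + 1 \<and> aligned S}
      \<le> card (\<Union>g\<in>{1..m}. (\<lambda>(u, v, K). segment u v g K) ` ?codes g)"
    using fin by (intro card_mono[OF _ aligned_subsets_cover[OF s]]) auto
  also have "\<dots> \<le> (\<Sum>g=1..m. card ((\<lambda>(u, v, K). segment u v g K) ` ?codes g))"
    by (rule card_UN_le) simp
  also have "\<dots> \<le> (\<Sum>g=1..m. card (?codes g))"
    using fin by (intro sum_mono card_image_le)
  also have "\<dots> = (\<Sum>g=1..m. m ^ 3 * (2 * (m div g) + 1) ^ 3 * (g - 1 choose (s - 1)))"
    by (simp add: card_cartesian_product card_grid card_cube n_subsets mult.assoc)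
  finally show ?thesis .
qed

lemma card_segment_codes_le:
  assumes s: "3 \<le> s" and g: "g \<in> {1..m}"
  shows "real (m ^ 3 * (2 * (m div g) + 1) ^ 3 * (g - 1 choose (s - 1)))
    \<le> 27 * real m ^ (s + 3) / fact (s - 1) * inverse (real g)"
proof -
  have "1 \<le> real m / real g" using g by simp
  then have "real (2 * (m div g) + 1) \<le> 3 * real m / real g"
    using of_nat_div_le_of_nat[of m g, where 'a = real] by simp
  then have steps: "real (2 * (m div g) + 1) ^ 3 \<le> (3 * real m / real g) ^ 3"
    by (rule power_mono) simp
  have "g - 1 choose (s - 1) \<le> g choose (s - 1)" by (rule binomial_right_mono) simp
  then have inner: "real (g - 1 choose (s - 1)) \<le> real g ^ (s - 1) / fact (s - 1)"
    using choose_le_power_divide_fact[of g "s - 1"] by linarith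
  have "real (m ^ 3 * (2 * (m div g) + 1) ^ 3 * (g - 1 choose (s - 1)))
      \<le> real m ^ 3 * (3 * real m / real g) ^ 3 * (real g ^ (s - 1) / fact (s - 1))"
    unfolding of_nat_mult of_nat_power using steps inner by (intro mult_mono) auto
  also have "\<dots> = 27 * real m ^ 6 * real g ^ (s - 3) / fact (s - 1) * inverse (real g)"
  proof -
    have cancel: "a ^ 3 * (3 * a / b) ^ 3 * (c * b\<^sup>2 / d) = 27 * a ^ 6 * c / d * inverse b"
      if "b \<noteq> 0" for a b c d :: real
      using that by (simp add: field_simps eval_nat_numeral)
    have "s - 1 = s - 3 + 2" using s by simp
    then have "real g ^ (s - 1) = real g ^ (s - 3) * (real g)\<^sup>2" by (simp only: power_add)
    moreover have "real g \<noteq> 0" using g by simp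
    ultimately show ?thesis by (simp only: cancel not_False_eq_True)
  qed
  also have "\<dots> \<le> 27 * real m ^ 6 * real m ^ (s - 3) / fact (s - 1) * inverse (real g)"
    using g by (intro mult_right_mono divide_right_mono mult_left_mono power_mono) auto
  also have "27 * real m ^ 6 * real m ^ (s - 3) = 27 * real m ^ (s + 3)"
    using s by (simp add: mult.assoc add.commute[of s] flip: power_add)
  finally show ?thesis .
qed

lemma card_aligned_subsets_le:
  assumes s: "3 \<le> s" and m: "0 < m"
  shows "real (card {S. S \<subseteq> grid m \<and> card S = s + 1 \<and> aligned S})
    \<le> 27 * real m ^ (s + 3) * (1 + ln m) / fact (s - 1)"
proof -
  have "real (card {S. S \<subseteq> grid m \<and> card S = s + 1 \<and> aligned S})
      \<le> real (\<Sum>g=1..m. m ^ 3 * (2 * (m div g) + 1) ^ 3 * (g - 1 choose (s - 1)))"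
    using card_aligned_subsets_le_sum[of s m] s by (simp only: of_nat_le_iff)
  also have "\<dots> \<le> (\<Sum>g=1..m. 27 * real m ^ (s + 3) / fact (s - 1) * inverse (real g))"
    unfolding of_nat_sum using s by (intro sum_mono card_segment_codes_le)
  also have "\<dots> = 27 * real m ^ (s + 3) / fact (s - 1) * harm m"
    by (simp only: harm_def sum_distrib_left)
  also have "\<dots> \<le> 27 * real m ^ (s + 3) / fact (s - 1) * (1 + ln m)"
    using harm_le[OF m] by (intro mult_left_mono) auto
  finally show ?thesis by simp
qed

section \<open>Lattice triples and containers in the grid\<close>

definition positive_cube :: "nat \<Rightarrow> lattice_point set" where
  "positive_cube t = {1..int t} \<times> {1..int t} \<times> {1..int t}"

definition directions :: "nat \<Rightarrow> lattice_point set" where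
  "directions t = {v\<in>positive_cube t. primitive v}"

lemma finite_positive_cube [simp]: "finite (positive_cube t)"
  by (simp add: positive_cube_def)

lemma card_positive_cube: "card (positive_cube t) = t ^ 3"
  by (simp add: positive_cube_def card_cartesian_product power3_eq_cube)

lemma finite_directions [simp]: "finite (directions t)"
  by (simp add: directions_def)

lemma positive_cube_of_scale:
  assumes "0 < d" "int d \<odot> w \<in> positive_cube t"
  shows "w \<in> positive_cube (t div d)"
proof -
  have range: "1 \<le> c \<and> c \<le> int (t div d)" if "1 \<le> int d * c" "int d * c \<le> int t" for c
  proof
    show "1 \<le> c" using that(1) assms(1) zero_less_mult_iff[of "int d" c] by simp
    have "int d * c div int d \<le> int t div int d" using that(2) assms(1) by (intro zdiv_mono1) auto
    then show "c \<le> int (t div d)" using assms(1) by (simp add: zdiv_int)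
  qed
  obtain a b c where "w = (a, b, c)" by (cases w)
  then show ?thesis using assms(2) range by (simp add: positive_cube_def)
qed

lemma nonprimitive_positive_cube:
  "positive_cube t - directions t \<subseteq> (\<Union>d\<in>{2..t}. scale (int d) ` positive_cube (t div d))"
proof
  fix v assume v: "v \<in> positive_cube t - directions t"
  then have "v \<noteq> 0" by (auto simp: positive_cube_def zero_prod_def)
  then obtain w where w: "v = coord_gcd v \<odot> w" using ex_primitive_direction by blast
  define d where "d = nat (coord_gcd v)"
  obtain a b c where abc: "v = (a, b, c)" by (cases v)
  have "0 \<le> coord_gcd v" by (simp add: abc)
  then have d: "int d = coord_gcd v" by (simp add: d_def)
  have "coord_gcd v \<noteq> 0" using \<open>v \<noteq> 0\<close> by simp
  then have "d \<noteq> 0" using d by linarith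
  moreover have "d \<noteq> 1" using v d by (auto simp: directions_def primitive_def)
  ultimately have "2 \<le> d" by linarith
  moreover have "d \<le> t"
  proof -
    have "coord_gcd v \<le> a" using v by (intro zdvd_imp_le) (auto simp: abc positive_cube_def)
    moreover have "a \<le> int t" using v by (simp add: abc positive_cube_def)
    ultimately show ?thesis using d by linarith
  qed
  moreover have "w \<in> positive_cube (t div d)"
    using positive_cube_of_scale[of d w t] v w d \<open>2 \<le> d\<close> by simp
  ultimately show "v \<in> (\<Union>d\<in>{2..t}. scale (int d) ` positive_cube (t div d))"
    using w d by (intro UN_I[of d] image_eqI[of _ _ w]) auto
qed

lemma card_directions_ge: "t ^ 3 \<le> 2 * card (directions t)"
proof (cases "t = 0")
  case False
  have "card (positive_cube t - directions t) \<le> card (\<Union>d\<in>{2..t}. scale (int d) ` positive_cube (t div d))"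
    by (intro card_mono nonprimitive_positive_cube) auto
  also have "\<dots> \<le> (\<Sum>d=2..t. card (scale (int d) ` positive_cube (t div d)))"
    by (rule card_UN_le) simp
  also have "\<dots> \<le> (\<Sum>d=2..t. (t div d) ^ 3)"
    by (intro sum_mono) (metis card_image_le card_positive_cube finite_positive_cube)
  finally have "real (card (positive_cube t - directions t)) \<le> real (\<Sum>d=2..t. (t div d) ^ 3)"
    by (simp only: of_nat_le_iff)
  also have "\<dots> \<le> (\<Sum>d=2..t. (real t / real d) ^ 3)"
    unfolding of_nat_sum of_nat_power by (intro sum_mono power_mono of_nat_div_le_of_nat) simp
  also have "\<dots> = real t ^ 3 * (\<Sum>d=2..t. 1 / real d ^ 3)"
    by (simp add: power_divide sum_distrib_left)
  also have "\<dots> \<le> real t ^ 3 * (1 / 2)"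
  proof (rule mult_left_mono)
    have "(\<Sum>d=2..t. 1 / real d ^ 3) \<le> (1 - 1 / real t) / 2"
      using False by (intro sum_inverse_cubes_le) simp
    also have "\<dots> \<le> 1 / 2" by simp
    finally show "(\<Sum>d=2..t. 1 / real d ^ 3) \<le> 1 / 2" .
  qed simp
  finally have "2 * real (card (positive_cube t - directions t)) \<le> real (t ^ 3)" by simp
  then have "2 * card (positive_cube t - directions t) \<le> t ^ 3" by linarith
  moreover have "card (positive_cube t - directions t) = card (positive_cube t) - card (directions t)"
    by (rule card_Diff_subset) (auto simp: directions_def)
  ultimately show ?thesis unfolding card_positive_cube by linarith
qed simp

lemma directions_unique:
  assumes "v \<in> directions t" "w \<in> directions t" "j \<odot> v = k \<odot> w" "j \<noteq> 0"
  shows "v = w"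
proof -
  have "\<bar>j\<bar> = \<bar>k\<bar>"
    using arg_cong[OF assms(3), of coord_gcd] assms(1,2)
    by (simp add: coord_gcd_scale directions_def primitive_def)
  moreover have "j \<noteq> - k"
  proof
    assume "j = - k"
    obtain v1 v2 v3 w1 w2 w3 where vw: "v = (v1, v2, v3)" "w = (w1, w2, w3)" by (metis surj_pair)
    have "k * (v1 + w1) = 0" using assms(3) \<open>j = - k\<close> by (simp add: vw algebra_simps)
    then show False
      using assms \<open>j = - k\<close> by (auto simp: vw directions_def positive_cube_def)
  qed
  ultimately show ?thesis using assms(3,4) by (simp add: abs_eq_iff)
qed

lemma ex_line_start:
  assumes x: "x \<in> grid m" and v: "v \<in> directions t"
  shows "\<exists>b. b \<in> grid m \<and> b - v \<notin> grid m \<and> b \<in> line x v"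
proof -
  obtain x1 x2 x3 v1 v2 v3 where xv: "x = (x1, x2, x3)" "v = (v1, v2, v3)" by (metis surj_pair)
  have "1 \<le> v1" using v by (auto simp: xv directions_def positive_cube_def)
  let ?inside = "\<lambda>k::nat. x - int k \<odot> v \<in> grid m"
  have "?inside 0" using x by simp
  moreover have "\<forall>k. ?inside k \<longrightarrow> k \<le> nat x1"
  proof (intro allI impI)
    fix k assume "?inside k"
    then have "int k * v1 \<le> x1" by (simp add: xv grid_def)
    moreover have "int k * 1 \<le> int k * v1" using \<open>1 \<le> v1\<close> by (intro mult_left_mono) auto
    ultimately show "k \<le> nat x1" by linarith
  qed
  ultimately obtain k where k: "?inside k" "\<And>j. ?inside j \<Longrightarrow> j \<le> k"
    using GreatestI_nat[of ?inside 0 "nat x1"] Greatest_le_nat[of ?inside _ "nat x1"] by blast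
  have "\<not> ?inside (k + 1)" using k(2)[of "k + 1"] by linarith
  moreover have "x - int (k + 1) \<odot> v = x - int k \<odot> v - v" by (simp add: scale_add algebra_simps)
  ultimately have "x - int k \<odot> v - v \<notin> grid m" by (simp only: simp_thms)
  moreover have "x - int k \<odot> v = x + (- int k) \<odot> v" using scale_diff[of 0 "int k" v] by simp
  then have "x - int k \<odot> v \<in> line x v" unfolding line_def by blast
  ultimately show ?thesis using k(1) by blast
qed

lemma card_lines_le:
  assumes A: "A \<subseteq> grid m" and v: "v \<in> directions t"
  shows "card ((\<lambda>x. line x v) ` A) \<le> 3 * t * m\<^sup>2"
proof -
  let ?M = "{0..<int m}" and ?T = "{0..<int t}"
  let ?B = "?T \<times> ?M \<times> ?M \<union> ?M \<times> ?T \<times> ?M \<union> ?M \<times> ?M \<times> ?T"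
  have "b \<in> ?B" if "b \<in> grid m" "b - v \<notin> grid m" for b
    using that v by (cases b; cases v) (auto simp: grid_def directions_def positive_cube_def)
  then have "line x v \<in> (\<lambda>x. line x v) ` ?B" if "x \<in> A" for x
    using ex_line_start[OF subsetD[OF A that] v] line_eqI by (metis image_eqI)
  then have "card ((\<lambda>x. line x v) ` A) \<le> card ((\<lambda>x. line x v) ` ?B)" by (intro card_mono) auto
  also have "\<dots> \<le> card ?B" by (rule card_image_le) simp
  also have "\<dots> \<le> card (?T \<times> ?M \<times> ?M) + card (?M \<times> ?T \<times> ?M) + card (?M \<times> ?M \<times> ?T)"
    by (meson add_mono card_Un_le le_trans order_refl)
  also have "\<dots> = 3 * t * m\<^sup>2" by (simp add: card_cartesian_product power2_eq_square)
  finally show ?thesis .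
qed

lemma ex_disjoint_triples_in_fibres:
  assumes "finite A"
  shows "\<exists>T. (\<forall>e\<in>T. e \<subseteq> A \<and> card e = 3 \<and> (\<exists>b. \<forall>x\<in>e. g x = b)) \<and> disjoint T
    \<and> card A \<le> 3 * card T + 2 * card (g ` A)"
  using assms
proof (induction "card A" arbitrary: A rule: less_induct)
  case less
  show ?case
  proof (cases "\<exists>b. 3 \<le> card {x\<in>A. g x = b}")
    case True
    then obtain b where "3 \<le> card {x\<in>A. g x = b}" ..
    then obtain e where e: "e \<subseteq> {x\<in>A. g x = b}" "card e = 3" by (rule obtain_subset_with_card_n)
    then have e_A: "e \<subseteq> A" "finite e" "e \<noteq> {}" using less.prems finite_subset[of e A] by auto
    then have card_A: "card A = card (A - e) + 3"
      using card_Diff_subset[of e A] card_mono[OF less.prems e_A(1)] e(2) by simp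
    then have smaller: "card (A - e) < card A" by simp
    obtain T where T: "\<forall>d\<in>T. d \<subseteq> A - e \<and> card d = 3 \<and> (\<exists>b. \<forall>x\<in>d. g x = b)" "disjoint T"
      "card (A - e) \<le> 3 * card T + 2 * card (g ` (A - e))"
      using less.hyps[OF smaller finite_Diff[OF less.prems]] by blast
    have "finite T" by (rule finite_subset[of _ "Pow A"]) (use T(1) less.prems in auto)
    moreover have "e \<notin> T" using T(1) e_A(3) by blast
    moreover have "card (g ` (A - e)) \<le> card (g ` A)" using less.prems by (intro card_mono) auto
    ultimately have "card A \<le> 3 * card (insert e T) + 2 * card (g ` A)" using T(3) card_A by simp
    moreover have "disjoint (insert e T)"
      using T(1,2) by (auto simp: pairwise_insert disjnt_def)
    moreover have "\<forall>d\<in>insert e T. d \<subseteq> A \<and> card d = 3 \<and> (\<exists>b. \<forall>x\<in>d. g x = b)"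
      using T(1) e e_A(1) by blast
    ultimately show ?thesis by blast
  next
    case False
    have fibre: "card {x\<in>A. g x = b} \<le> 2" for b
    proof -
      have "\<not> 3 \<le> card {x\<in>A. g x = b}" using False by blast
      then show ?thesis by simp
    qed
    have "card A \<le> card (\<Union>b\<in>g ` A. {x\<in>A. g x = b})" by (rule card_mono) (use less.prems in auto)
    also have "\<dots> \<le> (\<Sum>b\<in>g ` A. card {x\<in>A. g x = b})" using less.prems by (intro card_UN_le) simp
    also have "\<dots> \<le> card (g ` A) * 2"
      using fibre sum_bounded_above[of "g ` A" "\<lambda>b. card {x\<in>A. g x = b}" 2] by simp
    finally show ?thesis by (intro exI[of _ "{}"]) (simp add: mult.commute)
  qed
qed

definition triple_system :: "lattice_point set \<Rightarrow> lattice_point \<Rightarrow> lattice_point set set \<Rightarrow> bool" where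
  "triple_system A v T \<longleftrightarrow>
     (\<forall>e\<in>T. e \<subseteq> A \<and> card e = 3 \<and> (\<exists>p. e \<subseteq> line p v)) \<and> disjoint T \<and> card A \<le> 9 * card T"

lemma ex_triple_system:
  assumes A: "A \<subseteq> grid m" and v: "v \<in> directions t" and large: "9 * t * m\<^sup>2 \<le> card A"
  shows "\<exists>T. triple_system A v T"
proof -
  have "finite A" using A finite_grid by (rule finite_subset)
  then obtain T where T: "\<forall>e\<in>T. e \<subseteq> A \<and> card e = 3 \<and> (\<exists>l. \<forall>x\<in>e. line x v = l)" "disjoint T"
    "card A \<le> 3 * card T + 2 * card ((\<lambda>x. line x v) ` A)"
    using ex_disjoint_triples_in_fibres[of A "\<lambda>x. line x v"] by blast
  have "\<exists>p. e \<subseteq> line p v" if "e \<in> T" for e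
  proof -
    have "e \<noteq> {}" using T(1) that by auto
    then obtain p where "p \<in> e" by blast
    then have "line x v = line p v" if "x \<in> e" for x using T(1) \<open>e \<in> T\<close> that by metis
    then have "e \<subseteq> line p v" using line_refl by blast
    then show ?thesis ..
  qed
  moreover have "card A \<le> 9 * card T" using T(3) card_lines_le[OF A v] large by linarith
  ultimately have "triple_system A v T" using T(1,2) by (simp add: triple_system_def)
  then show ?thesis ..
qed

definition alignment_free :: "lattice_point set \<Rightarrow> bool" where
  "alignment_free I \<longleftrightarrow> (\<forall>S\<subseteq>I. card S = 3 \<longrightarrow> \<not> aligned S)"

locale lattice_triples =
  fixes A :: "lattice_point set" and t :: nat and T :: "lattice_point \<Rightarrow> lattice_point set set"
  assumes finite_points: "finite A" and triple_systems: "v \<in> directions t \<Longrightarrow> triple_system A v (T v)"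
begin

definition triples :: "lattice_point set set" where
  "triples = (\<Union>v\<in>directions t. T v)"

lemma triple: "v \<in> directions t \<Longrightarrow> e \<in> T v \<Longrightarrow> e \<subseteq> A \<and> card e = 3 \<and> (\<exists>p. e \<subseteq> line p v)"
  using triple_systems by (simp add: triple_system_def)

lemma finite_triple_system:
  assumes "v \<in> directions t"
  shows "finite (T v)"
proof (rule finite_subset)
  show "T v \<subseteq> Pow A" using triple[OF assms] by blast
qed (simp add: finite_points)

lemma disjoint_triple_system: "v \<in> directions t \<Longrightarrow> disjoint (T v)"
  using triple_systems by (simp add: triple_system_def)

lemma pair_determines_triple:
  assumes v: "v \<in> directions t" "e \<in> T v" and w: "w \<in> directions t" "g \<in> T w"
    and ab: "a \<noteq> b" "{a, b} \<subseteq> e" "{a, b} \<subseteq> g"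
  shows "v = w" and "e = g"
proof -
  obtain j where j: "b - a = j \<odot> v"
    using triple[OF v] ab(2) line_diff by (metis insert_subset subsetD)
  obtain k where k: "b - a = k \<odot> w"
    using triple[OF w] ab(3) line_diff by (metis insert_subset subsetD)
  have "j \<noteq> 0" using j ab(1) by auto
  then show "v = w" using directions_unique[OF v(1) w(1), of j k] j k by simp
  then show "e = g" using disjointD[OF disjoint_triple_system[OF v(1)] v(2), of g] w ab by blast
qed

sublocale linear_3graph A triples
proof
  show "finite A" by (fact finite_points)
  show "e \<subseteq> A \<and> card e = 3" if "e \<in> triples" for e
    using that triple unfolding triples_def by blast
  show "e = g" if mem: "e \<in> triples" "g \<in> triples"
    and pair: "a \<noteq> b" "{a, b} \<subseteq> e" "{a, b} \<subseteq> g" for e g a b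
  proof -
    obtain v w where "v \<in> directions t" "e \<in> T v" "w \<in> directions t" "g \<in> T w"
      using mem unfolding triples_def by blast
    then show ?thesis using pair by (rule pair_determines_triple(2))
  qed
qed

lemma deg_triples_le: "deg triples u \<le> card (directions t)"
proof -
  have "card {e\<in>T v. u \<in> e} \<le> 1" if v: "v \<in> directions t" for v
  proof -
    have "e = g" if "e \<in> T v" "g \<in> T v" "u \<in> e" "u \<in> g" for e g
      using disjointD[OF disjoint_triple_system[OF v]] that by blast
    then show ?thesis
      using card_le_Suc0_iff_eq[of "{e\<in>T v. u \<in> e}"] finite_triple_system[OF v] by simp
  qed
  moreover have "{e\<in>triples. u \<in> e} = (\<Union>v\<in>directions t. {e\<in>T v. u \<in> e})"
    by (auto simp: triples_def)
  then have "deg triples u \<le> (\<Sum>v\<in>directions t. card {e\<in>T v. u \<in> e})"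
    unfolding deg_def by (simp add: card_UN_le)
  ultimately show ?thesis
    using sum_bounded_above[of "directions t" "\<lambda>v. card {e\<in>T v. u \<in> e}" 1] by simp
qed

lemma card_triples_ge: "card (directions t) * card A \<le> 9 * card triples"
proof -
  have "card (directions t) * card A \<le> (\<Sum>v\<in>directions t. 9 * card (T v))"
    using triple_systems sum_bounded_below[of "directions t" "card A" "\<lambda>v. 9 * card (T v)"]
    by (simp add: triple_system_def)
  also have "\<dots> = 9 * (\<Sum>v\<in>directions t. card (T v))" by (simp add: sum_distrib_left)
  also have "(\<Sum>v\<in>directions t. card (T v)) = card triples"
    unfolding triples_def
  proof (intro card_UN_disjoint[symmetric] ballI impI)
    fix v w assume vw: "v \<in> directions t" "w \<in> directions t" "v \<noteq> w"
    show "T v \<inter> T w = {}"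
    proof (rule ccontr)
      assume "T v \<inter> T w \<noteq> {}"
      then obtain e where e: "e \<in> T v" "e \<in> T w" by blast
      then obtain a b c where "e = {a, b, c}" "a \<noteq> b" using triple[OF vw(1)] by (metis card_3_iff)
      then show False using pair_determines_triple(1)[OF vw(1) e(1) vw(2) e(2)] vw(3) by blast
    qed
  qed (use finite_triple_system in auto)
  finally show ?thesis .
qed

lemma alignment_free_independent:
  assumes "alignment_free I"
  shows "independent triples I"
  unfolding independent_def
proof
  fix e assume "e \<in> triples"
  then obtain v where "v \<in> directions t" "e \<in> T v" by (auto simp: triples_def)
  then have "card e = 3" "aligned e" using triple[of v e] aligned_if_subset_line by blast+
  then show "\<not> e \<subseteq> I" using assms by (auto simp: alignment_free_def)
qed

end

lemma container_step:
  assumes A: "A \<subseteq> grid m" and lo: "9 * \<sigma>\<^sup>2 * m\<^sup>2 \<le> card A" and hi: "card A \<le> 36 * \<sigma>\<^sup>2 * m\<^sup>2"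
    and \<sigma>: "18 \<le> \<sigma>" and q: "2592 * m\<^sup>2 \<le> \<sigma> * q"
  shows "\<exists>\<C>. container_family alignment_free A \<C> \<and> card \<C> \<le> (m ^ 3 + 1) ^ (2 * q) \<and>
     (\<forall>C\<in>\<C>. real (card C) \<le> 71 / 72 * card A)"
proof -
  let ?D = "card (directions (\<sigma>\<^sup>2))"
  have "finite A" using A finite_grid by (rule finite_subset)
  have "\<forall>v\<in>directions (\<sigma>\<^sup>2). \<exists>T. triple_system A v T"
    using ex_triple_system[OF A _ lo] by blast
  from bchoice[OF this] obtain T where "\<forall>v\<in>directions (\<sigma>\<^sup>2). triple_system A v (T v)" ..
  with \<open>finite A\<close> interpret lattice_triples A "\<sigma>\<^sup>2" T by unfold_locales auto
  have D: "\<sigma> ^ 3 * \<sigma> ^ 3 \<le> 2 * ?D"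
    using card_directions_ge[of "\<sigma>\<^sup>2"] by (simp flip: power_add power_mult)
  have \<sigma>3: "5832 \<le> \<sigma> ^ 3" using power_mono[OF \<sigma>, of 3] by simp
  interpret dense_linear_3graph A triples ?D "\<sigma> ^ 3" 9
  proof
    show "2 * 9\<^sup>2 * \<sigma> ^ 3 \<le> ?D" using mult_right_mono[OF \<sigma>3, of "\<sigma> ^ 3"] D by simp
  qed (use deg_triples_le card_triples_ge \<sigma>3 in simp_all)
  have "8 * 9 * card A \<le> \<sigma>\<^sup>2 * (2592 * m\<^sup>2)" using hi by linarith
  also have "\<dots> \<le> \<sigma>\<^sup>2 * (\<sigma> * q)" using q by (rule mult_left_mono) simp
  also have "\<dots> = \<sigma> ^ 3 * q" by (simp add: eval_nat_numeral)
  finally have q_neighbours: "8 * 9 * card A \<le> \<sigma> ^ 3 * q" .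
  have "4 * (9 * \<sigma> ^ 3 * card A) \<le> \<sigma> ^ 3 * (8 * 9 * card A)" by simp
  also have "\<dots> \<le> \<sigma> ^ 3 * (\<sigma> ^ 3 * q)" using q_neighbours by (rule mult_left_mono) simp
  also have "\<dots> \<le> 2 * ?D * q" using mult_right_mono[OF D, of q] by (simp add: mult.assoc)
  finally have q_pairs: "9 * \<sigma> ^ 3 * card A \<le> ?D * q" by linarith
  obtain \<C> where \<C>: "container_family (independent triples) A \<C>" "card \<C> \<le> (card A + 1) ^ (2 * q)"
    "\<forall>C\<in>\<C>. card A \<le> 8 * 9 * card (A - C)"
    using ex_containers[OF q_pairs q_neighbours] by blast
  have "card A \<le> m ^ 3" using card_mono[OF finite_grid A] by (simp only: card_grid)
  then have "(card A + 1) ^ (2 * q) \<le> (m ^ 3 + 1) ^ (2 * q)" by (intro power_mono) auto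
  then have "card \<C> \<le> (m ^ 3 + 1) ^ (2 * q)" using \<C>(2) by linarith
  moreover have "container_family alignment_free A \<C>"
    using \<C>(1) alignment_free_independent unfolding container_family_def by blast
  moreover have "real (card C) \<le> 71 / 72 * card A" if "C \<in> \<C>" for C
  proof -
    have "C \<subseteq> A" using \<C>(1) that by (simp add: container_family_def)
    then have "card (A - C) = card A - card C" "card C \<le> card A"
      using \<open>finite A\<close> by (auto intro: card_Diff_subset card_mono finite_subset)
    then have "72 * card C \<le> 71 * card A" using \<C>(3) that by force
    then show ?thesis by linarith
  qed
  ultimately show ?thesis by blast
qed

lemma ex_scale_of_card:
  assumes m: "0 < m" and large: "9 * real \<tau> ^ 2 * real m ^ 2 < real N" and \<tau>: "0 < \<tau>"
  shows "\<exists>\<sigma>\<ge>\<tau>. 9 * \<sigma>\<^sup>2 * m\<^sup>2 \<le> N \<and> N \<le> 36 * \<sigma>\<^sup>2 * m\<^sup>2"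
proof -
  define z where "z = sqrt (real N) / (3 * real m)"
  have N: "real N = 9 * z\<^sup>2 * real m ^ 2"
    using m by (simp add: z_def power_divide power_mult_distrib)
  have "0 \<le> z" by (simp add: z_def)
  have "real \<tau> ^ 2 < z ^ 2" using large m unfolding N by simp
  then have "real \<tau> \<le> z" using \<open>0 \<le> z\<close> by (meson less_imp_le power_less_imp_less_base)
  define \<sigma> where "\<sigma> = nat \<lfloor>z\<rfloor>"
  have "real \<sigma> = of_int \<lfloor>z\<rfloor>" using \<open>0 \<le> z\<close> by (simp add: \<sigma>_def)
  moreover have "\<tau> \<le> \<sigma>" using \<open>real \<tau> \<le> z\<close> unfolding \<sigma>_def by (rule le_nat_floor)
  ultimately have \<sigma>: "real \<sigma> \<le> z" "z \<le> 2 * real \<sigma>" "\<tau> \<le> \<sigma>" using \<tau> by linarith+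
  have "9 * real \<sigma> ^ 2 * real m ^ 2 \<le> real N" "real N \<le> 9 * (2 * real \<sigma>)\<^sup>2 * real m ^ 2"
    unfolding N using \<sigma> \<open>0 \<le> z\<close> by (intro mult_right_mono mult_left_mono power_mono; simp)+
  then have "real (9 * \<sigma>\<^sup>2 * m\<^sup>2) \<le> real N" "real N \<le> real (36 * \<sigma>\<^sup>2 * m\<^sup>2)"
    by (simp_all add: power_mult_distrib)
  then show ?thesis using \<sigma>(3) unfolding of_nat_le_iff by blast
qed

lemma iterated_grid_containers:
  assumes m: "0 < m" and \<tau>: "18 \<le> \<tau>" and q: "2592 * m\<^sup>2 \<le> \<tau> * q"
    and j: "(71 / 72) ^ j * real m ^ 3 \<le> 1"
  shows "\<exists>\<C>. container_family alignment_free (grid m) \<C> \<and> card \<C> \<le> (m ^ 3 + 1) ^ (2 * q * j) \<and>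
    (\<forall>C\<in>\<C>. real (card C) \<le> 9 * real \<tau> ^ 2 * real m ^ 2)"
proof -
  have "\<exists>\<C>. container_family alignment_free B \<C> \<and> card \<C> \<le> (m ^ 3 + 1) ^ (2 * q) \<and>
      (\<forall>C\<in>\<C>. real (card C) \<le> 71 / 72 * card B)"
    if B: "B \<subseteq> grid m" "9 * real \<tau> ^ 2 * real m ^ 2 < card B" for B
  proof -
    obtain \<sigma> where \<sigma>: "\<tau> \<le> \<sigma>" "9 * \<sigma>\<^sup>2 * m\<^sup>2 \<le> card B" "card B \<le> 36 * \<sigma>\<^sup>2 * m\<^sup>2"
      using ex_scale_of_card[OF m B(2)] \<tau> by auto
    have "\<tau> * q \<le> \<sigma> * q" using \<sigma>(1) by simp
    then have "2592 * m\<^sup>2 \<le> \<sigma> * q" using q by linarith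
    then show ?thesis using \<sigma>(1) \<tau> by (intro container_step[OF B(1) \<sigma>(2,3)]) auto
  qed
  moreover have "(71 / 72) ^ j * real (card (grid m)) \<le> 9 * real \<tau> ^ 2 * real m ^ 2"
  proof -
    have "1 * 1 \<le> real \<tau> ^ 2 * real m ^ 2" using \<tau> m by (intro mult_mono one_le_power) auto
    then show ?thesis using j by (simp add: card_grid)
  qed
  ultimately have "\<exists>\<C>. container_family alignment_free (grid m) \<C> \<and> card \<C> \<le> ((m ^ 3 + 1) ^ (2 * q)) ^ j \<and>
      (\<forall>C\<in>\<C>. real (card C) \<le> 9 * real \<tau> ^ 2 * real m ^ 2)"
    by (rule iterate_containers) simp_all
  then show ?thesis by (simp only: power_mult)
qed

lemma shrunk_cube_le_1:
  assumes m: "0 < m" and j: "216 * ln m \<le> real j"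
  shows "(71 / 72) ^ j * real m ^ 3 \<le> 1"
proof -
  have "71 / 72 \<le> exp (- 1 / 72 :: real)" using exp_ge_add_one_self[of "- 1 / 72 :: real"] by simp
  then have "(71 / 72) ^ j \<le> exp (- 1 / 72 :: real) ^ j" by (rule power_mono) simp
  also have "\<dots> = exp (- real j / 72)" by (simp flip: exp_of_nat_mult)
  also have "\<dots> \<le> exp (- (3 * ln (real m)))" using j by simp
  also have "\<dots> = inverse (exp (ln (real m)) ^ 3)" by (simp add: exp_minus flip: exp_of_nat_mult)
  finally show ?thesis using m by (simp add: field_simps)
qed

lemma cube_plus_one_power_le:
  assumes "2 \<le> m"
  shows "real ((m ^ 3 + 1) ^ e) \<le> exp (4 * ln m * real e)"
proof -
  have "m ^ 3 + 1 \<le> m ^ 3 * 2" using assms by simp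
  also have "\<dots> \<le> m ^ 3 * m" using assms by (intro mult_left_mono) auto
  finally have "real (m ^ 3 + 1) \<le> real (m ^ 4)"
    unfolding of_nat_le_iff by (simp add: eval_nat_numeral)
  also have "\<dots> = exp (ln (real m)) ^ 4" using assms by simp
  also have "\<dots> = exp (4 * ln m)" by (simp flip: exp_of_nat_mult)
  finally have "real (m ^ 3 + 1) ^ e \<le> exp (4 * ln m) ^ e" by (rule power_mono) simp
  also have "\<dots> = exp (4 * ln m * real e)" by (simp add: mult.commute flip: exp_of_nat_mult)
  finally show ?thesis by simp
qed

theorem grid_containers:
  fixes y :: real
  assumes m: "3 \<le> m" and y: "1 \<le> y" "y \<le> m"
  shows "\<exists>\<C>. container_family alignment_free (grid m) \<C> \<and>
    card \<C> \<le> exp (300000 * (real m ^ 2 / y) * (ln m)\<^sup>2) \<and> (\<forall>C\<in>\<C>. real (card C) \<le> 4000 * y\<^sup>2 * real m ^ 2)"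
proof -
  define l W where "l = ln (real m)" and "W = real m ^ 2 / y"
  have l: "1 \<le> l" unfolding l_def using m by (rule ln_ge_1)
  have "real m * y \<le> real m * real m" using y by (intro mult_left_mono) auto
  then have "real m \<le> W" using y by (simp add: W_def pos_le_divide_eq power2_eq_square)
  then have W: "1 \<le> W" using m by linarith
  define \<tau> where "\<tau> = nat \<lceil>18 * y\<rceil>"
  have \<tau>: "18 * y \<le> real \<tau>" "real \<tau> \<le> 19 * y" using y unfolding \<tau>_def by linarith+
  define q where "q = nat \<lceil>144 * W\<rceil>"
  have q: "144 * W \<le> real q" "real q \<le> 145 * W" using W unfolding q_def by linarith+
  define j where "j = nat \<lceil>216 * l\<rceil>"
  have j: "216 * l \<le> real j" "real j \<le> 217 * l" using l unfolding j_def by linarith+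
  have "18 \<le> \<tau>" using \<tau>(1) y by linarith
  moreover have "2592 * m\<^sup>2 \<le> \<tau> * q"
  proof -
    have "2592 * real m ^ 2 = (18 * y) * (144 * W)" using y by (simp add: W_def)
    also have "\<dots> \<le> real \<tau> * real q" using \<tau> q y W by (intro mult_mono) auto
    finally have "real (2592 * m\<^sup>2) \<le> real (\<tau> * q)" by simp
    then show ?thesis by (simp only: of_nat_le_iff)
  qed
  moreover have "(71 / 72) ^ j * real m ^ 3 \<le> 1"
    using m j(1) by (intro shrunk_cube_le_1) (auto simp: l_def)
  ultimately obtain \<C> where \<C>: "container_family alignment_free (grid m) \<C>"
    "card \<C> \<le> (m ^ 3 + 1) ^ (2 * q * j)" "\<forall>C\<in>\<C>. real (card C) \<le> 9 * real \<tau> ^ 2 * real m ^ 2"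
    using iterated_grid_containers[of m \<tau> q j] m by auto
  have "9 * real \<tau> ^ 2 * real m ^ 2 \<le> 9 * (19 * y)\<^sup>2 * real m ^ 2"
    using \<tau>(2) by (intro mult_right_mono mult_left_mono power_mono) auto
  also have "\<dots> \<le> 4000 * y\<^sup>2 * real m ^ 2"
    unfolding power_mult_distrib by (intro mult_right_mono) auto
  finally have size: "9 * real \<tau> ^ 2 * real m ^ 2 \<le> 4000 * y\<^sup>2 * real m ^ 2" .
  have "real (card \<C>) \<le> real ((m ^ 3 + 1) ^ (2 * q * j))" using \<C>(2) by (simp only: of_nat_le_iff)
  also have "\<dots> \<le> exp (8 * l * (real q * real j))"
    using cube_plus_one_power_le[of m "2 * q * j"] m by (simp add: l_def mult_ac)
  also have "\<dots> \<le> exp (8 * l * ((145 * W) * (217 * l)))"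
    unfolding exp_le_cancel_iff using q j W l by (intro mult_left_mono mult_mono) auto
  also have "\<dots> \<le> exp (300000 * W * l\<^sup>2)"
    using W by (simp add: power2_eq_square)
  finally show ?thesis
    using \<C>(1,3) size unfolding l_def W_def by (meson order_trans)
qed

section \<open>Generic projection to the plane\<close>

fun proj :: "int \<Rightarrow> lattice_point \<Rightarrow> real ^ 2" where
  "proj L (a, b, c) = vector [real_of_int (a + L * c), real_of_int (b + L\<^sup>2 * c)]"

lemma small_multiple_eq_0:
  fixes a L k :: int
  assumes "\<bar>a\<bar> < L" "a = L * k"
  shows "k = 0"
proof -
  have "a = 0" using assms dvd_imp_le_int[of a L] by force
  then show ?thesis using assms by auto
qed

lemma grid_diff_bound: "u \<in> grid m \<Longrightarrow> v \<in> grid m \<Longrightarrow> v - u = (a, b, c) \<Longrightarrow>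
    \<bar>a\<bar> \<le> int m \<and> \<bar>b\<bar> \<le> int m \<and> \<bar>c\<bar> \<le> int m"
  by (cases u; cases v) (auto simp: grid_def)

lemma collinear_proj_iff:
  "collinear {proj L u, proj L v, proj L w} \<longleftrightarrow>
    (case (v - u, w - u) of ((a1, a2, a3), (b1, b2, b3)) \<Rightarrow>
      a1 * b2 - a2 * b1 = L * ((a2 * b3 - a3 * b2) + L * (a3 * b1 - a1 * b3)))"
proof -
  obtain u1 u2 u3 v1 v2 v3 w1 w2 w3
    where uvw: "u = (u1, u2, u3)" "v = (v1, v2, v3)" "w = (w1, w2, w3)"
    by (metis surj_pair)
  define a1 a2 a3 b1 b2 b3 where ab: "a1 = v1 - u1" "a2 = v2 - u2" "a3 = v3 - u3"
    "b1 = w1 - u1" "b2 = w2 - u2" "b3 = w3 - u3"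
  have "collinear {proj L u, proj L v, proj L w} \<longleftrightarrow>
      real_of_int ((a1 + L * a3) * (b2 + L\<^sup>2 * b3)) = real_of_int ((b1 + L * b3) * (a2 + L\<^sup>2 * a3))"
    unfolding collinear_3_2D by (simp add: uvw ab algebra_simps)
  also have "\<dots> \<longleftrightarrow> (a1 + L * a3) * (b2 + L\<^sup>2 * b3) = (b1 + L * b3) * (a2 + L\<^sup>2 * a3)"
    by (simp only: of_int_eq_iff)
  also have "\<dots> \<longleftrightarrow> a1 * b2 - a2 * b1 = L * ((a2 * b3 - a3 * b2) + L * (a3 * b1 - a1 * b3))"
    by (simp add: algebra_simps power2_eq_square)
  finally show ?thesis by (simp add: uvw ab)
qed

lemma collinear_proj_iff_parallel:
  assumes grid: "u \<in> grid m" "v \<in> grid m" "w \<in> grid m" and L: "2 * (int m)\<^sup>2 < L"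
  shows "collinear {proj L u, proj L v, proj L w} \<longleftrightarrow> parallel (v - u) (w - u)"
proof -
  obtain a1 a2 a3 b1 b2 b3 where ab: "v - u = (a1, a2, a3)" "w - u = (b1, b2, b3)"
    by (metis surj_pair)
  have bounds: "\<bar>a1\<bar> \<le> int m" "\<bar>a2\<bar> \<le> int m" "\<bar>a3\<bar> \<le> int m" "\<bar>b1\<bar> \<le> int m" "\<bar>b2\<bar> \<le> int m"
    "\<bar>b3\<bar> \<le> int m"
    using grid_diff_bound[OF grid(1,2) ab(1)] grid_diff_bound[OF grid(1,3) ab(2)] by auto
  have minor: "\<bar>p * q - p' * q'\<bar> < L"
    if "\<bar>p\<bar> \<le> int m" "\<bar>q\<bar> \<le> int m" "\<bar>p'\<bar> \<le> int m" "\<bar>q'\<bar> \<le> int m" for p q p' q'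
  proof -
    have "\<bar>p * q\<bar> \<le> int m * int m" "\<bar>p' * q'\<bar> \<le> int m * int m"
      unfolding abs_mult using that by (auto intro!: mult_mono)
    then show ?thesis using L by (simp add: power2_eq_square)
  qed
  define c1 c2 c3
    where c: "c1 = a2 * b3 - a3 * b2" "c2 = a3 * b1 - a1 * b3" "c3 = a1 * b2 - a2 * b1"
  have "\<bar>c1\<bar> < L" "\<bar>c3\<bar> < L" unfolding c using bounds by (auto intro!: minor)
  have "collinear {proj L u, proj L v, proj L w} \<longleftrightarrow> c3 = L * (c1 + L * c2)"
    by (simp add: collinear_proj_iff ab c)
  also have "\<dots> \<longleftrightarrow> c1 = 0 \<and> c2 = 0 \<and> c3 = 0"
  proof
    assume digits: "c3 = L * (c1 + L * c2)"
    then have "c1 + L * c2 = 0" using small_multiple_eq_0 \<open>\<bar>c3\<bar> < L\<close> by blast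
    moreover from this have "c1 = L * (- c2)" by simp
    then have "- c2 = 0" using small_multiple_eq_0 \<open>\<bar>c1\<bar> < L\<close> by blast
    ultimately show "c1 = 0 \<and> c2 = 0 \<and> c3 = 0" using digits by simp
  qed simp
  also have "\<dots> \<longleftrightarrow> parallel (v - u) (w - u)" by (auto simp: ab c)
  finally show ?thesis .
qed

lemma inj_on_proj:
  assumes L: "2 * (int m)\<^sup>2 < L"
  shows "inj_on (proj L) (grid m)"
proof (rule inj_onI)
  fix u v assume uv: "u \<in> grid m" "v \<in> grid m" "proj L u = proj L v"
  obtain u1 u2 u3 v1 v2 v3 where c: "u = (u1, u2, u3)" "v = (v1, v2, v3)" by (metis surj_pair)
  have "proj L u $ 1 = proj L v $ 1" "proj L u $ 2 = proj L v $ 2" using uv(3) by simp_all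
  then have eq: "u1 + L * u3 = v1 + L * v3" "u2 + L\<^sup>2 * u3 = v2 + L\<^sup>2 * v3"
    unfolding c by (simp_all only: proj.simps vector_2 of_int_eq_iff)
  have "0 < m" using uv(1) by (auto simp: c grid_def)
  then have "int m * 1 \<le> int m * int m" by (intro mult_left_mono) auto
  then have "int m < L" using L by (simp add: power2_eq_square)
  then have "\<bar>u1 - v1\<bar> < L" using uv(1,2) by (auto simp: c grid_def)
  moreover have "u1 - v1 = L * (v3 - u3)" using eq(1) by (simp add: algebra_simps)
  ultimately have "v3 - u3 = 0" by (rule small_multiple_eq_0)
  then show "u = v" using eq by (simp add: c)
qed

lemma collinear_proj_image:
  assumes S: "S \<subseteq> grid m" and L: "2 * (int m)\<^sup>2 < L"
  shows "collinear (proj L ` S) \<longleftrightarrow> aligned S"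
proof -
  have "collinear {proj L u, proj L v, proj L w} \<longleftrightarrow> parallel (v - u) (w - u)"
    if "u \<in> S" "v \<in> S" "w \<in> S" for u v w
    using collinear_proj_iff_parallel[OF _ _ _ L] subsetD[OF S] that by blast
  then show ?thesis unfolding collinear_iff_triples[of "proj L ` S"] aligned_def by simp
qed

lemma no_collinear_proj_image:
  assumes A: "A \<subseteq> grid m" and L: "2 * (int m)\<^sup>2 < L"
  shows "no_collinear k (proj L ` A) \<longleftrightarrow> (\<forall>S\<subseteq>A. card S = k \<longrightarrow> \<not> aligned S)"
proof -
  have inj: "inj_on (proj L) S" if "S \<subseteq> A" for S
    using inj_on_proj[OF L] that A by (meson inj_on_subset subset_trans)
  have collinear: "collinear (proj L ` S) \<longleftrightarrow> aligned S" if "S \<subseteq> A" for S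
    using collinear_proj_image[OF subset_trans[OF that A] L] .
  have "no_collinear k (proj L ` A) \<longleftrightarrow> (\<forall>S\<subseteq>A. card (proj L ` S) = k \<longrightarrow> \<not> collinear (proj L ` S))"
    unfolding no_collinear_def by (metis image_mono subset_imageE)
  also have "\<dots> \<longleftrightarrow> (\<forall>S\<subseteq>A. card S = k \<longrightarrow> \<not> aligned S)"
    using card_image[OF inj] collinear by simp
  finally show ?thesis .
qed

lemma f_le_of_grid:
  fixes a :: real
  assumes s: "2 \<le> s" and A: "A \<subseteq> grid m" "card A = n"
    and lines: "\<And>S. S \<subseteq> A \<Longrightarrow> card S = s + 1 \<Longrightarrow> \<not> aligned S"
    and small: "\<And>I. I \<subseteq> A \<Longrightarrow> alignment_free I \<Longrightarrow> card I \<le> a"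
  shows "f n s \<le> a"
proof -
  define L where "L = 2 * (int m)\<^sup>2 + 1"
  have L: "2 * (int m)\<^sup>2 < L" by (simp add: L_def)
  have inj: "inj_on (proj L) A" using inj_on_proj[OF L] A(1) by (rule inj_on_subset)
  show ?thesis
  proof (rule f_leI[OF s])
    show "finite (proj L ` A)" using finite_subset[OF A(1) finite_grid] by simp
    show "card (proj L ` A) = n" using A(2) card_image[OF inj] by simp
    show "no_collinear (s + 1) (proj L ` A)"
      using lines no_collinear_proj_image[OF A(1) L] by blast
    fix Q assume Q: "Q \<subseteq> proj L ` A" "general_position Q"
    then obtain I where I: "I \<subseteq> A" "Q = proj L ` I" by (meson subset_imageE)
    have "alignment_free I"
      using Q(2) no_collinear_proj_image[OF subset_trans[OF I(1) A(1)] L]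
      unfolding I(2) general_position_def alignment_free_def by blast
    then show "card Q \<le> a"
      using small[OF I(1)] card_image[OF inj_on_subset[OF inj I(1)]] by (simp add: I(2))
  qed
qed

section \<open>Sets covered by few parallel lines\<close>

lemma aligned_in_row:
  assumes "\<And>x. x \<in> S \<Longrightarrow> snd x = b"
  shows "aligned S"
proof (rule aligned_if_subset_line)
  show "S \<subseteq> line (0, b) (1, 0, 0)"
  proof
    fix x assume "x \<in> S"
    then have "x = (0, b) + fst x \<odot> (1, 0, 0)" using assms by (auto simp: prod_eq_iff)
    then show "x \<in> line (0, b) (1, 0, 0)" unfolding line_def by blast
  qed
qed

lemma card_alignment_free_le_rows:
  assumes "finite I" "alignment_free I"
  shows "card I \<le> 2 * card (snd ` I)"
proof -
  obtain T where T: "\<forall>e\<in>T. e \<subseteq> I \<and> card e = 3 \<and> (\<exists>b. \<forall>x\<in>e. snd x = b)"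
    "card I \<le> 3 * card T + 2 * card (snd ` I)"
    using ex_disjoint_triples_in_fibres[OF assms(1), of snd] by blast
  have "e \<notin> T" for e
  proof
    assume "e \<in> T"
    then obtain b where "\<forall>x\<in>e. snd x = b" using T(1) by blast
    then have "aligned e" by (intro aligned_in_row) simp
    moreover have "e \<subseteq> I" "card e = 3" using T(1) \<open>e \<in> T\<close> by simp_all
    ultimately show False using assms(2) by (simp add: alignment_free_def)
  qed
  then have "T = {}" by blast
  then show ?thesis using T(2) by simp
qed

lemma f_le_rows:
  assumes s: "2 \<le> s" and n: "n \<le> s ^ 3"
  shows "real (f n s) \<le> 2 * (real n / real s + 1)"
proof -
  define k where "k = nat \<lceil>real n / real s\<rceil>"
  have "0 \<le> real n / real s" by simp
  then have k: "real n / real s \<le> real k" "real k \<le> real n / real s + 1"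
    unfolding k_def by linarith+
  have "real n \<le> real s ^ 3" using n by (metis of_nat_le_iff of_nat_power)
  then have "real n / real s \<le> real (s\<^sup>2)" using s by (simp add: pos_divide_le_eq eval_nat_numeral)
  then have "k \<le> card ({0..<int s} \<times> {0..<int s})"
    unfolding k_def by (simp add: card_cartesian_product nat_le_iff ceiling_le_iff power2_eq_square)
  then obtain R where R: "R \<subseteq> {0..<int s} \<times> {0..<int s}" "card R = k"
    by (rule obtain_subset_with_card_n)
  have "finite R" using R(1) by (rule finite_subset) simp
  have "real n \<le> real (s * k)" using k(1) s by (simp add: pos_divide_le_eq mult.commute)
  then have "n \<le> s * k" by (simp only: of_nat_le_iff)
  then have "n \<le> card ({0..<int s} \<times> R)" using R(2) by (simp add: card_cartesian_product)
  then obtain A where A: "A \<subseteq> {0..<int s} \<times> R" "card A = n" by (rule obtain_subset_with_card_n)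
  show ?thesis
  proof (rule f_le_of_grid[OF s _ A(2)])
    show A_grid: "A \<subseteq> grid s" using A(1) R(1) by (auto simp: grid_def)
    show "\<not> aligned S" if "S \<subseteq> A" "card S = s + 1" for S
      using card_aligned_grid_le[of S s] that A_grid s by auto
    fix I assume I: "I \<subseteq> A" "alignment_free I"
    have "finite A" using A_grid finite_grid by (rule finite_subset)
    then have "card I \<le> 2 * card (snd ` I)"
      using card_alignment_free_le_rows[OF _ I(2)] I(1) finite_subset by blast
    also have "\<dots> \<le> 2 * card R" using I(1) A(1) \<open>finite R\<close> by (intro mult_left_mono card_mono) auto
    finally have "real (card I) \<le> 2 * real k" using R(2) by simp
    also have "\<dots> \<le> 2 * (real n / real s + 1)" using k(2) by (rule mult_left_mono) simp
    finally show "real (card I) \<le> 2 * (real n / real s + 1)" .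
  qed
qed

section \<open>Random subsets of the grid\<close>

definition contained_subsets :: "nat \<Rightarrow> 'a set set \<Rightarrow> 'a set set" where
  "contained_subsets k \<C> = {K. card K = k \<and> (\<exists>C\<in>\<C>. K \<subseteq> C)}"

lemma contained_subsets_eq_UN: "contained_subsets k \<C> = (\<Union>C\<in>\<C>. {K. K \<subseteq> C \<and> card K = k})"
  by (auto simp: contained_subsets_def)

lemma finite_contained_subsets:
  "finite \<C> \<Longrightarrow> (\<And>C. C \<in> \<C> \<Longrightarrow> finite C) \<Longrightarrow> finite (contained_subsets k \<C>)"
  by (simp add: contained_subsets_eq_UN)

lemma card_contained_subsets_le:
  fixes M :: real
  assumes \<C>: "finite \<C>" "\<And>C. C \<in> \<C> \<Longrightarrow> finite C \<and> card C \<le> M" and k: "0 < k"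
  shows "card (contained_subsets k \<C>) \<le> card \<C> * (exp 1 * M / k) ^ k"
proof -
  have "card (contained_subsets k \<C>) \<le> (\<Sum>C\<in>\<C>. card {K. K \<subseteq> C \<and> card K = k})"
    unfolding contained_subsets_eq_UN using \<C>(1) by (rule card_UN_le)
  then have "real (card (contained_subsets k \<C>)) \<le> (\<Sum>C\<in>\<C>. real (card {K. K \<subseteq> C \<and> card K = k}))"
    unfolding of_nat_sum[symmetric] by (simp only: of_nat_le_iff)
  also have "\<dots> \<le> (\<Sum>C\<in>\<C>. (exp 1 * M / k) ^ k)"
  proof (rule sum_mono)
    fix C assume C: "C \<in> \<C>"
    have "real (card {K. K \<subseteq> C \<and> card K = k}) \<le> (exp 1 * real (card C) / real k) ^ k"
      using choose_le_exp_power[OF k] \<C>(2)[OF C] by (simp add: n_subsets)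
    also have "\<dots> \<le> (exp 1 * M / k) ^ k"
      using \<C>(2)[OF C] by (intro power_mono divide_right_mono mult_left_mono) auto
    finally show "real (card {K. K \<subseteq> C \<and> card K = k}) \<le> (exp 1 * M / k) ^ k" .
  qed
  finally show ?thesis by simp
qed

lemma card_less_of_no_contained_subset:
  assumes "container_family \<I> A \<C>" "I \<subseteq> A" "\<I> I" "\<forall>K\<in>contained_subsets k \<C>. \<not> K \<subseteq> I"
  shows "card I < k"
proof (rule ccontr)
  assume "\<not> card I < k"
  then have "k \<le> card I" by simp
  then obtain K where K: "K \<subseteq> I" "card K = k" by (rule obtain_subset_with_card_n)
  have "\<exists>C\<in>\<C>. I \<subseteq> C" using assms(1-3) by (simp add: container_family_def)
  then have "K \<in> contained_subsets k \<C>" using K by (auto simp: contained_subsets_def)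
  then show False using assms(4) K(1) by blast
qed

lemma ex_random_grid_subset:
  fixes p M :: real
  assumes p: "0 \<le> p" "p \<le> 1" and k: "0 < k"
    and few_aligned: "card {S. S \<subseteq> grid m \<and> card S = s + 1 \<and> aligned S} * p ^ (s + 1) \<le> p * real m ^ 3 / 4"
    and \<C>: "container_family alignment_free (grid m) \<C>" "\<And>C. C \<in> \<C> \<Longrightarrow> card C \<le> M"
    and few_contained: "card \<C> * (exp 1 * M / k) ^ k * p ^ k \<le> p * real m ^ 3 / 4"
  shows "\<exists>A\<subseteq>grid m. p * real m ^ 3 / 2 \<le> card A \<and> (\<forall>S\<subseteq>A. card S = s + 1 \<longrightarrow> \<not> aligned S) \<and>
    (\<forall>I\<subseteq>A. alignment_free I \<longrightarrow> card I < k)"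
proof -
  define \<T> where "\<T> = {S. S \<subseteq> grid m \<and> card S = s + 1 \<and> aligned S}"
  define \<K> where "\<K> = contained_subsets k \<C>"
  have C_subset: "C \<subseteq> grid m" if "C \<in> \<C>" for C
    using \<C>(1) that by (simp add: container_family_def)
  have C_finite: "finite C" if "C \<in> \<C>" for C
    using C_subset[OF that] finite_grid by (rule finite_subset)
  have \<C>_finite: "finite \<C>" using \<C>(1) by (simp add: container_family_def)
  have finite: "finite \<T>" "finite \<K>"
    using finite_contained_subsets[OF \<C>_finite C_finite] by (simp_all add: \<T>_def \<K>_def)
  have "(\<Sum>F\<in>\<T>. p ^ card F) = card \<T> * p ^ (s + 1)" "(\<Sum>F\<in>\<K>. p ^ card F) = card \<K> * p ^ k"
    by (simp_all add: \<T>_def \<K>_def contained_subsets_def)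
  moreover have "card \<K> * p ^ k \<le> card \<C> * (exp 1 * M / k) ^ k * p ^ k"
    unfolding \<K>_def
    using C_finite \<C>(2) \<C>_finite k p by (intro mult_right_mono card_contained_subsets_le) auto
  moreover have "(\<Sum>F\<in>\<T> \<union> \<K>. p ^ card F) \<le> (\<Sum>F\<in>\<T>. p ^ card F) + (\<Sum>F\<in>\<K>. p ^ card F)"
    using p(1) sum_nonneg[of "\<T> \<inter> \<K>" "\<lambda>F. p ^ card F"] by (simp add: sum_Un[OF finite])
  ultimately have weight: "(\<Sum>F\<in>\<T> \<union> \<K>. p ^ card F) \<le> p * real m ^ 3 / 2"
    using few_aligned few_contained unfolding \<T>_def by linarith
  have members: "F \<subseteq> grid m \<and> F \<noteq> {}" if F: "F \<in> \<T> \<union> \<K>" for F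
  proof
    show "F \<subseteq> grid m"
      using F C_subset unfolding \<T>_def \<K>_def contained_subsets_def by blast
    show "F \<noteq> {}" using F k by (auto simp: \<T>_def \<K>_def contained_subsets_def)
  qed
  obtain A where A: "A \<subseteq> grid m" "p * card (grid m) - (\<Sum>F\<in>\<T> \<union> \<K>. p ^ card F) \<le> card A"
    "\<forall>F\<in>\<T> \<union> \<K>. \<not> F \<subseteq> A"
    using random_deletion[OF finite_grid finite_UnI[OF finite] members p] by blast
  have "card I < k" if I: "I \<subseteq> A" "alignment_free I" for I
  proof (rule card_less_of_no_contained_subset[OF \<C>(1) _ I(2)])
    show "I \<subseteq> grid m" using I(1) A(1) by (rule subset_trans)
    show "\<forall>K\<in>contained_subsets k \<C>. \<not> K \<subseteq> I" using A(3) I(1) unfolding \<K>_def by blast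
  qed
  moreover have "\<not> aligned S" if "S \<subseteq> A" "card S = s + 1" for S
    using A(1,3) that by (auto simp: \<T>_def)
  moreover have "p * real m ^ 3 / 2 \<le> card A" using A(2) weight by (simp add: card_grid)
  ultimately show ?thesis using A(1) by blast
qed

section \<open>The asymptotic bounds\<close>

lemma weighted_card_aligned_subsets_le:
  fixes p :: real
  assumes s: "3 \<le> s" and m: "3 \<le> m" and p: "p = real s / (36 * real m * ln m)"
  shows "card {S. S \<subseteq> grid m \<and> card S = s + 1 \<and> aligned S} * p ^ (s + 1) \<le> p * real m ^ 3 / 4"
proof -
  let ?N = "real (card {S. S \<subseteq> grid m \<and> card S = s + 1 \<and> aligned S})"
  define l where "l = ln (real m)"
  have l: "1 \<le> l" unfolding l_def using m by (rule ln_ge_1)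
  have p0: "0 \<le> p" using m l by (simp add: p l_def)
  have "real m * p = real s / (36 * l)" using m by (simp add: p l_def)
  then have mp: "real m ^ s * p ^ s = real s ^ s / (36 * l) ^ s"
    by (metis power_divide power_mult_distrib)
  have "?N * p ^ s \<le> 27 * real m ^ (s + 3) * (1 + l) / fact (s - 1) * p ^ s"
    using card_aligned_subsets_le[OF s, of m] m p0 by (intro mult_right_mono) (auto simp: l_def)
  also have "\<dots> = 27 * real m ^ 3 * (1 + l) * (real m ^ s * p ^ s) / fact (s - 1)"
    by (simp add: power_add mult_ac)
  also have "\<dots> = 27 * real m ^ 3 * (1 + l) * (real s ^ s / (fact (s - 1) * (36 * l) ^ s))"
    unfolding mp by (simp add: mult_ac)
  also have "\<dots> \<le> 27 * real m ^ 3 * (2 * l ^ s) * (6 ^ s * fact (s - 1) / (fact (s - 1) * (36 * l) ^ s))"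
  proof (intro mult_mono mult_left_mono divide_right_mono self_power_le)
    have "l \<le> l ^ s" using l s by (intro self_le_power) auto
    then show "1 + l \<le> 2 * l ^ s" using l by linarith
  qed (use s l in auto)
  also have "\<dots> = 54 * real m ^ 3 * ((6 * l) ^ s / (36 * l) ^ s)"
    by (simp add: power_mult_distrib mult_ac)
  also have "(6 * l) ^ s / (36 * l) ^ s = (1 / 6) ^ s"
    using l by (simp flip: power_divide)
  also have "54 * real m ^ 3 * (1 / 6) ^ s \<le> 54 * real m ^ 3 * (1 / 6) ^ 3"
    using s by (intro mult_left_mono power_decreasing) auto
  finally have "?N * p ^ s \<le> real m ^ 3 / 4" by (simp add: power_divide)
  then have "p * (?N * p ^ s) \<le> p * (real m ^ 3 / 4)" using p0 by (rule mult_left_mono)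
  then show ?thesis by (simp add: mult_ac)
qed

lemma weighted_card_containers_le:
  fixes M N W l p :: real
  assumes N: "N \<le> exp (300000 * W * l\<^sup>2)" and M: "0 \<le> M" "M * p \<le> 112 * W" and W: "1 \<le> W" "1 \<le> l"
    and p: "0 \<le> p" and k: "300020 * (W * l\<^sup>2) \<le> real k"
  shows "N * (exp 1 * M / k) ^ k * p ^ k \<le> exp (- 20)"
proof -
  have Wl: "W \<le> W * l\<^sup>2" using W by (simp add: mult_le_cancel_left1)
  then have k0: "0 < real k" using k W by linarith
  have "exp 1 * (exp 1 * (M * p)) \<le> 3 * (3 * (112 * W))"
    using mult_mono[OF exp_le mult_mono[OF exp_le M(2)]] M(1) p by simp
  then have "exp 1 * (exp 1 * M / k * p) \<le> 1"
    using k Wl k0 by (simp add: pos_divide_le_eq mult_ac)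
  then have "exp 1 * M / k * p \<le> exp (- 1)" by (simp add: exp_minus field_simps)
  then have "(exp 1 * M / k * p) ^ k \<le> exp (- 1) ^ k" using M(1) p by (intro power_mono) auto
  also have "\<dots> = exp (- real k)" by (simp flip: exp_of_nat_mult)
  finally have "N * (exp 1 * M / k * p) ^ k \<le> exp (300000 * W * l\<^sup>2) * exp (- real k)"
    using N M(1) p by (intro mult_mono) auto
  also have "\<dots> = exp (300000 * W * l\<^sup>2 - k)" by (simp flip: exp_add)
  also have "\<dots> \<le> exp (- 20)"
  proof -
    have "300000 * W * l\<^sup>2 = 300000 * (W * l\<^sup>2)" by simp
    then show ?thesis unfolding exp_le_cancel_iff using k Wl W by linarith
  qed
  finally show ?thesis by (simp only: power_mult_distrib[of "exp 1 * M / k" p] mult.assoc)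
qed

text \<open>The size \<open>y\<^sup>2m\<^sup>2\<close> of the containers, thinned by the factor \<open>s/m\<close>, is balanced against the logarithm
  \<open>m\<^sup>2/y\<close> of their number: this gives \<open>y\<^sup>3 = m/s\<close>.\<close>

locale sparse_grid =
  fixes s m :: nat
  assumes s_ge_3: "3 \<le> s" and s_le_m: "s \<le> m"
begin

definition l :: real where "l = ln m"
definition y :: real where "y = (real m / real s) powr (1/3)"
definition W :: real where "W = real m ^ 2 / y"
definition p :: real where "p = real s / (36 * real m * l)"

lemma m_ge_3: "3 \<le> m"
  using s_ge_3 s_le_m by linarith

lemma l_bounds: "1 \<le> l" "l \<le> real m"
  using ln_ge_1[OF m_ge_3] ln_le_minus_one[of "real m"] m_ge_3 by (simp_all add: l_def)

lemma y_cube: "y ^ 3 = real m / real s"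
  using s_ge_3 m_ge_3 by (simp add: y_def powr_power)

lemma y_bounds: "1 \<le> y" "y \<le> real m"
proof -
  have x: "1 \<le> real m / real s" "real m / real s \<le> real m"
    using s_ge_3 s_le_m by (auto simp: field_simps)
  then show y: "1 \<le> y" by (simp add: y_def ge_one_powr_ge_zero)
  then have "y ^ 1 \<le> y ^ 3" by (intro power_increasing) auto
  then show "y \<le> real m" using x by (simp add: y_cube)
qed

lemma W_ge_1: "1 \<le> W"
proof -
  have "real m * y \<le> real m * real m" using y_bounds by (intro mult_left_mono) auto
  then have "real m \<le> W" using y_bounds by (simp add: W_def pos_le_divide_eq power2_eq_square)
  then show ?thesis using m_ge_3 by linarith
qed

lemma W_le_mult_l_square: "W \<le> W * l\<^sup>2"
  using W_ge_1 l_bounds by (simp add: mult_le_cancel_left1)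

lemma p_y: "p = 1 / (36 * y ^ 3 * l)"
  using s_ge_3 by (simp add: p_def y_cube)

lemma p_bounds: "0 \<le> p" "p \<le> 1"
proof -
  have "1 * 1 \<le> y ^ 3 * l" using y_bounds l_bounds by (intro mult_mono one_le_power) auto
  then show "0 \<le> p" "p \<le> 1" by (simp_all add: p_y mult.assoc)
qed

lemma thinned_container_size_le: "4000 * y\<^sup>2 * real m ^ 2 * p \<le> 112 * W"
proof -
  have "4000 * y\<^sup>2 * real m ^ 2 * p = 4000 / 36 * W / l"
    using y_bounds(1) l_bounds(1) by (simp add: p_y W_def power2_eq_square power3_eq_cube)
  also have "\<dots> \<le> 4000 / 36 * W"
    using W_ge_1 l_bounds by (simp add: pos_divide_le_eq mult_le_cancel_left1)
  finally show ?thesis using W_ge_1 by linarith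
qed

lemma expected_size_ge: "exp (- 20) \<le> p * real m ^ 3 / 4"
proof -
  have "(3 * 3) * (real m * l) \<le> (real s * real m) * (real m * real m)"
    using s_ge_3 m_ge_3 l_bounds by (intro mult_mono) auto
  then have "1 / 16 \<le> p * real m ^ 3 / 4"
    using m_ge_3 l_bounds by (simp add: p_def pos_le_divide_eq power3_eq_cube mult_ac)
  moreover have "exp (- 20) \<le> (1 / 16 :: real)"
    using exp_ge_add_one_self[of "20 :: real"] le_imp_inverse_le[of 16 "exp 20 :: real"]
    by (simp add: exp_minus inverse_eq_divide)
  ultimately show ?thesis by linarith
qed

lemma ex_grid_subset:
  "\<exists>A\<subseteq>grid m. real m ^ 2 * real s \<le> 72 * l * real (card A) \<and>
    (\<forall>S\<subseteq>A. card S = s + 1 \<longrightarrow> \<not> aligned S) \<and>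
    (\<forall>I\<subseteq>A. alignment_free I \<longrightarrow> real (card I) \<le> 400000 * W * l\<^sup>2)"
proof -
  define k where "k = nat \<lceil>300020 * (W * l\<^sup>2)\<rceil>"
  have k: "300020 * (W * l\<^sup>2) \<le> real k" "real k \<le> 300021 * (W * l\<^sup>2)"
    using W_ge_1 W_le_mult_l_square unfolding k_def by linarith+
  have k_pos: "0 < k" using k W_ge_1 W_le_mult_l_square by (intro gr0I) auto
  obtain \<C> where \<C>: "container_family alignment_free (grid m) \<C>"
    "card \<C> \<le> exp (300000 * W * l\<^sup>2)" "\<forall>C\<in>\<C>. real (card C) \<le> 4000 * y\<^sup>2 * real m ^ 2"
    using grid_containers[OF m_ge_3 y_bounds] unfolding W_def l_def by blast
  have few_aligned: "card {S. S \<subseteq> grid m \<and> card S = s + 1 \<and> aligned S} * p ^ (s + 1) \<le> p * real m ^ 3 / 4"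
    using s_ge_3 m_ge_3 by (rule weighted_card_aligned_subsets_le) (simp add: p_def l_def)
  have few_contained: "card \<C> * (exp 1 * (4000 * y\<^sup>2 * real m ^ 2) / k) ^ k * p ^ k \<le> p * real m ^ 3 / 4"
    using weighted_card_containers_le[OF \<C>(2) _ thinned_container_size_le W_ge_1 l_bounds(1) p_bounds(1) k(1)]
      expected_size_ge by simp
  obtain A where A: "A \<subseteq> grid m" "p * real m ^ 3 / 2 \<le> card A"
    "\<forall>S\<subseteq>A. card S = s + 1 \<longrightarrow> \<not> aligned S" "\<forall>I\<subseteq>A. alignment_free I \<longrightarrow> card I < k"
    using ex_random_grid_subset[OF p_bounds k_pos few_aligned \<C>(1) _ few_contained] \<C>(3) by blast
  have "p * real m ^ 3 / 2 = real m ^ 2 * real s / (72 * l)"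
    using m_ge_3 by (simp add: p_def power2_eq_square power3_eq_cube)
  then have "real m ^ 2 * real s \<le> 72 * l * real (card A)"
    using A(2) l_bounds by (simp add: pos_divide_le_eq mult.commute)
  moreover have "real (card I) \<le> 400000 * W * l\<^sup>2" if "I \<subseteq> A" "alignment_free I" for I
  proof -
    have "real (card I) \<le> real k" using A(4) that by (simp add: less_imp_le)
    then show ?thesis using k(2) W_ge_1 W_le_mult_l_square by simp
  qed
  ultimately show ?thesis using A(1,3) by blast
qed

lemma f_le:
  assumes n: "72 * l * real n \<le> real m ^ 2 * real s"
  shows "f n s \<le> 400000 * W * l\<^sup>2"
proof -
  obtain A where A: "A \<subseteq> grid m" "real m ^ 2 * real s \<le> 72 * l * real (card A)"
    "\<forall>S\<subseteq>A. card S = s + 1 \<longrightarrow> \<not> aligned S"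
    "\<forall>I\<subseteq>A. alignment_free I \<longrightarrow> real (card I) \<le> 400000 * W * l\<^sup>2"
    using ex_grid_subset by blast
  have "72 * l * real n \<le> 72 * l * real (card A)" using n A(2) by linarith
  then have "n \<le> card A" using l_bounds by simp
  then obtain B where B: "B \<subseteq> A" "card B = n" by (rule obtain_subset_with_card_n)
  show ?thesis
  proof (rule f_le_of_grid)
    show "2 \<le> s" using s_ge_3 by simp
    show "B \<subseteq> grid m" using B(1) A(1) by (rule subset_trans)
    show "card B = n" by (fact B(2))
    show "\<not> aligned S" if "S \<subseteq> B" "card S = s + 1" for S
      using A(3) subset_trans[OF that(1) B(1)] that(2) by blast
    show "real (card I) \<le> 400000 * W * l\<^sup>2" if "I \<subseteq> B" "alignment_free I" for I
      using A(4) subset_trans[OF that(1) B(1)] that(2) by blast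
  qed
qed

lemma W_le_of_m_le:
  assumes n: "0 < n" and c: "1 \<le> c" and m_le: "real m \<le> 10 * (sqrt (n / s) * c)"
  shows "W \<le> 100 * (n powr (5/6) / sqrt s) * c\<^sup>2"
proof -
  have pos: "0 < real m" "0 < real s" using m_ge_3 s_ge_3 by auto
  have "W = real m powr 2 / (real m powr (1/3) / real s powr (1/3))"
    using pos by (simp add: W_def y_def powr_divide powr_numeral)
  also have "\<dots> = real m powr (2 - 1/3) * real s powr (1/3)" by (simp only: powr_diff) simp
  also have "\<dots> \<le> (10 * (sqrt (n / s) * c)) powr (5/3) * real s powr (1/3)"
    using m_le pos by (intro mult_right_mono) (auto intro!: powr_mono2)
  also have "\<dots> = (10 * c) powr (5/3) * ((n / s) powr (5/6) * real s powr (1/3))"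
    using n c pos by (simp add: powr_mult powr_half_sqrt[symmetric] powr_powr)
  also have "(n / s) powr (5/6) * real s powr (1/3) = n powr (5/6) * (real s powr (1/3) / real s powr (5/6))"
    using n pos by (simp add: powr_divide)
  also have "real s powr (1/3) / real s powr (5/6) = real s powr - (1/2)" by (simp flip: powr_diff)
  also have "\<dots> = 1 / sqrt s"
    using pos by (simp add: powr_minus_divide powr_half_sqrt)
  also have "(10 * c) powr (5/3) * (n powr (5/6) * (1 / sqrt s)) \<le> (10 * c) powr 2 * (n powr (5/6) * (1 / sqrt s))"
    using c by (intro mult_right_mono powr_mono) auto
  also have "\<dots> = 100 * (n powr (5/6) / sqrt s) * c\<^sup>2"
    using c by (simp add: powr_numeral power_mult_distrib)
  finally show ?thesis .
qed

end

lemma f_le_small_s: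
  assumes n: "3 \<le> n" "10 * (sqrt (real n) * ln n) \<le> real n"
    and s: "3 \<le> s" "real s \<le> real n powr (1/3)"
  shows "f n s \<le> 40000000 * (real n powr (5/6) / sqrt s) * ln n ^ 4"
proof -
  define z where "z = sqrt (real n / real s) * ln n"
  have ln_n: "1 \<le> ln (real n)" using n(1) by (rule ln_ge_1)
  have s_z: "real s \<le> z"
  proof -
    have "real s ^ 3 \<le> (real n powr (1/3)) ^ 3" using s by (intro power_mono) auto
    also have "\<dots> = real n" using n(1) by (simp add: powr_power)
    finally have "real s ^ 2 \<le> real n / real s"
      using s by (simp add: pos_le_divide_eq eval_nat_numeral)
    then have "real s * 1 \<le> sqrt (real n / real s) * ln n"
      using ln_n by (intro mult_mono real_le_rsqrt) auto
    then show ?thesis by (simp add: z_def)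
  qed
  define m where "m = nat \<lceil>9 * z\<rceil>"
  have m_z: "9 * z \<le> real m" "real m \<le> 10 * z" using s s_z unfolding m_def by linarith+
  interpret sparse_grid s m by unfold_locales (use s m_z s_z in linarith)+
  have "z \<le> sqrt (real n) * ln n"
    unfolding z_def
    using s ln_n by (intro mult_right_mono) (auto simp: pos_divide_le_eq mult_le_cancel_left1)
  then have "real m \<le> real n" using m_z(2) n(2) by linarith
  then have l_le: "l \<le> ln n" using l_bounds by (simp add: l_def)
  have "ln n \<le> (ln n)\<^sup>2" using ln_n by (simp add: power2_eq_square)
  then have "72 * l * real n \<le> 81 * (ln n)\<^sup>2 * real n"
    using l_le ln_n by (intro mult_right_mono) auto
  also have "\<dots> = (9 * z)\<^sup>2 * real s" using s by (simp add: z_def power_mult_distrib)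
  also have "\<dots> \<le> real m ^ 2 * real s"
    using m_z(1) s_z by (intro mult_right_mono power_mono) auto
  finally have "f n s \<le> 400000 * W * l\<^sup>2" by (rule f_le)
  also have "\<dots> \<le> 400000 * (100 * (real n powr (5/6) / sqrt s) * (ln n)\<^sup>2) * (ln n)\<^sup>2"
    using W_le_of_m_le[of "real n" "ln n"] n(1) ln_n m_z(2) l_le l_bounds W_ge_1
    by (intro mult_mono power_mono) (auto simp: z_def)
  also have "\<dots> = 40000000 * (real n powr (5/6) / sqrt s) * ln n ^ 4"
    by (simp add: eval_nat_numeral)
  finally show ?thesis .
qed

lemma powr_ln_ln_over_ln:
  assumes "3 \<le> n"
  shows "real n powr (4 * ln (ln n) / ln n) = ln n ^ 4"
proof -
  have l: "1 \<le> ln (real n)" using assms by (rule ln_ge_1)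
  then have "real n powr (4 * ln (ln n) / ln n) = exp (4 * ln (ln n))"
    using assms by (simp add: powr_def)
  also have "\<dots> = exp (ln (ln n)) ^ 4" by (simp flip: exp_of_nat_mult)
  finally show ?thesis using l by simp
qed

lemma f_bigo_large_s:
  fixes s :: "nat \<Rightarrow> nat"
  assumes "\<forall>\<^sub>F n in at_top. real n powr (1/3) \<le> real (s n) \<and> s n \<le> n"
  shows "(\<lambda>n. real (f n (s n))) \<in> O(\<lambda>n. real n / real (s n))"
proof (rule bigoI)
  have "\<forall>\<^sub>F n in at_top. 1 < (n::nat)" by (rule eventually_gt_at_top)
  with assms show "\<forall>\<^sub>F n in at_top. norm (real (f n (s n))) \<le> 4 * norm (real n / real (s n))"
  proof eventually_elim
    case (elim n)
    have "1 powr (1/3) < real n powr (1/3)" using elim(2) by (intro powr_less_mono2) auto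
    then have s: "2 \<le> s n" using elim(1) by simp
    have "real n = (real n powr (1/3)) ^ 3" using elim(2) by (simp add: powr_power)
    also have "\<dots> \<le> real (s n) ^ 3" using elim(1) by (intro power_mono) auto
    finally have "n \<le> s n ^ 3" by (metis of_nat_le_iff of_nat_power)
    moreover have "1 \<le> real n / real (s n)" using elim(1) s by simp
    ultimately show ?case using f_le_rows[OF s, of n] by simp
  qed
qed

lemma f_bigo_small_s:
  fixes s :: "nat \<Rightarrow> nat"
  assumes "\<forall>\<^sub>F n in at_top. 3 \<le> s n \<and> real (s n) \<le> real n powr (1/3)"
  shows "(\<lambda>n. real (f n (s n))) \<in> O(\<lambda>n. real n powr (5/6 + 4 * ln (ln n) / ln n) / sqrt (s n))"
proof (rule bigoI)
  have "\<forall>\<^sub>F n in at_top. 10 * (sqrt (real n) * ln n) \<le> real n" by real_asymp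
  moreover have "\<forall>\<^sub>F n in at_top. 3 \<le> (n::nat)" by (rule eventually_ge_at_top)
  ultimately show "\<forall>\<^sub>F n in at_top. norm (real (f n (s n)))
      \<le> 40000000 * norm (real n powr (5/6 + 4 * ln (ln n) / ln n) / sqrt (s n))"
    using assms
  proof eventually_elim
    case (elim n)
    have "real n powr (5/6 + 4 * ln (ln n) / ln n) = real n powr (5/6) * ln n ^ 4"
      using elim(2) by (simp only: powr_add powr_ln_ln_over_ln)
    then show ?case using f_le_small_s[of n "s n"] elim by simp
  qed
qed

lemma cube_root_le_of_bigomega:
  fixes s :: "nat \<Rightarrow> nat"
  assumes "(\<lambda>n. real (s n)) \<in> \<Omega>(\<lambda>n. sqrt (real n * ln n))"
  shows "\<forall>\<^sub>F n in at_top. real n powr (1/3) \<le> real (s n)"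
proof -
  have "(\<lambda>n::nat. real n powr (1/3)) \<in> o(\<lambda>n. sqrt (real n * ln n))" by real_asymp
  also have "(\<lambda>n. sqrt (real n * ln n)) \<in> O(\<lambda>n. real (s n))"
    using assms by (simp add: bigomega_iff_bigo)
  finally have "\<forall>\<^sub>F n in at_top. norm (real n powr (1/3)) \<le> 1 * norm (real (s n))"
    by (rule landau_o.smallD) simp
  then show ?thesis by simp
qed

lemma f_bigomega_large_s:
  fixes s :: "nat \<Rightarrow> nat"
  assumes s_le: "\<forall>\<^sub>F n in at_top. s n \<le> n"
    and s_ge: "(\<lambda>n. real (s n)) \<in> \<Omega>(\<lambda>n. sqrt (real n * ln n))"
  shows "(\<lambda>n. real (f n (s n))) \<in> \<Omega>(\<lambda>n. real n / real (s n))"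
proof -
  have "(\<lambda>n. sqrt (real n * ln n)) \<in> O(\<lambda>n. real (s n))" using s_ge by (simp add: bigomega_iff_bigo)
  then obtain c
    where c: "0 < c" "\<forall>\<^sub>F n in at_top. norm (sqrt (real n * ln n)) \<le> c * norm (real (s n))"
    by (rule landau_o.bigE)
  have "\<forall>\<^sub>F n in at_top. 3 \<le> (n::nat)" by (rule eventually_ge_at_top)
  with s_le cube_root_le_of_bigomega[OF s_ge] c(2)
  have "\<forall>\<^sub>F n in at_top. norm (real n / real (s n)) \<le> (288 * c\<^sup>2 + 12) * norm (real (f n (s n)))"
  proof eventually_elim
    case (elim n)
    have "1 powr (1/3) < real n powr (1/3)" using elim(4) by (intro powr_less_mono2) auto
    then have s: "2 \<le> s n" using elim(2) by simp
    have "0 \<le> real n * ln n" using elim(4) by simp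
    then have "real n * ln n = (sqrt (real n * ln n))\<^sup>2" by simp
    also have "\<dots> \<le> (c * real (s n))\<^sup>2"
      using elim(3) \<open>0 \<le> real n * ln n\<close> by (intro power_mono) auto
    finally have "real n \<le> (288 * c\<^sup>2 + 12) * real (s n) * real (f n (s n))"
      using elim(1,4) s by (intro f_lower_bound) (auto simp: power_mult_distrib)
    then show ?case using s by (simp add: pos_divide_le_eq mult_ac)
  qed
  then have "(\<lambda>n. real n / real (s n)) \<in> O(\<lambda>n. real (f n (s n)))" by (rule bigoI)
  then show ?thesis by (simp add: bigomega_iff_bigo)
qed

theorem theorem1p1:
  "(\<forall>s :: nat \<Rightarrow> nat.
      (\<forall>\<^sub>F n in at_top. real n powr (1/3) \<le> real (s n) \<and> s n \<le> n) \<longrightarrow>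
      (\<lambda>n. real (f n (s n))) \<in> O(\<lambda>n. real n / real (s n)))
   \<and> (\<exists>\<epsilon> :: nat \<Rightarrow> real. \<epsilon> \<in> o(\<lambda>_. 1) \<and>
       (\<forall>s :: nat \<Rightarrow> nat.
          (\<forall>\<^sub>F n in at_top. 3 \<le> s n \<and> real (s n) \<le> real n powr (1/3)) \<longrightarrow>
          (\<lambda>n. real (f n (s n))) \<in> O(\<lambda>n. real n powr (5/6 + \<epsilon> n) / sqrt (real (s n)))))
   \<and> (\<forall>s :: nat \<Rightarrow> nat.
        (\<forall>\<^sub>F n in at_top. s n \<le> n) \<and>
        (\<lambda>n. real (s n)) \<in> \<Omega>(\<lambda>n. sqrt (real n * ln (real n))) \<longrightarrow>
        (\<lambda>n. real (f n (s n))) \<in> \<Theta>(\<lambda>n. real n / real (s n)))"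
proof (intro conjI exI[of _ "\<lambda>n. 4 * ln (ln (real n)) / ln (real n)"] allI impI; (elim conjE)?)
  show "(\<lambda>n. 4 * ln (ln (real n)) / ln (real n)) \<in> o(\<lambda>_. 1)" by real_asymp
next
  fix s :: "nat \<Rightarrow> nat"
  assume s: "\<forall>\<^sub>F n in at_top. s n \<le> n" "(\<lambda>n. real (s n)) \<in> \<Omega>(\<lambda>n. sqrt (real n * ln (real n)))"
  show "(\<lambda>n. real (f n (s n))) \<in> \<Theta>(\<lambda>n. real n / real (s n))"
  proof (rule bigthetaI)
    show "(\<lambda>n. real (f n (s n))) \<in> O(\<lambda>n. real n / real (s n))"
      using f_bigo_large_s cube_root_le_of_bigomega[OF s(2)] s(1) by (simp add: eventually_conj_iff)
    show "(\<lambda>n. real (f n (s n))) \<in> \<Omega>(\<lambda>n. real n / real (s n))"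
      using s by (rule f_bigomega_large_s)
  qed
qed (fact f_bigo_large_s f_bigo_small_s)+

end
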